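(* Let $\mathbf p=(p_k)_{k\ge 0}$ be a probability mass function on $\{0,1,2,\dots\}$ and let $Z\sim\mathbf p$. Let $\mathcal T_n(\mathbf p)$, $\mathcal T^*(\cdot,\mathbf p)$, $\tau$ and $\pi_{\mathbf p}$ be as in the context, and let $D$ denote the root degree (number of children of the root) of the random tree $\mathcal T^*(\tau,\mathbf p)\sim\pi_{\mathbf p}$. (a) Assume $\mathbb E[Z]<\infty$. Then the sequence $\{\mathcal T_n(\mathbf p):n\ge 1\}$ converges in probability, in the fringe sense, to $\pi_{\mathbf p}$. Moreover, for every $k\ge 0$, $$\frac1{n+1}\sum_{v\in\mathcal T_n(\mathbf p)}\mathbf 1\{\deg(v)=k+1\}\ \xrightarrow{P}\ \mathbb P(D=k)\qquad (n\to\infty).$$ (b) $\pi_{\mathbf p}$ is a fringe distribution if and only if $\mathbb E[Z]\le 1$. (c) The root degree $D$ and the size $|\mathcal T^*(\tau,\mathbf p)|$ of the limit fringe tree satisfy: (i) If $\mathbb E[Z]\le 1$ then $\mathbb E[D]=1$ and $\mathbb E[|\mathcal T^*(\tau,\mathbf p)|]=\infty$. (ii) If $\mathbb E[Z]>1$ then $\mathbb E[D]<1$ and $\mathbb E[|\mathcal T^*(\tau,\mathbf p)|]<\infty$.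
   Context: Discrete model. Let $Z_1,Z_2,\dots$ be i.i.d. with law $\mathbf p$. The random trees $\mathcal T_n=\mathcal T_n(\mathbf p)$, $n\ge1$, are rooted at $v_0$, with edges directed from children to parents. $\mathcal T_1$ has vertices $v_0,v_1$ and a directed edge from $v_1$ to $v_0$. Given $\mathcal T_n$ with vertex set $\{v_0,\dots,v_n\}$, a new vertex $v_{n+1}$ selects a vertex $V_n$ uniformly at random from $\{v_0,\dots,v_n\}$ and attaches (by a directed edge from $v_{n+1}$) to the vertex at distance $\min(Z_{n+1},\mathrm{dist}(v_0,V_n))$ from $V_n$ on the path from $V_n$ to $v_0$ (so to the root $v_0$ if $\mathrm{dist}(v_0,V_n)\le Z_{n+1}$). Here $V_n$ and $Z_{n+1}$ are independent of each other and $Z_{n+1}$ is independent of the past. $\deg(v)$ is the number of edges at $v$. Limit object. $\mathcal T^*(t,\mathbf p)$, $t\ge0$, is the continuous time tree process starting at time $0$ from a single root vertex, in which every existing vertex $v$ reproduces independently at rate one; when $v$ reproduces, an independent $Z\sim\mathbf p$ is sampled; if $Z\le\mathrm{dist}(\text{root},v)$ then a new vertex is attached as a child to the vertex $u$ on the path from $v$ to the root with $\mathrm{dist}(v,u)=Z$; if $Z>\mathrm{dist}(\text{root},v)$ nothing happens. $\tau$ is an $\mathrm{Exp}(1)$ random variable independent of $\mathcal T^*$, and $\pi_{\mathbf p}$ is the law of $\mathcal T^*(\tau,\mathbf p)$ viewed as a random a.s. finite rooted unlabeled tree. $|\mathbf t|$ is the number of vertices of $\mathbf t$. Fringe notions.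 $\mathbb T$ is the space of finite rooted trees up to root preserving isomorphism. The fringe $f_0(v,\mathbf t)$ of $\mathbf t$ at $v$ is the subtree rooted at $v$ of all vertices whose path to the root passes through $v$. A sequence of random finite rooted trees $\mathcal T_n$ (with $|\mathcal T_n|\to\infty$ in probability) converges in probability in the fringe sense to a probability measure $\pi$ on $\mathbb T$ if for every $\mathbf t\in\mathbb T$, $|\mathcal T_n|^{-1}\#\{v\in\mathcal T_n: f_0(v,\mathcal T_n)=\mathbf t\}\to\pi(\mathbf t)$ in probability. A probability measure $\pi$ on $\mathbb T$ is a fringe distribution if $\sum_{\mathbf s\in\mathbb T}\pi(\mathbf s)Q(\mathbf s,\mathbf t)=\pi(\mathbf t)$ for all $\mathbf t\in\mathbb T$, where $Q(\mathbf s,\mathbf t)$ is the number of children $v$ of the root of $\mathbf s$ with $f_0(v,\mathbf s)=\mathbf t$.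
   Formalization: Parts (b) and (c)(i) additionally assume that Z is not almost surely equal to 1; for Z = 1 a.s. the limit tree is a single vertex, so D = 0 and both claims fail although E[Z] = 1. *)

theory Defs
  imports "HOL-Probability.Probability"
begin

section \<open>Finite rooted trees up to isomorphism\<close>

text \<open>
  A finite rooted tree up to root preserving isomorphism is determined by the finite multiset of
  the (isomorphism classes of the) subtrees hanging off the children of its root.
\<close>

datatype rtree = Node (subtrees: "rtree multiset")

primrec num_vertices :: "rtree \<Rightarrow> nat" where
  "num_vertices (Node ts) = Suc (\<Sum>\<^sub># (image_mset num_vertices ts))"

definition root_degree :: "rtree \<Rightarrow> nat" where
  "root_degree t = size (subtrees t)"

text \<open>
  The number \<open>Q(s, t)\<close> of children of the root of \<open>s\<close> at which the fringe is \<open>t\<close>.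
\<close>

definition child_count :: "rtree \<Rightarrow> rtree \<Rightarrow> nat" where
  "child_count s t = count (subtrees s) t"

section \<open>Trees with vertices labelled in order of arrival\<close>

text \<open>
  A tree with vertices \<open>0, \<dots>, n\<close>, rooted at \<open>0\<close>, is represented by the list of
  length \<open>n\<close> of the parents of \<open>1, \<dots>, n\<close>, so the parent of \<open>Suc i\<close> is \<open>ps ! i\<close>.  All the trees
  below grow by attaching new vertices to existing ones, so that always \<open>ps ! i \<le> i\<close>.
\<close>

type_synonym ptree = "nat list"

definition vertices :: "ptree \<Rightarrow> nat set" where
  "vertices ps = {0..length ps}"

text \<open>The root is made its own parent so that walks towards the root can be iterated freely.\<close>

definition parent :: "ptree \<Rightarrow> nat \<Rightarrow> nat" where
  "parent ps v = (if v = 0 then 0 else ps ! (v - 1))"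

text \<open>\<open>depth ps v\<close> is the distance from \<open>v\<close> to the root.\<close>

definition depth :: "ptree \<Rightarrow> nat \<Rightarrow> nat" where
  "depth ps v = (LEAST k. (parent ps ^^ k) v = 0)"

definition edges :: "ptree \<Rightarrow> (nat \<times> nat) set" where
  "edges ps = {(Suc i, ps ! i) |i. i < length ps}"

definition vertex_degree :: "ptree \<Rightarrow> nat \<Rightarrow> nat" where
  "vertex_degree ps v = card {e \<in> edges ps. fst e = v \<or> snd e = v}"

text \<open>
  The isomorphism class of the fringe of \<open>ps\<close> at \<open>v\<close>, that is, of the subtree of \<open>v\<close> and its
  descendants.  The condition \<open>v < w\<close> on a child \<open>w\<close> is automatic when \<open>ps ! i \<le> i\<close> holds
  throughout; it is there to make the recursion terminate.  The fringe at \<open>0\<close> is the whole tree.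
\<close>

definition children :: "ptree \<Rightarrow> nat \<Rightarrow> nat set" where
  "children ps v = {w. v < w \<and> (w, v) \<in> edges ps}"

lemma children_bounds: "w \<in> children ps v \<Longrightarrow> v < w \<and> w \<le> length ps"
  by (auto simp: children_def edges_def)

lemma finite_children: "finite (children ps v)"
  by (rule finite_subset[of _ "{..length ps}"]) (auto dest: children_bounds)

function fringe :: "ptree \<Rightarrow> nat \<Rightarrow> rtree" where
  "fringe ps v = Node (image_mset (fringe ps) (mset_set (children ps v)))"
  by pat_completeness auto
termination
  by (relation "Wellfounded.measure (\<lambda>(ps, v). Suc (length ps) - v)")
     (auto dest!: children_bounds simp: finite_children)

declare fringe.simps [simp del]

section \<open>The discrete model\<close>

text \<open>
  \<open>discrete_tree p n\<close> is, for \<open>n \<ge> 1\<close>, the law of the tree with vertices \<open>0, \<dots>, n\<close>.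
\<close>

definition attach :: "nat pmf \<Rightarrow> ptree \<Rightarrow> ptree pmf" where
  "attach p ps = do {
     V \<leftarrow> pmf_of_set (vertices ps);
     Z \<leftarrow> p;
     return_pmf (ps @ [(parent ps ^^ min Z (depth ps V)) V])
   }"

definition discrete_tree :: "nat pmf \<Rightarrow> nat \<Rightarrow> ptree pmf" where
  "discrete_tree p n = ((\<lambda>\<mu>. bind_pmf \<mu> (attach p)) ^^ (n - 1)) (return_pmf [0])"

section \<open>The limit object\<close>

text \<open>
  Every potential vertex carries its own independent rate one Poisson clock with marks: a stream
  of pairs, of which the first components are the i.i.d. \<open>Exp(1)\<close> gaps between successive
  reproductions of the vertex (the first gap counted from its birth) and the second components
  are the i.i.d. samples of \<open>Z\<close> used at these reproductions.  Vertices are numbered in order of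
  birth.
\<close>

type_synonym clocks = "nat \<Rightarrow> (real \<times> nat) stream"

definition exp_law :: "real measure" where
  "exp_law = density lborel (\<lambda>x. ennreal (exponential_density 1 x))"

definition clock_space :: "nat pmf \<Rightarrow> clocks measure" where
  "clock_space p = (\<Pi>\<^sub>M v\<in>UNIV. stream_space (exp_law \<Otimes>\<^sub>M measure_pmf p))"

definition next_ring :: "clocks \<Rightarrow> nat \<Rightarrow> real" where
  "next_ring \<omega> v = fst (shd (\<omega> v))"

definition next_mark :: "clocks \<Rightarrow> nat \<Rightarrow> nat" where
  "next_mark \<omega> v = snd (shd (\<omega> v))"

definition first_to_ring :: "ptree \<Rightarrow> clocks \<Rightarrow> nat" where
  "first_to_ring ps \<omega> =
     (LEAST v. v \<in> vertices ps \<and> (\<forall>w\<in>vertices ps. next_ring \<omega> v \<le> next_ring \<omega> w))"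

text \<open>
  \<open>advance ps \<omega>\<close> moves the clocks of the vertices of \<open>ps\<close> forward to the next reproduction: the
  vertex that rings goes on to its next gap, the other vertices keep their residual waiting
  times.  The clocks of vertices not yet born do not run.
\<close>

definition advance :: "ptree \<Rightarrow> clocks \<Rightarrow> clocks" where
  "advance ps \<omega> = (\<lambda>w.
     if w = first_to_ring ps \<omega> then stl (\<omega> w)
     else if w \<in> vertices ps
     then (next_ring \<omega> w - next_ring \<omega> (first_to_ring ps \<omega>), next_mark \<omega> w) ## stl (\<omega> w)
     else \<omega> w)"

definition grow :: "ptree \<Rightarrow> nat \<Rightarrow> nat \<Rightarrow> ptree" where
  "grow ps v z = (if z \<le> depth ps v then ps @ [(parent ps ^^ z) v] else ps)"

text \<open>A state consists of the current tree, the current time, and the clocks seen from then on.\<close>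

fun reproduce :: "ptree \<times> real \<times> clocks \<Rightarrow> ptree \<times> real \<times> clocks" where
  "reproduce (ps, s, \<omega>) =
     (let v = first_to_ring ps \<omega>
      in (grow ps v (next_mark \<omega> v), s + next_ring \<omega> v, advance ps \<omega>))"

definition state_after :: "clocks \<Rightarrow> nat \<Rightarrow> ptree \<times> real \<times> clocks" where
  "state_after \<omega> k = (reproduce ^^ k) ([], 0, \<omega>)"

definition tree_after :: "clocks \<Rightarrow> nat \<Rightarrow> ptree" where
  "tree_after \<omega> k = fst (state_after \<omega> k)"

definition reproduction_time :: "clocks \<Rightarrow> nat \<Rightarrow> real" where
  "reproduction_time \<omega> k = fst (snd (state_after \<omega> k))"

text \<open>
  The process at time \<open>t\<close>; almost surely the reproduction times tend to infinity, so that the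
  \<open>LEAST\<close> is the number of reproductions up to time \<open>t\<close>.
\<close>

definition limit_tree :: "clocks \<Rightarrow> real \<Rightarrow> ptree" where
  "limit_tree \<omega> t = tree_after \<omega> (LEAST k. t < reproduction_time \<omega> (Suc k))"

definition limit_law :: "nat pmf \<Rightarrow> rtree measure" where
  "limit_law p = distr (clock_space p \<Otimes>\<^sub>M exp_law) (count_space UNIV)
     (\<lambda>(\<omega>, \<tau>). fringe (limit_tree \<omega> \<tau>) 0)"

section \<open>Convergence and fringe distributions\<close>

text \<open>
  Convergence in probability to a constant only involves the laws of the individual variables,
  so that the \<open>X n\<close> may live on different probability spaces.
\<close>

definition conv_in_prob :: "(nat \<Rightarrow> 'a pmf) \<Rightarrow> (nat \<Rightarrow> 'a \<Rightarrow> real) \<Rightarrow> real \<Rightarrow> bool" where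
  "conv_in_prob \<mu> X c \<longleftrightarrow>
     (\<forall>\<epsilon>>0. (\<lambda>n. measure_pmf.prob (\<mu> n) {x. \<bar>X n x - c\<bar> > \<epsilon>}) \<longlonglongrightarrow> 0)"

definition size_to_infinity :: "(nat \<Rightarrow> ptree pmf) \<Rightarrow> bool" where
  "size_to_infinity \<mu> \<longleftrightarrow>
     (\<forall>K. (\<lambda>n. measure_pmf.prob (\<mu> n) {ps. card (vertices ps) \<le> K}) \<longlonglongrightarrow> 0)"

definition tree_prob :: "rtree measure \<Rightarrow> bool" where
  "tree_prob \<pi> \<longleftrightarrow> prob_space \<pi> \<and> sets \<pi> = UNIV"

definition fringe_converges :: "(nat \<Rightarrow> ptree pmf) \<Rightarrow> rtree measure \<Rightarrow> bool" where
  "fringe_converges \<mu> \<pi> \<longleftrightarrow> tree_prob \<pi> \<and> size_to_infinity \<mu> \<and>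
     (\<forall>t. conv_in_prob \<mu>
        (\<lambda>_ ps. real (card {v \<in> vertices ps. fringe ps v = t}) / real (card (vertices ps)))
        (measure \<pi> {t}))"

text \<open>
  The sum over all trees has nonnegative terms; \<open>has_sum\<close> includes its finiteness.
\<close>

definition fringe_distribution :: "rtree measure \<Rightarrow> bool" where
  "fringe_distribution \<pi> \<longleftrightarrow> tree_prob \<pi> \<and>
     (\<forall>t. ((\<lambda>s. measure \<pi> {s} * real (child_count s t)) has_sum measure \<pi> {t}) UNIV)"

text \<open>Means of nonnegative integer variables, possibly infinite.\<close>

definition mean :: "'a measure \<Rightarrow> ('a \<Rightarrow> nat) \<Rightarrow> ennreal" where
  "mean M X = (\<integral>\<^sup>+ x. of_nat (X x) \<partial>M)"

end

theory Submission
  imports Defs "HOL-Real_Asymp.Real_Asymp"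
begin

text \<open>
  The reason behind all parts of the theorem is that a fringe grows by itself.  Suppose that a new
  vertex arrives through the uniform vertex \<open>V\<close> and the jump \<open>Z\<close>.  The fringe at a vertex \<open>v\<close> other
  than the root changes only if \<open>V\<close> lies in it and \<open>Z\<close> is at most the distance from \<open>v\<close> to \<open>V\<close>, and
  then it changes by the rule \<^const>\<open>grow\<close> that drives the limit process
  (\<open>labelled_fringe_attach\<close>).

  \<^emph>\<open>Law of large numbers.\<close>  Number the vertices of a fringe in order of arrival.  A numbered tree
  \<open>q\<close> can only arise from \<open>q\<close> itself or from \<open>butlast q\<close>.  Let \<open>X(q)\<close> count the vertices, other
  than the root, with numbered fringe \<open>q\<close>, write \<open>|q|\<close> for the number of vertices of \<open>q\<close>, and let
  \<open>K(s, q)\<close> be the rate at which \<open>s\<close> turns into \<open>q\<close> when all its vertices reproduce at rate one.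
  When the tree has \<open>n + 1\<close> vertices, the conditional mean of the change of \<open>X(q)\<close> is
  \<open>[q = []] + (K(butlast q, q) X(butlast q) - (|q| - K(q, q)) X(q)) / (n + 1)\<close>.  The changes are
  bounded, and the system is triangular, so a second moment estimate (\<open>stochastic_approximation\<close>)
  yields, by induction on \<open>q\<close>, that \<open>X(q) / n\<close> tends to \<open>\<nu>(q)\<close>, where \<open>\<nu>\<close> is the solution of
  \<open>(|q| + 1) \<nu>(q) = [q = []] + K(q, q) \<nu>(q) + K(butlast q, q) \<nu>(butlast q)\<close>.

  \<^emph>\<open>The limit law.\<close>  While the limit process is in the state \<open>q\<close>, the residual waiting times of its
  \<open>|q|\<close> clocks and the residual value of \<open>\<tau>\<close> are \<open>|q| + 1\<close> independent \<open>Exp(1)\<close> variables.  Hence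
  each of them is the first to elapse with probability \<open>1 / (|q| + 1)\<close>, and after a reproduction
  everything starts afresh (\<open>nn_integral_step\<close>).  So the tree at time \<open>\<tau>\<close> is the last state of a
  killed Markov chain on numbered trees, and its law solves the equation for \<open>\<nu>\<close>
  (\<open>tree_law_balance\<close>).  This gives the convergence of the fringe frequencies; the limit is a
  probability measure, so there is also convergence for infinite sets of trees, such as that of
  the trees of a given root degree.

  \<^emph>\<open>Means.\<close>  Let \<open>a d\<close> be the mean number of vertices at distance \<open>d\<close> from the root in the limit
  tree, so that the mean root degree is \<open>a 1\<close> and the mean size is the sum of all \<open>a d\<close>.  A vertex
  at depth \<open>e\<close> which reproduces with \<open>Z = z \<le> e\<close> adds a vertex at depth \<open>e - z + 1\<close>, whence
  \<open>a 0 = 1\<close> and \<open>a d = (\<Sum>j. p j * a (d - 1 + j))\<close> for \<open>d \<ge> 1\<close>.  The functions \<open>x ^ d\<close> are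
  supersolutions if \<open>(\<Sum>j. p j * x ^ j) \<le> x\<close>, which is the inequality for the extinction
  probability of a branching process with offspring law \<open>p\<close>.  A maximum principle then gives
  \<open>a d \<le> x ^ d\<close>.  If \<open>E Z > 1\<close>, some \<open>x < 1\<close> will do, and the means are below \<open>1\<close> and finite.  If
  \<open>E Z \<le> 1\<close> and \<open>Z\<close> is not constantly \<open>1\<close>, then \<open>x = 1\<close> gives \<open>a \<le> 1\<close>, and comparison of \<open>1 - a\<close>
  with small multiples of the supersolution \<open>d\<close> gives \<open>a = 1\<close>.

  \<^emph>\<open>Fringe distributions.\<close>  A vertex has at most one parent, so the empirical frequencies \<open>F\<close> of the
  fringes satisfy \<open>(\<Sum>s\<in>G. F(s) Q(s, t)) \<le> F(t)\<close> for finite sets \<open>G\<close>, and in the limit \<open>\<pi> Q \<le> \<pi>\<close>.  The total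
  masses of the two sides are \<open>E D\<close> and \<open>1\<close>.  Hence \<open>\<pi>\<close> is a fringe distribution precisely when
  \<open>E D = 1\<close>.
\<close>

section \<open>Trees whose labels increase away from the root\<close>

text \<open>
  The trees produced by attaching vertices one at a time.  Parents have smaller labels than their
  children, which allows induction along the labels as well as along the list of parents.
\<close>

definition increasing_tree :: "ptree \<Rightarrow> bool" where
  "increasing_tree ps \<longleftrightarrow> (\<forall>i<length ps. ps ! i \<le> i)"

lemma increasing_tree_Nil [simp]: "increasing_tree []"
  by (simp add: increasing_tree_def)

lemma increasing_tree_snoc [simp]:
  "increasing_tree (ps @ [u]) \<longleftrightarrow> increasing_tree ps \<and> u \<le> length ps"
  by (auto simp: increasing_tree_def nth_append less_Suc_eq)

lemma mem_vertices [simp]: "v \<in> vertices ps \<longleftrightarrow> v \<le> length ps"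
  by (simp add: vertices_def)

lemma finite_vertices [simp]: "finite (vertices ps)"
  by (simp add: vertices_def)

lemma card_vertices [simp]: "card (vertices ps) = Suc (length ps)"
  by (simp add: vertices_def)

lemma vertices_nonempty [simp]: "vertices ps \<noteq> {}"
  by (simp add: vertices_def)

lemma parent_0 [simp]: "parent ps 0 = 0"
  by (simp add: parent_def)

lemma funpow_parent_0 [simp]: "(parent ps ^^ k) 0 = 0"
  by (induction k) auto

lemma parent_less: "increasing_tree ps \<Longrightarrow> v \<le> length ps \<Longrightarrow> 0 < v \<Longrightarrow> parent ps v < v"
  by (cases v) (auto simp: parent_def increasing_tree_def le_imp_less_Suc)

lemma parent_le: "increasing_tree ps \<Longrightarrow> v \<le> length ps \<Longrightarrow> parent ps v \<le> v"
  using parent_less[of ps v] by (cases "v = 0") auto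

lemma funpow_parent_le:
  assumes "increasing_tree ps" "v \<le> length ps"
  shows "(parent ps ^^ k) v \<le> v"
proof (induction k)
  case (Suc k)
  then show ?case using parent_le[of ps "(parent ps ^^ k) v"] assms by simp
qed simp

lemma parent_snoc_old [simp]: "v \<le> length ps \<Longrightarrow> parent (ps @ [u]) v = parent ps v"
  by (cases v) (auto simp: parent_def nth_append)

lemma parent_snoc_new [simp]: "parent (ps @ [u]) (Suc (length ps)) = u"
  by (simp add: parent_def)

lemma funpow_parent_snoc:
  assumes "increasing_tree ps" "v \<le> length ps"
  shows "(parent (ps @ [u]) ^^ k) v = (parent ps ^^ k) v"
proof (induction k)
  case (Suc k)
  then show ?case using funpow_parent_le[OF assms, of k] assms by simp
qed simp

lemma ex_funpow_parent_eq_0: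
  assumes "increasing_tree ps" "v \<le> length ps"
  shows "\<exists>k. (parent ps ^^ k) v = 0"
  using assms(2)
proof (induction v rule: less_induct)
  case (less v)
  show ?case
  proof (cases "v = 0")
    case False
    then have "parent ps v < v" using parent_less[OF assms(1) less.prems] by simp
    then obtain k where "(parent ps ^^ k) (parent ps v) = 0"
      using less.IH[of "parent ps v"] less.prems by auto
    then have "(parent ps ^^ Suc k) v = 0" by (simp add: funpow_swap1)
    then show ?thesis by blast
  qed auto
qed

lemma depth_0 [simp]: "depth ps 0 = 0"
  by (simp add: depth_def)

lemma depth_Suc:
  assumes "increasing_tree ps" "v \<le> length ps" "0 < v"
  shows "depth ps v = Suc (depth ps (parent ps v))"
proof -
  obtain k where "(parent ps ^^ k) v = 0" using ex_funpow_parent_eq_0 assms by blast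
  then have "(LEAST k. (parent ps ^^ k) v = 0) = Suc (LEAST k. (parent ps ^^ Suc k) v = 0)"
    by (rule Least_Suc) (use assms in simp)
  then show ?thesis by (simp add: depth_def funpow_swap1)
qed

lemma depth_snoc_old [simp]:
  "increasing_tree ps \<Longrightarrow> v \<le> length ps \<Longrightarrow> depth (ps @ [u]) v = depth ps v"
  by (simp add: depth_def funpow_parent_snoc)

lemma depth_snoc_new [simp]:
  "increasing_tree ps \<Longrightarrow> u \<le> length ps \<Longrightarrow> depth (ps @ [u]) (Suc (length ps)) = Suc (depth ps u)"
  by (subst depth_Suc) auto

lemma depth_eq_0_iff: "increasing_tree ps \<Longrightarrow> v \<le> length ps \<Longrightarrow> depth ps v = 0 \<longleftrightarrow> v = 0"
  using depth_Suc[of ps v] by (cases "v = 0") auto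

lemma depth_funpow_parent:
  assumes "increasing_tree ps" "v \<le> length ps" "k \<le> depth ps v"
  shows "depth ps ((parent ps ^^ k) v) = depth ps v - k"
  using assms(3)
proof (induction k)
  case (Suc k)
  let ?w = "(parent ps ^^ k) v"
  have w: "?w \<le> length ps" using funpow_parent_le[OF assms(1,2), of k] assms(2) by linarith
  have d: "depth ps ?w = depth ps v - k" using Suc by simp
  then have "depth ps ?w > 0" using Suc.prems by simp
  then have "?w > 0" by (metis depth_0 gr0I less_irrefl)
  then show ?case using depth_Suc[OF assms(1) w] d by simp
qed simp

text \<open>
  The root is its own parent, so walks only reach \<open>0\<close> after exactly \<^term>\<open>depth ps v\<close> steps.
\<close>

lemma depth_parent_iter_less:
  assumes "increasing_tree ps" "v \<le> length ps" "k < depth ps v"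
  shows "0 < (parent ps ^^ k) v"
  using assms(3) not_less_Least[of k "\<lambda>k. (parent ps ^^ k) v = 0"]
  by (simp add: depth_def)

lemma increasing_tree_grow: "increasing_tree ps \<Longrightarrow> v \<le> length ps \<Longrightarrow> increasing_tree (grow ps v z)"
  using funpow_parent_le[of ps v z] by (auto simp: grow_def)

lemma length_grow: "length (grow ps v z) \<le> Suc (length ps)"
  by (simp add: grow_def)

lemma grow_cases: "grow ps v z = ps \<or> ps = butlast (grow ps v z) \<and> grow ps v z \<noteq> []"
  by (auto simp: grow_def)

definition level_size :: "ptree \<Rightarrow> nat \<Rightarrow> nat" where
  "level_size ps d = card {v \<in> vertices ps. depth ps v = d}"

lemma level_size_Nil: "level_size [] d = of_bool (d = 0)"
proof -
  have "{v \<in> vertices []. depth [] v = d} = (if d = 0 then {0} else {})" by auto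
  then show ?thesis by (simp add: level_size_def)
qed

lemma level_size_snoc:
  assumes "increasing_tree ps" "u \<le> length ps"
  shows "level_size (ps @ [u]) d = level_size ps d + of_bool (d = Suc (depth ps u))"
proof -
  have "{v \<in> vertices (ps @ [u]). depth (ps @ [u]) v = d} =
     {v \<in> vertices ps. depth ps v = d} \<union> (if d = Suc (depth ps u) then {Suc (length ps)} else {})"
    using assms by (auto simp: le_Suc_eq)
  then show ?thesis by (simp add: level_size_def)
qed

text \<open>
  The new vertex hangs below the vertex at depth \<open>depth ps v - z\<close>.  Writing the condition on \<open>d\<close>
  additively avoids truncated subtraction.
\<close>

lemma level_size_grow:
  assumes "increasing_tree ps" "v \<le> length ps"
  shows "level_size (grow ps v z) d =
    level_size ps d + of_bool (z \<le> depth ps v \<and> d + z = Suc (depth ps v))"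
proof (cases "z \<le> depth ps v")
  case True
  then have "depth ps ((parent ps ^^ z) v) = depth ps v - z"
    using depth_funpow_parent[OF assms] by simp
  moreover have "(parent ps ^^ z) v \<le> length ps"
    using funpow_parent_le[OF assms, of z] assms by linarith
  ultimately show ?thesis using True assms
    by (auto simp: grow_def level_size_snoc)
qed (auto simp: grow_def)

lemma level_size_0: "increasing_tree ps \<Longrightarrow> level_size ps 0 = 1"
proof -
  assume "increasing_tree ps"
  then have "{v \<in> vertices ps. depth ps v = 0} = {0}" using depth_eq_0_iff by auto
  then show ?thesis by (simp add: level_size_def)
qed

lemma depth_le: "increasing_tree ps \<Longrightarrow> v \<le> length ps \<Longrightarrow> depth ps v \<le> v"
proof (induction v rule: less_induct)
  case (less v)
  show ?case
  proof (cases "v = 0")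
    case False
    then show ?thesis
      using less.IH[of "parent ps v"] less.prems parent_less[of ps v] depth_Suc[of ps v] by simp
  qed simp
qed

lemma sum_over_levels:
  assumes "increasing_tree ps" "length ps \<le> m"
  shows "(\<Sum>v\<in>vertices ps. f (depth ps v)) = (\<Sum>d\<le>m. real (level_size ps d) * f d)"
proof -
  have "(\<Sum>v\<in>vertices ps. f (depth ps v)) =
      (\<Sum>d\<le>m. sum (\<lambda>v. f (depth ps v)) {v \<in> vertices ps. depth ps v = d})"
    using assms by (subst sum.group) (auto intro: order_trans[OF depth_le[OF assms(1)]])
  also have "\<dots> = (\<Sum>d\<le>m. real (level_size ps d) * f d)"
    by (simp add: level_size_def)
  finally show ?thesis .
qed

lemma level_size_eq_0: "increasing_tree ps \<Longrightarrow> length ps < d \<Longrightarrow> level_size ps d = 0"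
proof -
  assume *: "increasing_tree ps" "length ps < d"
  have "{v \<in> vertices ps. depth ps v = d} = {}" using depth_le[OF *(1)] *(2) by fastforce
  then show ?thesis by (simp only: level_size_def card.empty)
qed

section \<open>Fringes numbered in order of arrival\<close>

definition descendants :: "ptree \<Rightarrow> nat \<Rightarrow> nat list" where
  "descendants ps v = filter (\<lambda>w. \<exists>k. (parent ps ^^ k) w = v) [v..<Suc (length ps)]"

definition position :: "'a list \<Rightarrow> 'a \<Rightarrow> nat" where
  "position xs x = length (takeWhile (\<lambda>y. y \<noteq> x) xs)"

lemma position_less: "x \<in> set xs \<Longrightarrow> position xs x < length xs"
  unfolding position_def by (induction xs) auto

lemma nth_position: "x \<in> set xs \<Longrightarrow> xs ! position xs x = x"
  unfolding position_def by (induction xs) auto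

lemma position_nth: "distinct xs \<Longrightarrow> i < length xs \<Longrightarrow> position xs (xs ! i) = i"
  by (meson nth_eq_iff_index_eq nth_mem nth_position position_less)

lemma position_append: "x \<in> set xs \<Longrightarrow> position (xs @ ys) x = position xs x"
  unfolding position_def by (induction xs) auto

text \<open>
  Renumbering the descendants of \<open>v\<close> in order of arrival keeps the history of the fringe: its last
  entry belongs to the youngest descendant, so that the previous value of a fringe that has just
  grown is recovered by \<^const>\<open>butlast\<close>.  The isomorphism class alone has many predecessors.
\<close>

definition labelled_fringe :: "ptree \<Rightarrow> nat \<Rightarrow> ptree" where
  "labelled_fringe ps v =
     map (\<lambda>w. position (descendants ps v) (parent ps w)) (tl (descendants ps v))"

lemma mem_descendants:
  assumes "increasing_tree ps"
  shows "w \<in> set (descendants ps v) \<longleftrightarrow> w \<le> length ps \<and> (\<exists>k. (parent ps ^^ k) w = v)"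
  using funpow_parent_le[OF assms] by (auto simp: descendants_def intro: order_trans less_Suc_eq_le[THEN iffD2])

lemma descendantsI:
  "increasing_tree ps \<Longrightarrow> w \<le> length ps \<Longrightarrow> (parent ps ^^ k) w = v \<Longrightarrow> w \<in> set (descendants ps v)"
  by (auto simp: mem_descendants)

lemma descendants_Cons: "v \<le> length ps \<Longrightarrow> descendants ps v = v # tl (descendants ps v)"
proof -
  assume "v \<le> length ps"
  moreover have "\<exists>k. (parent ps ^^ k) v = v" by (rule exI[of _ 0]) simp
  ultimately show ?thesis by (simp add: descendants_def upt_conv_Cons del: upt_Suc)
qed

lemma descendants_nonempty: "v \<le> length ps \<Longrightarrow> descendants ps v \<noteq> []"
  using descendants_Cons[of v ps] by auto

lemma sorted_descendants: "sorted_wrt (<) (descendants ps v)"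
  unfolding descendants_def by (intro sorted_wrt_filter sorted_wrt_upt)

lemma distinct_descendants [simp]: "distinct (descendants ps v)"
  by (simp add: descendants_def)

lemma nth_descendants_0: "v \<le> length ps \<Longrightarrow> descendants ps v ! 0 = v"
  by (subst descendants_Cons) auto

lemma length_labelled_fringe:
  "v \<le> length ps \<Longrightarrow> Suc (length (labelled_fringe ps v)) = length (descendants ps v)"
  using descendants_nonempty[of v ps] by (simp add: labelled_fringe_def)

lemma descendants_snoc:
  assumes "increasing_tree ps" "u \<le> length ps" "v \<le> length ps"
  shows "descendants (ps @ [u]) v =
    descendants ps v @ (if u \<in> set (descendants ps v) then [Suc (length ps)] else [])"
proof -
  have ex: "(\<exists>k. (parent (ps @ [u]) ^^ k) (Suc (length ps)) = v) \<longleftrightarrow> u \<in> set (descendants ps v)"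
  proof
    assume "\<exists>k. (parent (ps @ [u]) ^^ k) (Suc (length ps)) = v"
    then obtain k where k: "(parent (ps @ [u]) ^^ k) (Suc (length ps)) = v" by blast
    have "k \<noteq> 0" using k assms(3) by (intro notI) simp
    then obtain j where "k = Suc j" by (cases k) auto
    with k have "(parent ps ^^ j) u = v"
      by (simp add: funpow_swap1 funpow_parent_snoc assms)
    then show "u \<in> set (descendants ps v)" using assms by (auto simp: mem_descendants)
  next
    assume "u \<in> set (descendants ps v)"
    then obtain j where "(parent ps ^^ j) u = v" using assms by (auto simp: mem_descendants)
    then have "(parent (ps @ [u]) ^^ Suc j) (Suc (length ps)) = v"
      by (simp add: funpow_swap1 funpow_parent_snoc assms)
    then show "\<exists>k. (parent (ps @ [u]) ^^ k) (Suc (length ps)) = v" by blast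
  qed
  have "filter (\<lambda>w. \<exists>k. (parent (ps @ [u]) ^^ k) w = v) [v..<Suc (length ps)] = descendants ps v"
    unfolding descendants_def
    by (rule filter_cong) (auto simp: funpow_parent_snoc assms)
  moreover have "[v..<Suc (length (ps @ [u]))] = [v..<Suc (length ps)] @ [Suc (length ps)]"
    using assms(3) by simp
  ultimately show ?thesis
    using ex unfolding descendants_def[of "ps @ [u]"] by simp
qed

lemma descendants_parent:
  assumes "increasing_tree ps" "w \<in> set (descendants ps v)" "w \<noteq> v"
  shows "parent ps w \<in> set (descendants ps v)"
proof -
  obtain k where k: "(parent ps ^^ k) w = v" and w: "w \<le> length ps"
    using assms by (auto simp: mem_descendants)
  with assms(3) obtain j where "k = Suc j" by (cases k) auto
  with k have "(parent ps ^^ j) (parent ps w) = v" by (simp add: funpow_swap1)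
  moreover have "parent ps w \<le> length ps" using parent_le[OF assms(1) w] w by simp
  ultimately show ?thesis using assms(1) by (auto simp: mem_descendants)
qed

lemma labelled_fringe_snoc:
  assumes "increasing_tree ps" "u \<le> length ps" "v \<le> length ps"
  shows "labelled_fringe (ps @ [u]) v =
    (if u \<in> set (descendants ps v)
     then labelled_fringe ps v @ [position (descendants ps v) u]
     else labelled_fringe ps v)"
proof -
  let ?L = "descendants ps v"
  have tl: "w \<in> set ?L \<and> w \<le> length ps \<and> w \<noteq> v" if "w \<in> set (tl ?L)" for w
    using that descendants_Cons[OF assms(3)] distinct_descendants[of ps v] assms(1)
    by (metis distinct.simps(2) list.set_sel(2) mem_descendants tl_Nil)
  then have *: "map (\<lambda>w. position (?L @ ys) (parent (ps @ [u]) w)) (tl ?L) = labelled_fringe ps v" for ys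
    unfolding labelled_fringe_def
    by (auto intro!: position_append descendants_parent assms(1))
  show ?thesis
    using descendants_nonempty[OF assms(3)] *
    unfolding labelled_fringe_def[of "ps @ [u]"] descendants_snoc[OF assms]
    by (auto simp: position_append)
qed

lemma labelled_fringe_new:
  "labelled_fringe (ps @ [u]) (Suc (length ps)) = []"
proof -
  have "length (descendants (ps @ [u]) (Suc (length ps))) \<le> 1"
    unfolding descendants_def by (rule order_trans[OF length_filter_le]) simp
  then have "tl (descendants (ps @ [u]) (Suc (length ps))) = []"
    by (cases "descendants (ps @ [u]) (Suc (length ps))") auto
  then show ?thesis by (simp add: labelled_fringe_def)
qed

lemma nth_descendants_parent:
  assumes "increasing_tree ps" "v \<le> length ps" "0 < i" "i < length (descendants ps v)"
  shows "parent ps (descendants ps v ! i) \<in> set (descendants ps v)"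
    and "parent (labelled_fringe ps v) i = position (descendants ps v) (parent ps (descendants ps v ! i))"
    and "descendants ps v ! parent (labelled_fringe ps v) i = parent ps (descendants ps v ! i)"
proof -
  let ?L = "descendants ps v"
  have "?L ! i \<noteq> v"
    using sorted_wrt_nth_less[OF sorted_descendants, of 0 i ps v] nth_descendants_0[OF assms(2)] assms
    by simp
  then show 1: "parent ps (?L ! i) \<in> set ?L"
    using assms by (intro descendants_parent) auto
  show 2: "parent (labelled_fringe ps v) i = position ?L (parent ps (?L ! i))"
  proof -
    have "parent (labelled_fringe ps v) i = labelled_fringe ps v ! (i - 1)"
      using assms(3) by (simp add: parent_def)
    then show ?thesis using assms(3,4) by (simp add: labelled_fringe_def nth_tl)
  qed
  show "?L ! parent (labelled_fringe ps v) i = parent ps (?L ! i)"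
    using 1 by (simp add: 2 nth_position)
qed

lemma increasing_tree_labelled_fringe:
  assumes "increasing_tree ps" "v \<le> length ps"
  shows "increasing_tree (labelled_fringe ps v)"
  unfolding increasing_tree_def
proof (intro allI impI)
  let ?L = "descendants ps v" and ?q = "labelled_fringe ps v"
  fix j assume j: "j < length ?q"
  then have i: "Suc j < length ?L" using length_labelled_fringe[OF assms(2)] by simp
  note * = nth_descendants_parent[OF assms _ i, simplified]
  have "?L ! Suc j \<le> length ps" using i assms(1) by (metis mem_descendants nth_mem)
  moreover have "?L ! Suc j > ?L ! 0"
    using sorted_wrt_nth_less[OF sorted_descendants, of 0 "Suc j" ps v] i by simp
  ultimately have "parent ps (?L ! Suc j) < ?L ! Suc j"
    using parent_less[OF assms(1)] by simp
  then have "?L ! parent ?q (Suc j) < ?L ! Suc j" using *(3) by simp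
  moreover have "parent ?q (Suc j) < length ?L"
    using *(1,2) position_less by metis
  ultimately have "parent ?q (Suc j) < Suc j"
    by (metis i linorder_neqE_nat less_asym less_irrefl sorted_wrt_nth_less[OF sorted_descendants])
  then show "?q ! j \<le> j" by (simp add: parent_def)
qed

lemma funpow_parent_labelled_fringe:
  assumes "increasing_tree ps" "v \<le> length ps" "i < length (descendants ps v)"
    and "k \<le> depth (labelled_fringe ps v) i"
  shows "descendants ps v ! ((parent (labelled_fringe ps v) ^^ k) i) =
    (parent ps ^^ k) (descendants ps v ! i)"
  using assms(4)
proof (induction k)
  case (Suc k)
  let ?q = "labelled_fringe ps v"
  have inc: "increasing_tree ?q" by (rule increasing_tree_labelled_fringe) fact+
  have i: "i \<le> length ?q" using length_labelled_fringe[OF assms(2)] assms(3) by simp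
  have "(parent ?q ^^ k) i > 0"
    using depth_parent_iter_less[OF inc i, of k] Suc.prems by simp
  moreover have "(parent ?q ^^ k) i < length (descendants ps v)"
    using funpow_parent_le[OF inc i, of k] assms(3) by simp
  ultimately show ?case
    using nth_descendants_parent(3)[OF assms(1,2)] Suc by simp
qed simp

lemma depth_labelled_fringe:
  assumes "increasing_tree ps" "v \<le> length ps"
  shows "i < length (descendants ps v) \<Longrightarrow>
    depth ps (descendants ps v ! i) = depth (labelled_fringe ps v) i + depth ps v"
proof (induction i rule: less_induct)
  case (less i)
  let ?q = "labelled_fringe ps v" and ?L = "descendants ps v"
  show ?case
  proof (cases "i = 0")
    case True
    then show ?thesis using nth_descendants_0[OF assms(2)] by simp
  next
    case False
    have inc: "increasing_tree ?q" by (rule increasing_tree_labelled_fringe) fact+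
    have i: "i \<le> length ?q" using length_labelled_fringe[OF assms(2)] less.prems by simp
    have lt: "parent ?q i < i" using parent_less[OF inc i] False by simp
    have "?L ! i \<le> length ps" using less.prems assms(1) by (metis mem_descendants nth_mem)
    moreover have "?L ! i > ?L ! 0"
      using sorted_wrt_nth_less[OF sorted_descendants, of 0 i ps v] less.prems False by simp
    ultimately have "depth ps (?L ! i) = Suc (depth ps (parent ps (?L ! i)))"
      using assms by (intro depth_Suc) auto
    also have "parent ps (?L ! i) = ?L ! parent ?q i"
      using nth_descendants_parent(3)[OF assms _ less.prems] False by simp
    also have "depth ps (?L ! parent ?q i) = depth ?q (parent ?q i) + depth ps v"
      using less.IH[OF lt] lt less.prems by simp
    also have "Suc \<dots> = depth ?q i + depth ps v"
      using depth_Suc[OF inc i] False by simp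
    finally show ?thesis .
  qed
qed

lemma funpow_parent_mem_descendants:
  assumes "increasing_tree ps" "V \<le> length ps" "(parent ps ^^ k) V \<in> set (descendants ps v)"
  shows "V \<in> set (descendants ps v)"
proof -
  obtain j where "(parent ps ^^ j) ((parent ps ^^ k) V) = v"
    using assms by (auto simp: mem_descendants)
  then have "(parent ps ^^ (j + k)) V = v" by (simp add: funpow_add)
  then show ?thesis using assms by (auto simp: mem_descendants)
qed

lemma depth_mem_descendants:
  assumes "increasing_tree ps" "v \<le> length ps" "w \<in> set (descendants ps v)"
  shows "depth ps v \<le> depth ps w"
  using depth_labelled_fringe[OF assms(1,2)] assms(3) by (metis in_set_conv_nth le_add2)

text \<open>
  The fringe at a vertex other than the root follows the rule of the limit process.  If \<open>V\<close> is at
  depth \<open>e\<close> in this fringe and \<open>z \<le> e\<close>, then the walk of \<open>z\<close> steps from \<open>V\<close> stays in the fringe,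
  where it can be followed in the renumbered tree.  If \<open>z > e\<close>, it ends at a vertex above \<open>v\<close>, or at
  the root, where it is stopped; for \<open>v \<noteq> 0\<close> neither belongs to the fringe.
\<close>

lemma labelled_fringe_attach:
  fixes z :: nat
  assumes "increasing_tree ps" "0 < v" "v \<le> length ps" "V \<le> length ps"
  defines "u \<equiv> (parent ps ^^ min z (depth ps V)) V"
  shows "labelled_fringe (ps @ [u]) v =
    (if V \<in> set (descendants ps v)
     then grow (labelled_fringe ps v) (position (descendants ps v) V) z
     else labelled_fringe ps v)"
proof -
  let ?q = "labelled_fringe ps v" and ?L = "descendants ps v"
  define i where "i = position ?L V"
  have u: "u \<le> length ps"
    unfolding u_def using funpow_parent_le[OF assms(1,4)] assms(4) order_trans by blast
  note snoc = labelled_fringe_snoc[OF assms(1) u assms(3)]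
  show ?thesis
  proof (cases "V \<in> set ?L")
    case False
    then have "u \<notin> set ?L" unfolding u_def using funpow_parent_mem_descendants[OF assms(1,4)] by blast
    with False show ?thesis by (simp add: snoc)
  next
    case True
    then have i: "i < length ?L" "?L ! i = V" by (auto simp: i_def position_less nth_position)
    have d: "depth ps V = depth ?q i + depth ps v"
      using depth_labelled_fringe[OF assms(1,3) i(1)] i(2) by simp
    have dv: "0 < depth ps v" using depth_eq_0_iff[OF assms(1,3)] assms(2) by simp
    show ?thesis
    proof (cases "z \<le> depth ?q i")
      case z: True
      then have "u = (parent ps ^^ z) (?L ! i)" by (simp add: u_def i d)
      also have "\<dots> = ?L ! ((parent ?q ^^ z) i)"
        using funpow_parent_labelled_fringe[OF assms(1,3) i(1) z] by simp
      finally have u': "u = ?L ! ((parent ?q ^^ z) i)" .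
      have "(parent ?q ^^ z) i \<le> i"
        by (rule funpow_parent_le[OF increasing_tree_labelled_fringe[OF assms(1,3)]])
          (use i length_labelled_fringe[OF assms(3)] in simp)
      then have less: "(parent ?q ^^ z) i < length ?L" using i by simp
      then have "u \<in> set ?L" using u' by simp
      moreover have "position ?L u = (parent ?q ^^ z) i"
        unfolding u' using less by (intro position_nth) auto
      ultimately show ?thesis using True z by (simp add: snoc grow_def i_def[symmetric])
    next
      case z: False
      have "depth ps u = depth ps V - min z (depth ps V)"
        unfolding u_def by (rule depth_funpow_parent[OF assms(1,4)]) simp
      also have "\<dots> < depth ps v" using z d dv by simp
      finally have "u \<notin> set ?L" using depth_mem_descendants[OF assms(1,3)] by fastforce
      then show ?thesis using True z by (simp add: snoc grow_def i_def[symmetric])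
    qed
  qed
qed

text \<open>
  The fringes at the ancestors of \<open>u\<close> form a strictly increasing chain, so no two have the same
  size.  A new vertex attached to \<open>u\<close> therefore changes at most one fringe of each size.
\<close>

lemma ancestors_of_same_size:
  assumes "increasing_tree ps"
  shows "card {v \<in> {1..length ps}. u \<in> set (descendants ps v) \<and> length (descendants ps v) = m} \<le> 1"
proof -
  have *: "length (descendants ps v) < length (descendants ps w)"
    if "u \<in> set (descendants ps w)" "(parent ps ^^ i) u = v" "(parent ps ^^ j) u = w"
      "v \<le> length ps" "w \<le> length ps" "v \<noteq> w" "i \<le> j" for v w i j
  proof -
    have "(parent ps ^^ (j - i)) ((parent ps ^^ i) u) = w"
      using that by (metis comp_apply funpow_add le_add_diff_inverse2)
    then have v: "(parent ps ^^ (j - i)) v = w" using that by simp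
    have "w \<le> v" using funpow_parent_le[OF assms that(4), of "j - i"] v by simp
    then have "w < v" using that by simp
    have "set (descendants ps v) \<subseteq> set (descendants ps w)"
    proof
      fix x assume "x \<in> set (descendants ps v)"
      then obtain k where k: "(parent ps ^^ k) x = v" "x \<le> length ps"
        using assms by (auto simp: mem_descendants)
      then have "(parent ps ^^ ((j - i) + k)) x = w" using v by (simp add: funpow_add)
      then show "x \<in> set (descendants ps w)" using k assms by (auto simp: mem_descendants)
    qed
    moreover have "w \<in> set (descendants ps w)"
      using descendants_Cons[OF that(5)] by (metis list.set_intros(1))
    moreover have "w \<notin> set (descendants ps v)"
      using \<open>w < v\<close> by (auto simp: descendants_def)
    ultimately have "set (descendants ps v) \<subset> set (descendants ps w)" by blast
    then have "card (set (descendants ps v)) < card (set (descendants ps w))"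
      by (simp add: psubset_card_mono)
    then show ?thesis by (simp add: distinct_card)
  qed
  have "v = w" if vw: "v \<le> length ps" "u \<in> set (descendants ps v)" "w \<le> length ps" "u \<in> set (descendants ps w)"
    "length (descendants ps v) = length (descendants ps w)" for v w
  proof (rule ccontr)
    assume "v \<noteq> w"
    obtain i j where "(parent ps ^^ i) u = v" "(parent ps ^^ j) u = w"
      using vw unfolding mem_descendants[OF assms] by blast
    then show False using *[of w i v j] *[of v j w i] vw \<open>v \<noteq> w\<close> by (cases "i \<le> j") auto
  qed
  then show ?thesis
    by (intro card_le_Suc0_iff_eq[THEN iffD2, simplified One_nat_def[symmetric]]) auto
qed

section \<open>Isomorphism classes of fringes\<close>

lemma mem_children_iff: "w \<in> children ps v \<longleftrightarrow> v < w \<and> w \<le> length ps \<and> parent ps w = v"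
  by (cases w) (auto simp: children_def edges_def parent_def Suc_le_eq)

text \<open>
  Positions in the list of descendants are an isomorphism from the renumbered tree.  The recursion
  of \<^const>\<open>fringe\<close> descends to larger labels, hence the induction on the number of later positions.
\<close>

lemma fringe_labelled_fringe_nth:
  assumes "increasing_tree ps" "v \<le> length ps"
  shows "i < length (descendants ps v) \<Longrightarrow>
    fringe ps (descendants ps v ! i) = fringe (labelled_fringe ps v) i"
proof (induction "length (descendants ps v) - i" arbitrary: i rule: less_induct)
  case less
  let ?q = "labelled_fringe ps v" and ?L = "descendants ps v"
  have len: "Suc (length ?q) = length ?L" by (rule length_labelled_fringe) fact
  have eq: "children ps (?L ! i) = (!) ?L ` children ?q i"
  proof (intro equalityI subsetI)
    fix w assume "w \<in> children ps (?L ! i)"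
    then have w: "?L ! i < w" "w \<le> length ps" "parent ps w = ?L ! i"
      by (auto simp: mem_children_iff)
    obtain k where "(parent ps ^^ k) (?L ! i) = v"
      using less.prems assms(1) by (metis mem_descendants nth_mem)
    then have "(parent ps ^^ Suc k) w = v" using w by (simp add: funpow_swap1)
    then have "w \<in> set ?L" using w assms(1) descendantsI by blast
    then obtain j where j: "j < length ?L" "w = ?L ! j" by (auto simp: in_set_conv_nth)
    have "i < j" using w(1) j less.prems sorted_wrt_nth_less[OF sorted_descendants, of j i ps v]
      by (metis linorder_neqE_nat less_asym less_irrefl)
    then have "parent ?q j = position ?L (?L ! i)"
      using nth_descendants_parent(2)[OF assms _ j(1)] w(3) j(2) by simp
    then have "parent ?q j = i" using position_nth[OF distinct_descendants less.prems] by simp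
    then have "j \<in> children ?q i" using \<open>i < j\<close> j len by (auto simp: mem_children_iff)
    then show "w \<in> (!) ?L ` children ?q i" using j by blast
  next
    fix w assume "w \<in> (!) ?L ` children ?q i"
    then obtain j where j: "w = ?L ! j" "i < j" "j \<le> length ?q" "parent ?q j = i"
      by (auto simp: mem_children_iff)
    then have jl: "j < length ?L" using len by simp
    have "parent ps w = ?L ! i"
      using nth_descendants_parent(3)[OF assms _ jl] j by simp
    moreover have "?L ! i < w" using sorted_wrt_nth_less[OF sorted_descendants j(2) jl] j by simp
    moreover have "w \<le> length ps" using jl assms(1) j by (metis mem_descendants nth_mem)
    ultimately show "w \<in> children ps (?L ! i)" by (simp add: mem_children_iff)
  qed
  have sub: "children ?q i \<subseteq> {..<length ?L}" using len by (auto simp: mem_children_iff)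
  then have "inj_on ((!) ?L) (children ?q i)"
    by (intro inj_on_subset[OF inj_on_nth]) auto
  then have "mset_set (children ps (?L ! i)) = image_mset ((!) ?L) (mset_set (children ?q i))"
    by (simp add: eq image_mset_mset_set)
  then have "image_mset (fringe ps) (mset_set (children ps (?L ! i))) =
      image_mset (\<lambda>j. fringe ps (?L ! j)) (mset_set (children ?q i))"
    by (simp add: multiset.map_comp comp_def)
  also have "\<dots> = image_mset (fringe ?q) (mset_set (children ?q i))"
  proof (rule image_mset_cong)
    fix j assume "j \<in># mset_set (children ?q i)"
    then have "j \<in> children ?q i" by (simp add: finite_children)
    then have "i < j" "j < length ?L" using len by (auto simp: mem_children_iff)
    then show "fringe ps (?L ! j) = fringe ?q j" using less.hyps by simp
  qed
  finally show ?case by (simp add: fringe.simps[of ps] fringe.simps[of ?q])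
qed

lemma fringe_labelled_fringe:
  assumes "increasing_tree ps" "v \<le> length ps"
  shows "fringe ps v = fringe (labelled_fringe ps v) 0"
  using fringe_labelled_fringe_nth[OF assms, of 0] descendants_nonempty[OF assms(2)]
    nth_descendants_0[OF assms(2)] by simp

text \<open>
  The sets of descendants of the children of \<open>v\<close> partition the proper descendants of \<open>v\<close>: the walk
  from a descendant to the root passes through only one child of \<open>v\<close>.
\<close>

lemma num_vertices_fringe:
  assumes "increasing_tree ps"
  shows "v \<le> length ps \<Longrightarrow> num_vertices (fringe ps v) = length (descendants ps v)"
proof (induction "length ps - v" arbitrary: v rule: less_induct)
  case less
  let ?C = "children ps v" and ?D = "\<lambda>v. set (descendants ps v)"
  have IH: "num_vertices (fringe ps w) = card (?D w)" if "w \<in> ?C" for w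
    using that less.hyps[of w] by (auto simp: mem_children_iff distinct_card)
  have "num_vertices (fringe ps v) = Suc (\<Sum>w\<in>?C. num_vertices (fringe ps w))"
    by (subst fringe.simps) (simp add: sum_unfold_sum_mset multiset.map_comp comp_def)
  also have "(\<Sum>w\<in>?C. num_vertices (fringe ps w)) = (\<Sum>w\<in>?C. card (?D w))"
    using IH by simp
  also have "\<dots> = card (\<Union>w\<in>?C. ?D w)"
  proof (rule card_UN_disjoint[symmetric])
    show "\<forall>i\<in>?C. \<forall>j\<in>?C. i \<noteq> j \<longrightarrow> ?D i \<inter> ?D j = {}"
    proof (intro ballI impI equals0I)
      fix a b x assume ab: "a \<in> ?C" "b \<in> ?C" "a \<noteq> b" and "x \<in> ?D a \<inter> ?D b"
      then obtain i j where ij: "(parent ps ^^ i) x = a" "(parent ps ^^ j) x = b" "x \<le> length ps"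
        using assms by (auto simp: mem_descendants)
      have *: "a = b" if "(parent ps ^^ i) x = a" "(parent ps ^^ j) x = b" "a \<in> ?C" "b \<in> ?C" "i < j"
        for a b i j
      proof -
        have "(parent ps ^^ (j - Suc i)) (parent ps ((parent ps ^^ i) x)) = (parent ps ^^ (j - Suc i + Suc i)) x"
          by (simp only: funpow_add comp_apply funpow.simps)
        then have "b = (parent ps ^^ (j - Suc i)) v"
          using that by (simp add: mem_children_iff)
        then have "b \<le> v" using funpow_parent_le[OF assms less.prems] by simp
        then show ?thesis using that by (simp add: mem_children_iff)
      qed
      from *[of i a j b] *[of j b i a] ij ab show False
        by (cases i j rule: linorder_cases) auto
    qed
  qed (auto simp: finite_children)
  also have "(\<Union>w\<in>?C. ?D w) = ?D v - {v}"
  proof (intro equalityI subsetI)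
    fix x assume "x \<in> (\<Union>w\<in>?C. ?D w)"
    then obtain w k where w: "w \<in> ?C" "(parent ps ^^ k) x = w" "x \<le> length ps"
      using assms by (auto simp: mem_descendants)
    then have "(parent ps ^^ Suc k) x = v" "w \<le> x" "v < w"
      using funpow_parent_le[OF assms w(3), of k] by (auto simp: mem_children_iff)
    then show "x \<in> ?D v - {v}" using w(3) assms descendantsI[of ps x "Suc k" v] by auto
  next
    fix x assume x: "x \<in> ?D v - {v}"
    define k where "k = (LEAST k. (parent ps ^^ k) x = v)"
    have ex: "\<exists>k. (parent ps ^^ k) x = v" and xl: "x \<le> length ps"
      using x assms by (auto simp: mem_descendants)
    have k: "(parent ps ^^ k) x = v" unfolding k_def using ex by (rule LeastI_ex)
    then obtain j where j: "k = Suc j" using x by (cases k) auto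
    let ?w = "(parent ps ^^ j) x"
    have w: "?w \<le> length ps" using funpow_parent_le[OF assms xl, of j] xl by linarith
    have p: "parent ps ?w = v" using k j by simp
    have "?w \<noteq> v" using not_less_Least[of j "\<lambda>k. (parent ps ^^ k) x = v"] j k_def by auto
    then have "v < ?w" using parent_le[OF assms w] p by simp
    then have "?w \<in> ?C" using w p by (simp add: mem_children_iff)
    moreover have "x \<in> ?D ?w" using xl assms by (auto simp: mem_descendants)
    ultimately show "x \<in> (\<Union>w\<in>?C. ?D w)" by blast
  qed
  also have "Suc (card (?D v - {v})) = card (?D v)"
    using descendants_Cons[OF less.prems] by (intro card_Suc_Diff1) (auto, metis list.set_intros(1))
  finally show ?case by (simp add: distinct_card)
qed

lemma descendants_0: "increasing_tree ps \<Longrightarrow> descendants ps 0 = [0..<Suc (length ps)]"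
  unfolding descendants_def
  by (rule filter_True) (auto intro: ex_funpow_parent_eq_0)

lemma num_vertices_fringe_0: "increasing_tree ps \<Longrightarrow> num_vertices (fringe ps 0) = Suc (length ps)"
  by (simp add: num_vertices_fringe descendants_0 del: upt_Suc)

lemma root_degree_fringe: "root_degree (fringe ps v) = card (children ps v)"
  by (subst fringe.simps) (simp add: root_degree_def)

lemma child_count_fringe: "child_count (fringe ps v) t = card {w \<in> children ps v. fringe ps w = t}"
  by (subst fringe.simps)
    (simp add: child_count_def count_image_mset' finite_children eq_commute flip: sum.inter_filter card_eq_sum)

lemma root_degree_fringe_0:
  assumes "increasing_tree ps"
  shows "root_degree (fringe ps 0) = level_size ps 1"
proof -
  have "children ps 0 = {v \<in> vertices ps. depth ps v = 1}"
  proof (intro set_eqI)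
    fix w
    show "w \<in> children ps 0 \<longleftrightarrow> w \<in> {v \<in> vertices ps. depth ps v = 1}"
    proof (cases "0 < w \<and> w \<le> length ps")
      case True
      then have "depth ps w = Suc (depth ps (parent ps w))" using depth_Suc assms by simp
      moreover have "parent ps w \<le> length ps" using parent_le[of ps w] True assms by simp
      ultimately show ?thesis using True depth_eq_0_iff[OF assms] by (auto simp: mem_children_iff)
    qed (auto simp: mem_children_iff)
  qed
  then show ?thesis by (simp add: root_degree_fringe level_size_def)
qed

lemma vertex_degree_eq:
  assumes "increasing_tree ps" "0 < v" "v \<le> length ps"
  shows "vertex_degree ps v = Suc (card (children ps v))"
proof -
  have "{e \<in> edges ps. fst e = v \<or> snd e = v} =
      insert (v, parent ps v) ((\<lambda>w. (w, v)) ` children ps v)" (is "?l = ?r")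
  proof (intro equalityI subsetI)
    fix e assume "e \<in> ?l"
    then obtain i where i: "i < length ps" "e = (Suc i, ps ! i)" "Suc i = v \<or> ps ! i = v"
      by (auto simp: edges_def)
    moreover have "ps ! i \<le> i" using assms i by (auto simp: increasing_tree_def)
    ultimately show "e \<in> ?r"
      by (auto simp: mem_children_iff parent_def image_iff)
  next
    fix e assume "e \<in> ?r"
    moreover have "(v, parent ps v) \<in> edges ps"
      using assms by (cases v) (auto simp: edges_def parent_def)
    ultimately show "e \<in> ?l" by (auto simp: children_def)
  qed
  moreover have "(v, parent ps v) \<notin> (\<lambda>w. (w, v)) ` children ps v"
    by (auto simp: mem_children_iff)
  moreover have "card ((\<lambda>w. (w, v)) ` children ps v) = card (children ps v)"
    by (intro card_image) (auto simp: inj_on_def)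
  ultimately show ?thesis by (simp add: vertex_degree_def finite_children)
qed

section \<open>Convergence in mean to a constant\<close>

text \<open>
  Unlike convergence in probability, this notion passes through expectations, as the recursions for
  the fringe counts require; it implies convergence in probability by the Markov inequality.
\<close>

definition L1_limit :: "(nat \<Rightarrow> 'a pmf) \<Rightarrow> (nat \<Rightarrow> 'a \<Rightarrow> real) \<Rightarrow> real \<Rightarrow> bool" where
  "L1_limit \<mu> X c \<longleftrightarrow> (\<lambda>n. measure_pmf.expectation (\<mu> n) (\<lambda>x. \<bar>X n x - c\<bar>)) \<longlonglongrightarrow> 0"

lemma expectation_mono_on_support:
  fixes f g :: "'a \<Rightarrow> real"
  assumes "finite (set_pmf M)" "\<And>x. x \<in> set_pmf M \<Longrightarrow> f x \<le> g x"
  shows "measure_pmf.expectation M f \<le> measure_pmf.expectation M g"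
  by (rule integral_mono_AE) (use assms in \<open>auto simp: integrable_measure_pmf_finite AE_measure_pmf_iff\<close>)

lemma expectation_bind_finite:
  fixes h :: "'b \<Rightarrow> real"
  assumes "finite (set_pmf M)" "\<And>x. x \<in> set_pmf M \<Longrightarrow> finite (set_pmf (\<kappa> x))"
  shows "measure_pmf.expectation (bind_pmf M \<kappa>) h =
    measure_pmf.expectation M (\<lambda>x. measure_pmf.expectation (\<kappa> x) h)"
  using assms by (subst pmf_expectation_bind[of "set_pmf M"])
    (auto simp: integral_measure_pmf[of "set_pmf M"])

lemma L1_limitI:
  assumes fin: "\<And>n. finite (set_pmf (\<mu> n))"
    and bound: "\<And>n x. n \<ge> m \<Longrightarrow> x \<in> set_pmf (\<mu> n) \<Longrightarrow> \<bar>X n x - c\<bar> \<le> Y n x"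
    and Y: "(\<lambda>n. measure_pmf.expectation (\<mu> n) (Y n)) \<longlonglongrightarrow> 0"
  shows "L1_limit \<mu> X c"
  unfolding L1_limit_def
proof (rule tendsto_sandwich[OF _ _ tendsto_const Y])
  show "\<forall>\<^sub>F n in sequentially. measure_pmf.expectation (\<mu> n) (\<lambda>x. \<bar>X n x - c\<bar>)
      \<le> measure_pmf.expectation (\<mu> n) (Y n)"
    using eventually_ge_at_top[of m]
    by eventually_elim (intro expectation_mono_on_support fin bound)
qed simp

lemma L1_limit_conv_in_prob:
  assumes fin: "\<And>n. finite (set_pmf (\<mu> n))" and "L1_limit \<mu> X c"
  shows "conv_in_prob \<mu> X c"
  unfolding conv_in_prob_def
proof (intro allI impI)
  fix \<epsilon> :: real assume "\<epsilon> > 0"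
  have lim: "(\<lambda>n. measure_pmf.expectation (\<mu> n) (\<lambda>x. \<bar>X n x - c\<bar>) / \<epsilon>) \<longlonglongrightarrow> 0"
    using tendsto_divide[OF assms(2)[unfolded L1_limit_def] tendsto_const[of \<epsilon>]] \<open>\<epsilon> > 0\<close> by simp
  have le: "measure_pmf.prob (\<mu> n) {x. \<bar>X n x - c\<bar> > \<epsilon>}
      \<le> measure_pmf.expectation (\<mu> n) (\<lambda>x. \<bar>X n x - c\<bar>) / \<epsilon>" for n
  proof -
    have "measure_pmf.prob (\<mu> n) {x. \<bar>X n x - c\<bar> > \<epsilon>}
        \<le> measure_pmf.prob (\<mu> n) {x \<in> space (\<mu> n). \<bar>X n x - c\<bar> \<ge> \<epsilon>}"
      by (rule measure_pmf.finite_measure_mono) auto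
    also have "\<dots> \<le> measure_pmf.expectation (\<mu> n) (\<lambda>x. \<bar>X n x - c\<bar>) / \<epsilon>"
      by (rule integral_Markov_inequality_measure[where A = "{}"])
        (use \<open>\<epsilon> > 0\<close> fin in \<open>auto simp: integrable_measure_pmf_finite\<close>)
    finally show ?thesis .
  qed
  show "(\<lambda>n. measure_pmf.prob (\<mu> n) {x. \<bar>X n x - c\<bar> > \<epsilon>}) \<longlonglongrightarrow> 0"
    by (rule tendsto_sandwich[OF _ _ tendsto_const lim]) (use le in auto)
qed

lemma L1_limit_cmult:
  assumes "L1_limit \<mu> X c"
  shows "L1_limit \<mu> (\<lambda>n x. a * X n x) (a * c)"
proof -
  have "\<bar>a * X n x - a * c\<bar> = \<bar>a\<bar> * \<bar>X n x - c\<bar>" for n x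
    by (simp add: abs_mult right_diff_distrib[symmetric])
  then show ?thesis
    using tendsto_mult[OF tendsto_const[of "\<bar>a\<bar>"] assms[unfolded L1_limit_def]]
    by (simp add: L1_limit_def)
qed

lemma L1_limit_add:
  assumes fin: "\<And>n. finite (set_pmf (\<mu> n))" and "L1_limit \<mu> X c" "L1_limit \<mu> Y d"
  shows "L1_limit \<mu> (\<lambda>n x. X n x + Y n x) (c + d)"
proof (rule L1_limitI[OF fin, where Y = "\<lambda>n x. \<bar>X n x - c\<bar> + \<bar>Y n x - d\<bar>"])
  show "(\<lambda>n. measure_pmf.expectation (\<mu> n) (\<lambda>x. \<bar>X n x - c\<bar> + \<bar>Y n x - d\<bar>)) \<longlonglongrightarrow> 0"
    using tendsto_add[OF assms(2,3)[unfolded L1_limit_def]]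
    by (simp add: integrable_measure_pmf_finite fin)
qed simp_all

lemma L1_limit_0: "L1_limit \<mu> (\<lambda>_ _. 0) 0"
  by (simp add: L1_limit_def)

lemma L1_limit_sum:
  fixes X :: "'b \<Rightarrow> nat \<Rightarrow> 'a \<Rightarrow> real" and c :: "'b \<Rightarrow> real"
  assumes fin: "\<And>n. finite (set_pmf (\<mu> n))" and "finite A"
    and "\<And>a. a \<in> A \<Longrightarrow> L1_limit \<mu> (X a) (c a)"
  shows "L1_limit \<mu> (\<lambda>n x. \<Sum>a\<in>A. X a n x) (\<Sum>a\<in>A. c a)"
  using assms(2,3)
proof (induction A)
  case (insert a A)
  then show ?case using L1_limit_add[OF fin, where X = "X a" and c = "c a"] by simp
qed (simp add: L1_limit_0)

text \<open>
  An increment \<open>o(n)\<close> accumulates to \<open>o(n\<^sup>2)\<close>.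
\<close>

lemma quadratic_growth_bound:
  fixes s e :: "nat \<Rightarrow> real"
  assumes s: "\<And>n. s n \<ge> 0" and e: "e \<longlonglongrightarrow> 0"
    and step: "\<And>n. n \<ge> 1 \<Longrightarrow> s (Suc n) \<le> s n + C + B * (real n + 1) * e n"
  shows "(\<lambda>n. s n / (real n + 1)\<^sup>2) \<longlonglongrightarrow> 0"
proof (rule LIMSEQ_I)
  fix r :: real assume "r > 0"
  define \<epsilon> where "\<epsilon> = r / 3"
  have \<epsilon>: "\<epsilon> > 0" using \<open>r > 0\<close> by (simp add: \<epsilon>_def)
  have "(\<lambda>n. C / (real n + 1) + B * e n) \<longlonglongrightarrow> 0 + B * 0"
    by (intro tendsto_intros e) real_asymp
  then have "\<forall>\<^sub>F n in sequentially. C / (real n + 1) + B * e n < \<epsilon>"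
    using \<epsilon> by (intro order_tendstoD(2)) auto
  then obtain N0 where N0: "\<And>n. n \<ge> N0 \<Longrightarrow> C / (real n + 1) + B * e n < \<epsilon>"
    by (auto simp: eventually_sequentially)
  define N where "N = max N0 1"
  have bound: "s n \<le> s N + \<epsilon> * (real n + 1)\<^sup>2" if "n \<ge> N" for n
    using that
  proof (induction n rule: dec_induct)
    case base
    show ?case using \<epsilon> by simp
  next
    case (step n)
    have "C + B * (real n + 1) * e n = (C / (real n + 1) + B * e n) * (real n + 1)"
      by (simp add: field_simps)
    also have "\<dots> \<le> \<epsilon> * (real n + 1)"
      using N0[of n] step(1) by (intro mult_right_mono) (auto simp: N_def)
    finally have "s (Suc n) \<le> s N + \<epsilon> * (real n + 1)\<^sup>2 + \<epsilon> * (real n + 1)"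
      using assms(3)[of n] step by (auto simp: N_def)
    also have "\<dots> \<le> s N + \<epsilon> * (real (Suc n) + 1)\<^sup>2"
      using \<epsilon> by (simp add: power2_eq_square algebra_simps)
    finally show ?case .
  qed
  have "(\<lambda>n. s N / (real n + 1)\<^sup>2) \<longlonglongrightarrow> 0" by real_asymp
  then have "\<forall>\<^sub>F n in sequentially. s N / (real n + 1)\<^sup>2 < \<epsilon>"
    using \<epsilon> by (intro order_tendstoD(2)) auto
  then obtain M where M: "\<And>n. n \<ge> M \<Longrightarrow> s N / (real n + 1)\<^sup>2 < \<epsilon>"
    by (auto simp: eventually_sequentially)
  show "\<exists>no. \<forall>n\<ge>no. norm (s n / (real n + 1)\<^sup>2 - 0) < r"
  proof (intro exI[of _ "max M N"] allI impI)
    fix n assume n: "n \<ge> max M N"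
    have "s n / (real n + 1)\<^sup>2 \<le> (s N + \<epsilon> * (real n + 1)\<^sup>2) / (real n + 1)\<^sup>2"
      using bound[of n] n by (intro divide_right_mono) auto
    also have "\<dots> = s N / (real n + 1)\<^sup>2 + \<epsilon>"
      by (simp add: add_divide_distrib)
    also have "\<dots> < \<epsilon> + \<epsilon>" using M[of n] n by simp
    also have "\<dots> < r" using \<epsilon> \<open>r > 0\<close> by (simp add: \<epsilon>_def)
    finally show "norm (s n / (real n + 1)\<^sup>2 - 0) < r" using s[of n] by simp
  qed
qed

text \<open>
  The value \<open>y\<close> is chosen such that the drift of \<open>D n = Y - (n + 1) y\<close> is
  \<open>(L / (n + 1) - l) - a D n / (n + 1)\<close>.  In the recursion for the second moment of \<open>D n\<close>, the term
  with \<open>a \<ge> 0\<close> is favourable and may be dropped, the square of the increment contributes a constant,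
  and the cross term is \<open>o(n)\<close> because \<open>D n = O(n)\<close> and \<open>L / (n + 1)\<close> tends to \<open>l\<close> in mean.  So the
  second moment is \<open>o(n\<^sup>2)\<close>.
\<close>

lemma stochastic_approximation:
  fixes \<mu> :: "nat \<Rightarrow> 'a pmf" and \<kappa> :: "'a \<Rightarrow> 'a pmf" and Y L :: "'a \<Rightarrow> real"
  assumes fin: "\<And>n. finite (set_pmf (\<mu> n))"
    and fin': "\<And>n x. n \<ge> 1 \<Longrightarrow> x \<in> set_pmf (\<mu> n) \<Longrightarrow> finite (set_pmf (\<kappa> x))"
    and step: "\<And>n. n \<ge> 1 \<Longrightarrow> \<mu> (Suc n) = bind_pmf (\<mu> n) \<kappa>"
    and bound: "\<And>n x. n \<ge> 1 \<Longrightarrow> x \<in> set_pmf (\<mu> n) \<Longrightarrow> \<bar>Y x\<bar> \<le> real n"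
    and incr: "\<And>n x y. n \<ge> 1 \<Longrightarrow> x \<in> set_pmf (\<mu> n) \<Longrightarrow> y \<in> set_pmf (\<kappa> x) \<Longrightarrow> \<bar>Y y - Y x\<bar> \<le> b"
    and drift: "\<And>n x. n \<ge> 1 \<Longrightarrow> x \<in> set_pmf (\<mu> n) \<Longrightarrow>
      measure_pmf.expectation (\<kappa> x) Y = Y x + c + (L x - a * Y x) / (real n + 1)"
    and a: "a \<ge> 0" and L: "L1_limit \<mu> (\<lambda>n x. L x / (real n + 1)) l"
    and y: "y * (1 + a) = l + c"
  shows "L1_limit \<mu> (\<lambda>n x. Y x / (real n + 1)) y"
proof -
  define D where "D n x = Y x - (real n + 1) * y" for n x
  define s where "s n = measure_pmf.expectation (\<mu> n) (\<lambda>x. (D n x)\<^sup>2)" for n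
  define e where "e n = measure_pmf.expectation (\<mu> n) (\<lambda>x. \<bar>L x / (real n + 1) - l\<bar>)" for n
  have [simp]: "integrable (measure_pmf (\<mu> n)) f" for n and f :: "'a \<Rightarrow> real"
    by (rule integrable_measure_pmf_finite[OF fin])
  have one_step: "measure_pmf.expectation (\<kappa> x) (\<lambda>z. (D (Suc n) z)\<^sup>2)
      \<le> (D n x)\<^sup>2 + (b + \<bar>y\<bar>)\<^sup>2 + 2 * (1 + \<bar>y\<bar>) * (real n + 1) * \<bar>L x / (real n + 1) - l\<bar>"
    if n: "n \<ge> 1" and x: "x \<in> set_pmf (\<mu> n)" for n x
  proof -
    have [simp]: "integrable (measure_pmf (\<kappa> x)) f" for f :: "'a \<Rightarrow> real"
      by (rule integrable_measure_pmf_finite[OF fin'[OF n x]])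
    have "(D (Suc n) z)\<^sup>2 \<le> (D n x)\<^sup>2 + 2 * D n x * (Y z - Y x - y) + (b + \<bar>y\<bar>)\<^sup>2"
      if "z \<in> set_pmf (\<kappa> x)" for z
    proof -
      have "\<bar>Y z - Y x - y\<bar> \<le> \<bar>b + \<bar>y\<bar>\<bar>" using incr[OF n x that] by linarith
      then have "(Y z - Y x - y)\<^sup>2 \<le> (b + \<bar>y\<bar>)\<^sup>2" by (simp only: abs_le_square_iff)
      moreover have "D (Suc n) z = D n x + (Y z - Y x - y)" by (simp add: D_def algebra_simps)
      ultimately show ?thesis by (simp add: power2_sum)
    qed
    then have "measure_pmf.expectation (\<kappa> x) (\<lambda>z. (D (Suc n) z)\<^sup>2) \<le>
        measure_pmf.expectation (\<kappa> x) (\<lambda>z. (D n x)\<^sup>2 + 2 * D n x * (Y z - Y x - y) + (b + \<bar>y\<bar>)\<^sup>2)"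
      by (intro expectation_mono_on_support fin'[OF n x])
    also have "\<dots> = (D n x)\<^sup>2 + 2 * D n x * (measure_pmf.expectation (\<kappa> x) Y - Y x - y) + (b + \<bar>y\<bar>)\<^sup>2"
      by simp
    also have "measure_pmf.expectation (\<kappa> x) Y - Y x - y
        = (L x / (real n + 1) - l) - a * (D n x / (real n + 1))"
    proof -
      have "c = y * (1 + a) - l" using y by simp
      moreover have "D n x / (real n + 1) = Y x / (real n + 1) - y"
        by (simp add: D_def field_simps)
      ultimately show ?thesis
        using drift[OF n x] by (simp add: diff_divide_distrib right_diff_distrib distrib_left)
    qed
    also have "2 * D n x * \<dots> = 2 * D n x * (L x / (real n + 1) - l) - 2 * a * ((D n x)\<^sup>2 / (real n + 1))"
      by (simp add: algebra_simps power2_eq_square)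
    also have "\<dots> \<le> 2 * D n x * (L x / (real n + 1) - l)"
      using a by simp
    also have "\<dots> \<le> 2 * \<bar>D n x\<bar> * \<bar>L x / (real n + 1) - l\<bar>"
      using abs_ge_self[of "D n x * (L x / (real n + 1) - l)"] unfolding abs_mult by linarith
    also have "\<dots> \<le> 2 * ((1 + \<bar>y\<bar>) * (real n + 1)) * \<bar>L x / (real n + 1) - l\<bar>"
    proof -
      have "\<bar>D n x\<bar> \<le> \<bar>Y x\<bar> + \<bar>(real n + 1) * y\<bar>" unfolding D_def by (rule abs_triangle_ineq4)
      also have "\<bar>(real n + 1) * y\<bar> = (real n + 1) * \<bar>y\<bar>" by (simp add: abs_mult)
      also have "\<bar>Y x\<bar> + (real n + 1) * \<bar>y\<bar> \<le> (real n + 1) + (real n + 1) * \<bar>y\<bar>"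
        using bound[OF n x] by linarith
      also have "\<dots> = (1 + \<bar>y\<bar>) * (real n + 1)" by (simp add: distrib_left distrib_right)
      finally have "2 * \<bar>D n x\<bar> \<le> 2 * ((1 + \<bar>y\<bar>) * (real n + 1))" by linarith
      then show ?thesis by (rule mult_right_mono) simp
    qed
    finally show ?thesis by (simp add: algebra_simps)
  qed
  have "(\<lambda>n. s n / (real n + 1)\<^sup>2) \<longlonglongrightarrow> 0"
  proof (rule quadratic_growth_bound[where e = e and C = "(b + \<bar>y\<bar>)\<^sup>2" and B = "2 * (1 + \<bar>y\<bar>)"])
    show "e \<longlonglongrightarrow> 0" using L by (simp add: e_def[abs_def] L1_limit_def)
    show "s n \<ge> 0" for n by (simp add: s_def)
    fix n :: nat assume n: "n \<ge> 1"
    have "s (Suc n) = measure_pmf.expectation (\<mu> n) (\<lambda>x. measure_pmf.expectation (\<kappa> x) (\<lambda>z. (D (Suc n) z)\<^sup>2))"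
      unfolding s_def step[OF n] by (rule expectation_bind_finite[OF fin fin'[OF n]])
    also have "\<dots> \<le> measure_pmf.expectation (\<mu> n) (\<lambda>x. (D n x)\<^sup>2 + (b + \<bar>y\<bar>)\<^sup>2
        + 2 * (1 + \<bar>y\<bar>) * (real n + 1) * \<bar>L x / (real n + 1) - l\<bar>)"
      by (intro expectation_mono_on_support fin one_step n)
    also have "\<dots> = s n + (b + \<bar>y\<bar>)\<^sup>2 + 2 * (1 + \<bar>y\<bar>) * (real n + 1) * e n"
      by (simp add: s_def e_def)
    finally show "s (Suc n) \<le> \<dots>" .
  qed
  then have "(\<lambda>n. sqrt (s n / (real n + 1)\<^sup>2)) \<longlonglongrightarrow> 0"
    using tendsto_real_sqrt[of _ 0 sequentially] by fastforce
  then have lim: "(\<lambda>n. sqrt (s n) / (real n + 1)) \<longlonglongrightarrow> 0"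
    by (simp add: real_sqrt_divide)
  have le: "measure_pmf.expectation (\<mu> n) (\<lambda>x. \<bar>Y x / (real n + 1) - y\<bar>) \<le> sqrt (s n) / (real n + 1)" for n
  proof -
    have "(measure_pmf.expectation (\<mu> n) (\<lambda>x. \<bar>D n x\<bar>))\<^sup>2 \<le> s n"
      using measure_pmf.variance_positive[of "\<mu> n" "\<lambda>x. \<bar>D n x\<bar>"]
        measure_pmf.variance_eq[of "\<mu> n" "\<lambda>x. \<bar>D n x\<bar>"] by (simp add: s_def)
    then have "measure_pmf.expectation (\<mu> n) (\<lambda>x. \<bar>D n x\<bar>) \<le> sqrt (s n)"
      by (rule real_le_rsqrt)
    moreover have "\<bar>Y x / (real n + 1) - y\<bar> = \<bar>D n x\<bar> / (real n + 1)" for x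
    proof -
      have "Y x / (real n + 1) - y = D n x / (real n + 1)" by (simp add: D_def field_simps)
      then show ?thesis by (simp only: abs_divide)
    qed
    ultimately show ?thesis by (simp add: divide_right_mono)
  qed
  show ?thesis
    unfolding L1_limit_def
    by (rule tendsto_sandwich[OF _ _ tendsto_const lim]) (use le in auto)
qed

section \<open>The drift of the fringe counts\<close>

text \<open>
  The total rate at which the vertices of \<open>s\<close>, reproducing at rate one, turn \<open>s\<close> into \<open>q\<close>.  The case
  \<open>q = s\<close> collects the reproductions that add no vertex.
\<close>

definition rate :: "nat pmf \<Rightarrow> ptree \<Rightarrow> ptree \<Rightarrow> real" where
  "rate p s q = (\<Sum>v\<in>vertices s. measure_pmf.prob p {z. grow s v z = q})"

lemma rate_nonneg: "rate p s q \<ge> 0"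
  by (simp add: rate_def sum_nonneg)

lemma rate_le: "rate p s q \<le> real (length s) + 1"
proof -
  have "rate p s q \<le> (\<Sum>v\<in>vertices s. 1)"
    unfolding rate_def by (intro sum_mono) simp
  then show ?thesis by simp
qed

lemma rate_eq_0: "s \<noteq> q \<Longrightarrow> q = [] \<or> s \<noteq> butlast q \<Longrightarrow> rate p s q = 0"
proof -
  assume *: "s \<noteq> q" "q = [] \<or> s \<noteq> butlast q"
  have "grow s v z \<noteq> q" for v z using grow_cases[of s v z] * by auto
  then show ?thesis by (simp add: rate_def)
qed

text \<open>
  The root is left out because its fringe obeys a different rule: a jump beyond the root still
  attaches the new vertex to it.
\<close>

definition occurrences :: "ptree \<Rightarrow> ptree \<Rightarrow> nat" where
  "occurrences q ps = card {v \<in> {1..length ps}. labelled_fringe ps v = q}"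

lemma occurrences_le: "occurrences q ps \<le> length ps"
proof -
  have "occurrences q ps \<le> card {1..length ps}"
    unfolding occurrences_def by (rule card_mono) auto
  then show ?thesis by simp
qed

lemma occurrences_eq_sum:
  "real (occurrences q ps) = (\<Sum>v\<in>{1..length ps}. of_bool (labelled_fringe ps v = q))"
  by (simp add: occurrences_def Int_def)

lemma occurrences_snoc:
  "real (occurrences q (ps @ [u])) =
    (\<Sum>v\<in>{1..length ps}. of_bool (labelled_fringe (ps @ [u]) v = q)) + of_bool (q = [])"
proof -
  have "{1..length (ps @ [u])} = insert (Suc (length ps)) {1..length ps}" by auto
  then show ?thesis
    unfolding occurrences_eq_sum by (simp only:) (subst sum.insert, auto simp: labelled_fringe_new)
qed

text \<open>
  A fringe that turns into \<open>q\<close> has one vertex less than \<open>q\<close>, and one that ceases to be \<open>q\<close> has the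
  size of \<open>q\<close>; there is at most one of each.  The new vertex itself may add another \<open>1\<close>.
\<close>

lemma occurrences_increment:
  assumes "increasing_tree ps" "u \<le> length ps"
  shows "\<bar>real (occurrences q (ps @ [u])) - real (occurrences q ps)\<bar> \<le> 2"
proof -
  let ?I = "{1..length ps}" and ?m = "length q"
  let ?A = "\<lambda>m. {v \<in> ?I. u \<in> set (descendants ps v) \<and> length (descendants ps v) = m}"
  have A: "(\<Sum>v\<in>?I. of_bool (u \<in> set (descendants ps v) \<and> length (descendants ps v) = m)) \<le> (1::real)" for m
    using ancestors_of_same_size[OF assms(1), of u m] by (simp add: Int_def)
  have 1: "of_bool (labelled_fringe (ps @ [u]) v = q) \<le> of_bool (labelled_fringe ps v = q)
      + (of_bool (u \<in> set (descendants ps v) \<and> length (descendants ps v) = ?m) :: real)"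
    and 2: "of_bool (labelled_fringe ps v = q) \<le> of_bool (labelled_fringe (ps @ [u]) v = q)
      + (of_bool (u \<in> set (descendants ps v) \<and> length (descendants ps v) = Suc ?m) :: real)"
    if "v \<in> ?I" for v
  proof -
    have v: "v \<le> length ps" using that by simp
    show "of_bool (labelled_fringe (ps @ [u]) v = q) \<le> of_bool (labelled_fringe ps v = q)
      + (of_bool (u \<in> set (descendants ps v) \<and> length (descendants ps v) = ?m) :: real)"
      using length_labelled_fringe[OF v] labelled_fringe_snoc[OF assms v]
      by (cases "u \<in> set (descendants ps v)") auto
    show "of_bool (labelled_fringe ps v = q) \<le> of_bool (labelled_fringe (ps @ [u]) v = q)
      + (of_bool (u \<in> set (descendants ps v) \<and> length (descendants ps v) = Suc ?m) :: real)"
      using length_labelled_fringe[OF v] labelled_fringe_snoc[OF assms v]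
      by (cases "u \<in> set (descendants ps v)") auto
  qed
  have "(\<Sum>v\<in>?I. of_bool (labelled_fringe (ps @ [u]) v = q)) \<le>
     (\<Sum>v\<in>?I. of_bool (labelled_fringe ps v = q)
      + (of_bool (u \<in> set (descendants ps v) \<and> length (descendants ps v) = ?m) :: real))"
    by (rule sum_mono) (rule 1)
  moreover have "(\<Sum>v\<in>?I. of_bool (labelled_fringe ps v = q)) \<le>
     (\<Sum>v\<in>?I. of_bool (labelled_fringe (ps @ [u]) v = q)
      + (of_bool (u \<in> set (descendants ps v) \<and> length (descendants ps v) = Suc ?m) :: real))"
    by (rule sum_mono) (rule 2)
  ultimately show ?thesis
    using A[of ?m] A[of "Suc ?m"] unfolding occurrences_snoc occurrences_eq_sum sum.distrib
    by (auto simp: abs_le_iff simp del: sum_of_bool_eq)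
qed

lemma set_attach:
  assumes "increasing_tree ps"
  shows "set_pmf (attach p ps) \<subseteq> (\<lambda>u. ps @ [u]) ` {..length ps}"
proof
  fix qs assume "qs \<in> set_pmf (attach p ps)"
  then obtain V k where "V \<le> length ps" "qs = ps @ [(parent ps ^^ k) V]"
    by (auto simp: attach_def)
  then show "qs \<in> (\<lambda>u. ps @ [u]) ` {..length ps}"
    using funpow_parent_le[OF assms, of V k] by auto
qed

lemma expectation_attach:
  fixes f :: "ptree \<Rightarrow> real"
  assumes "increasing_tree ps"
  shows "measure_pmf.expectation (attach p ps) f =
    (\<Sum>V\<in>vertices ps. measure_pmf.expectation p (\<lambda>z. f (ps @ [(parent ps ^^ min z (depth ps V)) V])))
     / (real (length ps) + 1)"
proof -
  define \<kappa> where "\<kappa> V = map_pmf (\<lambda>z. ps @ [(parent ps ^^ min z (depth ps V)) V]) p" for V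
  have \<kappa>: "attach p ps = pmf_of_set (vertices ps) \<bind> \<kappa>"
    unfolding attach_def map_pmf_def \<kappa>_def by simp
  then have "finite (set_pmf (\<kappa> V))" if "V \<in> vertices ps" for V
    using set_attach[OF assms, of p] that
    by (intro finite_subset[of "set_pmf (\<kappa> V)" "(\<lambda>u. ps @ [u]) ` {..length ps}"])
      (auto simp del: mem_vertices)
  then have "measure_pmf.expectation (pmf_of_set (vertices ps) \<bind> \<kappa>) f =
      (\<Sum>V\<in>vertices ps. measure_pmf.expectation (\<kappa> V) f) / (real (length ps) + 1)"
    by (subst pmf_expectation_bind[of "vertices ps"])
      (auto simp: sum_divide_distrib add.commute)
  then show ?thesis by (simp add: \<kappa>[symmetric]) (simp add: \<kappa>_def)
qed

text \<open>
  The vertices \<open>V\<close> inside the fringe at \<open>v\<close> contribute its transition rate, the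
  \<open>length ps - length (labelled_fringe ps v)\<close> others leave it as it is.
\<close>

lemma sum_transitions_of_fringe:
  assumes "increasing_tree ps" "v \<in> {1..length ps}"
  shows "(\<Sum>V\<in>vertices ps. measure_pmf.prob p
      {z. labelled_fringe (ps @ [(parent ps ^^ min z (depth ps V)) V]) v = q}) =
    rate p (labelled_fringe ps v) q + (real (length ps) - real (length q)) * of_bool (labelled_fringe ps v = q)"
proof -
  let ?L = "descendants ps v" and ?q = "labelled_fringe ps v"
  have v: "0 < v" "v \<le> length ps" using assms(2) by auto
  have len: "Suc (length ?q) = length ?L" by (rule length_labelled_fringe[OF v(2)])
  have sub: "set ?L \<subseteq> vertices ps" using mem_descendants[OF assms(1)] by auto
  let ?P = "\<lambda>V. measure_pmf.prob p {z. labelled_fringe (ps @ [(parent ps ^^ min z (depth ps V)) V]) v = q}"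
  have "sum ?P (vertices ps) = sum ?P (vertices ps - set ?L) + sum ?P (set ?L)"
    by (rule sum.subset_diff[OF sub]) simp
  also have "sum ?P (vertices ps - set ?L) = (\<Sum>V\<in>vertices ps - set ?L. of_bool (?q = q))"
    by (rule sum.cong) (use assms(1) v in \<open>auto simp: labelled_fringe_attach\<close>)
  also have "\<dots> = (real (length ps) - real (length ?q)) * of_bool (?q = q)"
    using sub len card_mono[OF _ sub] by (simp add: card_Diff_subset distinct_card of_nat_diff)
  also have "\<dots> = (real (length ps) - real (length q)) * of_bool (?q = q)" by auto
  also have "sum ?P (set ?L) = (\<Sum>V\<in>set ?L. measure_pmf.prob p {z. grow ?q (position ?L V) z = q})"
    by (rule sum.cong) (use sub assms(1) v in \<open>auto simp: labelled_fringe_attach\<close>)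
  also have "\<dots> = rate p ?q q"
  proof -
    have "inj_on ((!) ?L) (vertices ?q)" using len by (intro inj_on_nth) auto
    moreover have "(!) ?L ` vertices ?q = set ?L"
      using len by (auto simp: set_conv_nth image_iff less_Suc_eq_le[symmetric])
    ultimately have "(\<Sum>V\<in>set ?L. measure_pmf.prob p {z. grow ?q (position ?L V) z = q}) =
        (\<Sum>i\<in>vertices ?q. measure_pmf.prob p {z. grow ?q (position ?L (?L ! i)) z = q})"
      using sum.reindex[of "(!) ?L" "vertices ?q"] by (simp add: comp_def)
    also have "\<dots> = rate p ?q q"
      unfolding rate_def using len by (intro sum.cong) (auto simp: position_nth)
    finally show ?thesis .
  qed
  finally show ?thesis by simp
qed

lemma expectation_occurrences_attach:
  assumes "increasing_tree ps"
  shows "measure_pmf.expectation (attach p ps) (\<lambda>ps. real (occurrences q ps)) =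
    real (occurrences q ps) + of_bool (q = []) +
    (of_bool (q \<noteq> []) * rate p (butlast q) q * real (occurrences (butlast q) ps)
      - (real (length q) + 1 - rate p q q) * real (occurrences q ps)) / (real (length ps) + 1)"
proof -
  let ?n = "real (length ps)" and ?I = "{1..length ps}"
  let ?u = "\<lambda>V z. (parent ps ^^ min z (depth ps V)) V"
  have E: "measure_pmf.expectation p (\<lambda>z. real (occurrences q (ps @ [?u V z]))) =
      (\<Sum>v\<in>?I. measure_pmf.prob p {z. labelled_fringe (ps @ [?u V z]) v = q}) + of_bool (q = [])" for V
  proof -
    have ind: "of_bool (labelled_fringe (ps @ [?u V z]) v = q) =
        indicator {z. labelled_fringe (ps @ [?u V z]) v = q} z" for v z
      by (simp add: indicator_def)
    have int: "integrable (measure_pmf p) (indicat_real A)" for A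
      by (rule measure_pmf.integrable_const_bound[where B = 1]) auto
    show ?thesis
      unfolding occurrences_snoc ind
      by (subst Bochner_Integration.integral_add, rule Bochner_Integration.integrable_sum, rule int, simp,
          subst Bochner_Integration.integral_sum, rule int, simp)
  qed
  have "measure_pmf.expectation (attach p ps) (\<lambda>ps. real (occurrences q ps)) * (?n + 1) =
      (\<Sum>V\<in>vertices ps. (\<Sum>v\<in>?I. measure_pmf.prob p {z. labelled_fringe (ps @ [?u V z]) v = q}) + of_bool (q = []))"
    unfolding expectation_attach[OF assms] E by simp
  also have "\<dots> = (\<Sum>v\<in>?I. \<Sum>V\<in>vertices ps. measure_pmf.prob p {z. labelled_fringe (ps @ [?u V z]) v = q})
      + (?n + 1) * of_bool (q = [])"
    by (simp add: sum.distrib sum.swap[of _ "vertices ps"] del: of_bool_eq_0_iff)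
  also have "(\<Sum>v\<in>?I. \<Sum>V\<in>vertices ps. measure_pmf.prob p {z. labelled_fringe (ps @ [?u V z]) v = q}) =
      (\<Sum>v\<in>?I. rate p (labelled_fringe ps v) q + (?n - real (length q)) * of_bool (labelled_fringe ps v = q))"
    by (intro sum.cong sum_transitions_of_fringe assms) auto
  also have "\<dots> = (\<Sum>v\<in>?I. (rate p q q + ?n - real (length q)) * of_bool (labelled_fringe ps v = q)
      + of_bool (q \<noteq> []) * rate p (butlast q) q * of_bool (labelled_fringe ps v = butlast q))"
  proof (intro sum.cong refl)
    fix v assume "v \<in> ?I"
    have "butlast q \<noteq> q" if "q \<noteq> []"
      using that by (metis append_butlast_last_id not_Cons_self2 self_append_conv)
    then show "rate p (labelled_fringe ps v) q + (?n - real (length q)) * of_bool (labelled_fringe ps v = q) =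
      (rate p q q + ?n - real (length q)) * of_bool (labelled_fringe ps v = q)
      + of_bool (q \<noteq> []) * rate p (butlast q) q * of_bool (labelled_fringe ps v = butlast q)"
      using rate_eq_0[of "labelled_fringe ps v" q p] by (auto simp: algebra_simps)
  qed
  also have "\<dots> = (rate p q q + ?n - real (length q)) * real (occurrences q ps)
      + of_bool (q \<noteq> []) * rate p (butlast q) q * real (occurrences (butlast q) ps)"
    unfolding occurrences_eq_sum by (simp only: sum.distrib sum_distrib_left)
  finally show ?thesis by (simp add: field_simps)
qed

lemma discrete_tree_Suc:
  "n \<ge> 1 \<Longrightarrow> discrete_tree p (Suc n) = bind_pmf (discrete_tree p n) (attach p)"
  by (cases n) (auto simp: discrete_tree_def)

lemma discrete_tree_support:
  "ps \<in> set_pmf (discrete_tree p n) \<Longrightarrow> increasing_tree ps \<and> length ps = max n 1"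
proof (induction n arbitrary: ps)
  case (Suc n)
  show ?case
  proof (cases "n \<ge> 1")
    case True
    from Suc.prems obtain qs where qs: "qs \<in> set_pmf (discrete_tree p n)" "ps \<in> set_pmf (attach p qs)"
      by (auto simp: discrete_tree_Suc[OF True])
    from Suc.IH[OF qs(1)] set_attach[of qs p] qs(2) True show ?thesis by auto
  next
    case False
    then have "n = 0" by simp
    then show ?thesis using Suc.prems by (simp add: discrete_tree_def increasing_tree_def)
  qed
qed (simp add: discrete_tree_def increasing_tree_def)

lemma finite_increasing_trees: "finite {ps. increasing_tree ps \<and> length ps \<le> n}"
proof (rule finite_subset)
  show "{ps. increasing_tree ps \<and> length ps \<le> n} \<subseteq> {ps. set ps \<subseteq> {..n} \<and> length ps \<le> n}"
  proof
    fix ps assume ps: "ps \<in> {ps. increasing_tree ps \<and> length ps \<le> n}"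
    then have "ps ! i \<le> n" if "i < length ps" for i
      using that unfolding increasing_tree_def by force
    then show "ps \<in> {ps. set ps \<subseteq> {..n} \<and> length ps \<le> n}"
      using ps by (auto simp: in_set_conv_nth)
  qed
qed (rule finite_lists_length_le, simp)

lemma finite_set_discrete_tree: "finite (set_pmf (discrete_tree p n))"
  by (rule finite_subset[OF _ finite_increasing_trees[of "max n 1"]])
    (use discrete_tree_support in auto)

text \<open>
  The drift of \<open>occurrences q\<close> involves besides itself only \<open>occurrences (butlast q)\<close>, whose
  limit is known by induction.
\<close>

lemma occurrences_L1_limit:
  assumes \<nu>: "\<And>q. (real (length q) + 2) * \<nu> q =
    of_bool (q = []) + \<nu> q * rate p q q + of_bool (q \<noteq> []) * \<nu> (butlast q) * rate p (butlast q) q"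
  shows "L1_limit (discrete_tree p) (\<lambda>n ps. real (occurrences q ps) / (real n + 1)) (\<nu> q)"
proof (induction q rule: length_induct)
  case (1 q)
  show ?case
  proof (rule stochastic_approximation[where \<kappa> = "attach p" and b = 2 and c = "of_bool (q = [])"
      and a = "real (length q) + 1 - rate p q q"
      and L = "\<lambda>ps. of_bool (q \<noteq> []) * rate p (butlast q) q * real (occurrences (butlast q) ps)"
      and l = "of_bool (q \<noteq> []) * rate p (butlast q) q * \<nu> (butlast q)"])
    show "finite (set_pmf (discrete_tree p n))" for n by (rule finite_set_discrete_tree)
    show "discrete_tree p (Suc n) = discrete_tree p n \<bind> attach p" if "1 \<le> n" for n
      by (rule discrete_tree_Suc[OF that])
    show "real (length q) + 1 - rate p q q \<ge> 0" using rate_le[of p q q] by simp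
    show "\<nu> q * (1 + (real (length q) + 1 - rate p q q)) =
      of_bool (q \<noteq> []) * rate p (butlast q) q * \<nu> (butlast q) + of_bool (q = [])"
      using \<nu>[of q] by (simp add: algebra_simps)
    show "L1_limit (discrete_tree p)
      (\<lambda>n x. of_bool (q \<noteq> []) * rate p (butlast q) q * real (occurrences (butlast q) x) / (real n + 1))
      (of_bool (q \<noteq> []) * rate p (butlast q) q * \<nu> (butlast q))"
    proof (cases "q = []")
      case False
      then have "length (butlast q) < length q" by simp
      then have "L1_limit (discrete_tree p) (\<lambda>n ps. real (occurrences (butlast q) ps) / (real n + 1)) (\<nu> (butlast q))"
        using "1.IH" by blast
      from L1_limit_cmult[OF this, of "rate p (butlast q) q"] False show ?thesis by simp
    qed (simp add: L1_limit_0)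
    fix n ps assume n: "(1::nat) \<le> n" and "ps \<in> set_pmf (discrete_tree p n)"
    then have ps: "increasing_tree ps" "length ps = n"
      using discrete_tree_support[of ps p n] by auto
    show "finite (set_pmf (attach p ps))"
      by (rule finite_subset[OF set_attach[OF ps(1)]]) simp
    show "\<bar>real (occurrences q ps)\<bar> \<le> real n" using occurrences_le[of q ps] ps by simp
    show "measure_pmf.expectation (attach p ps) (\<lambda>x. real (occurrences q x)) =
      real (occurrences q ps) + of_bool (q = []) +
      (of_bool (q \<noteq> []) * rate p (butlast q) q * real (occurrences (butlast q) ps) -
       (real (length q) + 1 - rate p q q) * real (occurrences q ps)) / (real n + 1)"
      using expectation_occurrences_attach[OF ps(1)] ps(2) by simp
    fix ps' assume "ps' \<in> set_pmf (attach p ps)"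
    then obtain u where "ps' = ps @ [u]" "u \<le> length ps" using set_attach[OF ps(1)] by auto
    then show "\<bar>real (occurrences q ps') - real (occurrences q ps)\<bar> \<le> 2"
      using occurrences_increment[OF ps(1)] by simp
  qed
qed

definition fringe_freq :: "rtree set \<Rightarrow> ptree \<Rightarrow> real" where
  "fringe_freq A ps = real (card {v \<in> vertices ps. fringe ps v \<in> A}) / real (card (vertices ps))"

text \<open>
  The histories that lead to \<open>t\<close>.  They are finitely many, since all have as many vertices as \<open>t\<close>.
\<close>

definition orderings :: "rtree \<Rightarrow> ptree set" where
  "orderings t = {q. increasing_tree q \<and> fringe q 0 = t}"

lemma finite_orderings: "finite (orderings t)"
  by (rule finite_subset[OF _ finite_increasing_trees[of "num_vertices t"]])
    (auto simp: orderings_def num_vertices_fringe_0)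

lemma card_fringe_eq:
  assumes "increasing_tree ps"
  shows "real (card {v \<in> vertices ps. fringe ps v = t}) =
    (\<Sum>q\<in>orderings t. real (occurrences q ps)) + of_bool (fringe ps 0 = t)"
proof -
  have "real (card {v \<in> vertices ps. fringe ps v = t}) = (\<Sum>v\<in>vertices ps. of_bool (fringe ps v = t))"
    by (simp add: Int_def)
  also have "\<dots> = of_bool (fringe ps 0 = t) + (\<Sum>v\<in>{1..length ps}. (of_bool (fringe ps v = t) :: real))"
  proof -
    have "vertices ps = insert 0 {1..length ps}" by auto
    then show ?thesis by (simp only:) (subst sum.insert, auto)
  qed
  also have "(\<Sum>v\<in>{1..length ps}. (of_bool (fringe ps v = t) :: real)) =
      (\<Sum>v\<in>{1..length ps}. \<Sum>q\<in>orderings t. of_bool (labelled_fringe ps v = q))"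
  proof (rule sum.cong[OF refl])
    fix v assume "v \<in> {1..length ps}"
    then have "labelled_fringe ps v \<in> orderings t \<longleftrightarrow> fringe ps v = t"
      using assms by (auto simp: orderings_def increasing_tree_labelled_fringe fringe_labelled_fringe)
    then show "(of_bool (fringe ps v = t) :: real) = (\<Sum>q\<in>orderings t. of_bool (labelled_fringe ps v = q))"
      by (simp add: of_bool_def sum.delta finite_orderings)
  qed
  also have "\<dots> = (\<Sum>q\<in>orderings t. real (occurrences q ps))"
    unfolding occurrences_eq_sum by (rule sum.swap)
  finally show ?thesis by simp
qed

lemma fringe_freq_singleton_L1_limit:
  assumes \<nu>: "\<And>q. (real (length q) + 2) * \<nu> q =
    of_bool (q = []) + \<nu> q * rate p q q + of_bool (q \<noteq> []) * \<nu> (butlast q) * rate p (butlast q) q"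
  shows "L1_limit (discrete_tree p) (\<lambda>_. fringe_freq {t}) (\<Sum>q\<in>orderings t. \<nu> q)"
proof (rule L1_limitI[OF finite_set_discrete_tree, where m = 1 and
    Y = "\<lambda>n ps. \<bar>(\<Sum>q\<in>orderings t. real (occurrences q ps) / (real n + 1)) - (\<Sum>q\<in>orderings t. \<nu> q)\<bar> + 1 / (real n + 1)"])
  fix n ps assume "1 \<le> n" "ps \<in> set_pmf (discrete_tree p n)"
  then have ps: "increasing_tree ps" "length ps = n" using discrete_tree_support[of ps p n] by auto
  have eq: "fringe_freq {t} ps = (\<Sum>q\<in>orderings t. real (occurrences q ps) / (real n + 1)) +
      of_bool (fringe ps 0 = t) / (real n + 1)"
    unfolding fringe_freq_def singleton_iff card_fringe_eq[OF ps(1)]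
    by (simp only: card_vertices ps sum_divide_distrib add_divide_distrib) (simp add: add.commute)
  then show "\<bar>fringe_freq {t} ps - (\<Sum>q\<in>orderings t. \<nu> q)\<bar> \<le>
     \<bar>(\<Sum>q\<in>orderings t. real (occurrences q ps) / (real n + 1)) - (\<Sum>q\<in>orderings t. \<nu> q)\<bar> + 1 / (real n + 1)"
  proof -
    have "0 \<le> of_bool (fringe ps 0 = t) / (real n + 1)"
      "of_bool (fringe ps 0 = t) / (real n + 1) \<le> 1 / (real n + 1)"
      by (auto simp: divide_right_mono)
    then show ?thesis unfolding eq by linarith
  qed
next
  have "L1_limit (discrete_tree p) (\<lambda>n ps. \<Sum>q\<in>orderings t. real (occurrences q ps) / (real n + 1)) (\<Sum>q\<in>orderings t. \<nu> q)"
    by (intro L1_limit_sum finite_set_discrete_tree finite_orderings occurrences_L1_limit[where \<nu> = \<nu>] \<nu>)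
  moreover have "(\<lambda>n. 1 / (real n + 1)) \<longlonglongrightarrow> 0" by real_asymp
  ultimately have "(\<lambda>n. measure_pmf.expectation (discrete_tree p n)
      (\<lambda>ps. \<bar>(\<Sum>q\<in>orderings t. real (occurrences q ps) / (real n + 1)) - (\<Sum>q\<in>orderings t. \<nu> q)\<bar>) + 1 / (real n + 1)) \<longlonglongrightarrow> 0 + 0"
    unfolding L1_limit_def by (intro tendsto_add)
  then show "(\<lambda>n. measure_pmf.expectation (discrete_tree p n)
      (\<lambda>ps. \<bar>(\<Sum>q\<in>orderings t. real (occurrences q ps) / (real n + 1)) - (\<Sum>q\<in>orderings t. \<nu> q)\<bar> + 1 / (real n + 1))) \<longlonglongrightarrow> 0"
    by (simp add: integrable_measure_pmf_finite finite_set_discrete_tree)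
qed

section \<open>Memoryless clocks\<close>

lemma prob_space_exp_law: "prob_space exp_law"
  unfolding exp_law_def by (rule prob_space_exponential_density) simp

lemma sets_exp_law [measurable_cong]: "sets exp_law = sets borel"
  by (simp add: exp_law_def)

lemma space_exp_law [simp]: "space exp_law = UNIV"
  by (simp add: exp_law_def)

definition ticks :: "nat pmf \<Rightarrow> (real \<times> nat) stream measure" where
  "ticks p = stream_space (exp_law \<Otimes>\<^sub>M measure_pmf p)"

lemma clock_space_eq: "clock_space p = (\<Pi>\<^sub>M v\<in>UNIV. ticks p)"
  by (simp add: clock_space_def ticks_def)

lemma prob_space_tick: "prob_space (exp_law \<Otimes>\<^sub>M measure_pmf p)"
  by (intro prob_space_pair prob_space_exp_law prob_space_measure_pmf)

lemma prob_space_ticks: "prob_space (ticks p)"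
  unfolding ticks_def by (intro prob_space.prob_space_stream_space prob_space_tick)

lemma prob_space_clock_space: "prob_space (clock_space p)"
  unfolding clock_space_eq by (intro prob_space_PiM prob_space_ticks)

lemma space_ticks [simp]: "space (ticks p) = UNIV"
  by (simp add: ticks_def space_stream_space space_pair_measure)

lemma space_clock_space [simp]: "space (clock_space p) = UNIV"
  by (simp add: clock_space_eq space_PiM)

lemma measurable_clock [measurable]: "(\<lambda>\<omega>. \<omega> w) \<in> clock_space p \<rightarrow>\<^sub>M ticks p"
  unfolding clock_space_eq by (rule measurable_component_singleton) simp

lemma measurable_clocksI:
  "(\<And>w. (\<lambda>x. F x w) \<in> N \<rightarrow>\<^sub>M ticks p) \<Longrightarrow> F \<in> N \<rightarrow>\<^sub>M clock_space p"
  unfolding clock_space_eq by (rule measurable_PiM_single') auto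

lemma measurable_tick_fst [measurable]: "(\<lambda>s. fst (shd s)) \<in> ticks p \<rightarrow>\<^sub>M borel"
proof -
  have "fst \<in> exp_law \<Otimes>\<^sub>M measure_pmf p \<rightarrow>\<^sub>M borel"
    by (subst measurable_cong_sets[OF refl sets_exp_law[symmetric]]) measurable
  then show ?thesis
    unfolding ticks_def by (rule measurable_compose[OF measurable_shd])
qed

lemma measurable_tick_snd [measurable]: "(\<lambda>s. snd (shd s)) \<in> ticks p \<rightarrow>\<^sub>M count_space UNIV"
proof -
  have "snd \<in> exp_law \<Otimes>\<^sub>M measure_pmf p \<rightarrow>\<^sub>M count_space UNIV"
    by (rule measurable_compose[OF measurable_snd]) (auto simp: measurable_def)
  then show ?thesis
    unfolding ticks_def by (rule measurable_compose[OF measurable_shd])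
qed

lemma measurable_tick_stl [measurable]: "stl \<in> ticks p \<rightarrow>\<^sub>M ticks p"
  unfolding ticks_def by measurable

lemma measurable_tick_Cons:
  assumes [measurable]: "f \<in> N \<rightarrow>\<^sub>M borel" "g \<in> N \<rightarrow>\<^sub>M count_space UNIV" "h \<in> N \<rightarrow>\<^sub>M ticks p"
  shows "(\<lambda>x. (f x, g x) ## h x) \<in> N \<rightarrow>\<^sub>M ticks p"
proof -
  have [measurable]: "f \<in> N \<rightarrow>\<^sub>M exp_law" "g \<in> N \<rightarrow>\<^sub>M measure_pmf p" "h \<in> N \<rightarrow>\<^sub>M stream_space (exp_law \<Otimes>\<^sub>M measure_pmf p)"
    using assms by (auto simp: ticks_def measurable_cong_sets[OF refl sets_exp_law]
       measurable_cong_sets[OF refl sets_measure_pmf_count_space])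
  show ?thesis unfolding ticks_def by measurable
qed

definition shift_ring :: "real \<Rightarrow> (real \<times> nat) stream \<Rightarrow> (real \<times> nat) stream" where
  "shift_ring a s = (fst (shd s) - a, snd (shd s)) ## stl s"

lemma measurable_shift_ring:
  assumes [measurable]: "a \<in> N \<rightarrow>\<^sub>M borel" "s \<in> N \<rightarrow>\<^sub>M ticks p"
  shows "(\<lambda>x. shift_ring (a x) (s x)) \<in> N \<rightarrow>\<^sub>M ticks p"
  unfolding shift_ring_def by (rule measurable_tick_Cons) measurable

text \<open>
  Simultaneous rings are attributed to the smallest label, so a clock with a smaller label than the
  first one to ring has to ring strictly later, and the others weakly later.  The flag covers both
  cases, which makes the description of the first ring exact instead of almost sure.
\<close>

definition beyond :: "bool \<Rightarrow> real \<Rightarrow> real set" where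
  "beyond strict a = (if strict then {a<..} else {a..})"

lemma beyond_sets [measurable]: "beyond b a \<in> sets borel"
  by (simp add: beyond_def)

lemma exp_law_memoryless:
  assumes a: "a \<ge> 0" and f: "f \<in> borel_measurable borel"
  shows "(\<integral>\<^sup>+ x. indicator (beyond b a) x * f (x - a) \<partial>exp_law) = ennreal (exp (- a)) * (\<integral>\<^sup>+ x. f x \<partial>exp_law)"
proof -
  note [measurable] = f
  have "(\<integral>\<^sup>+ x. indicator (beyond b a) x * f (x - a) \<partial>exp_law) =
    (\<integral>\<^sup>+ x. ennreal (exponential_density 1 x) * (indicator (beyond b a) x * f (x - a)) \<partial>lborel)"
    unfolding exp_law_def by (rule nn_integral_density) measurable
  also have "\<dots> = (\<integral>\<^sup>+ y. ennreal (exponential_density 1 (a + 1 * y)) * (indicator (beyond b a) (a + 1 * y) * f (a + 1 * y - a)) \<partial>lborel)"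
    by (subst nn_integral_real_affine[where c = 1 and t = a]) simp_all
  also have "\<dots> = (\<integral>\<^sup>+ y. ennreal (exp (- a)) * (ennreal (exponential_density 1 y) * f y) \<partial>lborel)"
  proof (rule nn_integral_cong_AE)
    have "AE y in lborel. y \<noteq> (0::real)" by (rule AE_lborel_singleton)
    then show "AE y in lborel. ennreal (exponential_density 1 (a + 1 * y)) * (indicator (beyond b a) (a + 1 * y) * f (a + 1 * y - a)) =
        ennreal (exp (- a)) * (ennreal (exponential_density 1 y) * f y)"
    proof eventually_elim
      case (elim y)
      show ?case
      proof (cases "y > 0")
        case True
        then have "a + y \<in> beyond b a" by (simp add: beyond_def)
        moreover have "exponential_density 1 (a + y) = exp (- a) * exponential_density 1 y"
          using True a by (simp add: exponential_density_def exp_add[symmetric])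
        ultimately show ?thesis by (simp add: ennreal_mult exponential_density_nonneg mult.assoc)
      next
        case False
        then have "y < 0" using elim by simp
        then have "a + y \<notin> beyond b a" by (simp add: beyond_def)
        then show ?thesis using \<open>y < 0\<close> by (simp add: exponential_density_def)
      qed
    qed
  qed
  also have "\<dots> = ennreal (exp (- a)) * (\<integral>\<^sup>+ x. f x \<partial>exp_law)"
    unfolding exp_law_def by (simp add: nn_integral_density nn_integral_cmult)
  finally show ?thesis .
qed

text \<open>
  This is the probability that a clock rings before each of its \<open>m\<close> competitors.
\<close>

lemma exp_law_laplace:
  "(\<integral>\<^sup>+ x. ennreal (exp (- x)) ^ m \<partial>exp_law) = ennreal (1 / (real m + 1))"
proof -
  have "(\<integral>\<^sup>+ x. ennreal (exp (- x)) ^ m \<partial>exp_law) =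
     (\<integral>\<^sup>+ x. ennreal (exponential_density 1 x) * ennreal (exp (- x)) ^ m \<partial>lborel)"
    unfolding exp_law_def by (rule nn_integral_density) measurable
  also have "\<dots> = (\<integral>\<^sup>+ x. ennreal (1 / (real m + 1)) * ennreal (exponential_density (real m + 1) x) \<partial>lborel)"
  proof (rule nn_integral_cong)
    fix x :: real
    have "exponential_density 1 x * exp (- x) ^ m = 1 / (real m + 1) * exponential_density (real m + 1) x"
    proof -
      have "exp (- x) * exp (- x) ^ m = exp (- x * (real m + 1))"
        by (simp add: exp_of_nat_mult[symmetric] exp_add[symmetric] algebra_simps)
      moreover have "real m + 1 \<noteq> 0" by linarith
      ultimately show ?thesis by (simp add: exponential_density_def)
    qed
    then show "ennreal (exponential_density 1 x) * ennreal (exp (- x)) ^ m =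
      ennreal (1 / (real m + 1)) * ennreal (exponential_density (real m + 1) x)"
      by (simp add: ennreal_power ennreal_mult[symmetric] exponential_density_nonneg)
  qed
  also have "\<dots> = ennreal (1 / (real m + 1)) * emeasure (density lborel (\<lambda>x. ennreal (exponential_density (real m + 1) x))) UNIV"
    by (simp add: nn_integral_cmult emeasure_density)
  also have "emeasure (density lborel (\<lambda>x. ennreal (exponential_density (real m + 1) x))) UNIV = 1"
    using prob_space.emeasure_space_1[OF prob_space_exponential_density[of "real m + 1"]] by simp
  finally show ?thesis by simp
qed

lemma AE_exp_law_nonneg: "AE x in exp_law. x \<ge> 0"
  unfolding exp_law_def by (subst AE_density) (auto simp: exponential_density_def)

lemma nn_integral_ticks:
  assumes f: "f \<in> borel_measurable (ticks p)"
  shows "(\<integral>\<^sup>+ s. f s \<partial>ticks p) = (\<integral>\<^sup>+ z. \<integral>\<^sup>+ x. \<integral>\<^sup>+ s. f ((x, z) ## s) \<partial>ticks p \<partial>exp_law \<partial>measure_pmf p)"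
proof -
  interpret E: prob_space exp_law by (rule prob_space_exp_law)
  interpret T: prob_space "exp_law \<Otimes>\<^sub>M measure_pmf p" by (rule prob_space_tick)
  interpret S: prob_space "stream_space (exp_law \<Otimes>\<^sub>M measure_pmf p)"
    by (rule T.prob_space_stream_space)
  interpret EP: pair_prob_space exp_law "measure_pmf p" ..
  have [measurable]: "f \<in> borel_measurable (stream_space (exp_law \<Otimes>\<^sub>M measure_pmf p))"
    using f by (simp add: ticks_def)
  have "(\<integral>\<^sup>+ s. f s \<partial>ticks p) = (\<integral>\<^sup>+ x. \<integral>\<^sup>+ s. f (x ## s) \<partial>ticks p \<partial>(exp_law \<Otimes>\<^sub>M measure_pmf p))"
    unfolding ticks_def by (rule T.nn_integral_stream_space) measurable
  also have "\<dots> = (\<integral>\<^sup>+ z. \<integral>\<^sup>+ x. \<integral>\<^sup>+ s. f ((x, z) ## s) \<partial>ticks p \<partial>exp_law \<partial>measure_pmf p)"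
    unfolding ticks_def by (rule EP.nn_integral_snd[symmetric]) measurable
  finally show ?thesis .
qed

lemma measurable_ticks_integrals:
  assumes f: "f \<in> borel_measurable (ticks p)"
  shows "(\<lambda>x. \<integral>\<^sup>+ s. f ((x, z) ## s) \<partial>ticks p) \<in> borel_measurable borel"
proof -
  interpret S: prob_space "ticks p" by (rule prob_space_ticks)
  have "(\<lambda>(x, s). f ((x, z) ## s)) \<in> borel_measurable (borel \<Otimes>\<^sub>M ticks p)"
    unfolding case_prod_beta
    by (rule measurable_compose[OF _ f], rule measurable_tick_Cons) measurable
  then show ?thesis by (rule S.borel_measurable_nn_integral)
qed

lemma ticks_memoryless:
  assumes a: "a \<ge> 0" and f: "f \<in> borel_measurable (ticks p)"
  shows "(\<integral>\<^sup>+ s. indicator (beyond b a) (fst (shd s)) * f (shift_ring a s) \<partial>ticks p) =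
    ennreal (exp (- a)) * (\<integral>\<^sup>+ s. f s \<partial>ticks p)"
proof -
  note [measurable] = measurable_compose[OF measurable_shift_ring f]
  interpret S: prob_space "ticks p" by (rule prob_space_ticks)
  have fc: "(\<lambda>s. f ((x, z) ## s)) \<in> borel_measurable (ticks p)" for x z
    by (rule measurable_compose[OF measurable_tick_Cons f]) measurable
  have "(\<integral>\<^sup>+ s. indicator (beyond b a) (fst (shd s)) * f (shift_ring a s) \<partial>ticks p) =
    (\<integral>\<^sup>+ z. \<integral>\<^sup>+ x. indicator (beyond b a) x * (\<integral>\<^sup>+ s. f ((x - a, z) ## s) \<partial>ticks p) \<partial>exp_law \<partial>measure_pmf p)"
    by (subst nn_integral_ticks, measurable) (simp add: shift_ring_def nn_integral_cmult fc)
  also have "\<dots> = (\<integral>\<^sup>+ z. ennreal (exp (- a)) * (\<integral>\<^sup>+ x. \<integral>\<^sup>+ s. f ((x, z) ## s) \<partial>ticks p \<partial>exp_law) \<partial>measure_pmf p)"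
    by (intro nn_integral_cong exp_law_memoryless[OF a] measurable_ticks_integrals f)
  also have "\<dots> = ennreal (exp (- a)) * (\<integral>\<^sup>+ s. f s \<partial>ticks p)"
    by (simp add: nn_integral_cmult nn_integral_ticks[OF f])
  finally show ?thesis .
qed

lemma measurable_resample [measurable]:
  "(\<lambda>(s, \<omega>). \<omega> (v := s)) \<in> ticks p \<Otimes>\<^sub>M clock_space p \<rightarrow>\<^sub>M clock_space p"
proof (rule measurable_clocksI)
  show "(\<lambda>x. (case x of (s, \<omega>) \<Rightarrow> \<omega> (v := s)) w) \<in> ticks p \<Otimes>\<^sub>M clock_space p \<rightarrow>\<^sub>M ticks p" for w
    by (cases "w = v") (simp_all add: case_prod_beta)
qed

text \<open>
  Replacing one coordinate by an independent copy preserves a product measure.  This isolates one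
  clock without splitting the index set.
\<close>

lemma nn_integral_resample:
  assumes F: "F \<in> borel_measurable (clock_space p)"
  shows "(\<integral>\<^sup>+ \<omega>. F \<omega> \<partial>clock_space p) = (\<integral>\<^sup>+ s. \<integral>\<^sup>+ \<omega>. F (\<omega> (v := s)) \<partial>clock_space p \<partial>ticks p)"
    and "(\<integral>\<^sup>+ \<omega>. F \<omega> \<partial>clock_space p) = (\<integral>\<^sup>+ \<omega>. \<integral>\<^sup>+ s. F (\<omega> (v := s)) \<partial>ticks p \<partial>clock_space p)"
proof -
  interpret S: prob_space "ticks p" by (rule prob_space_ticks)
  interpret C: prob_space "clock_space p" by (rule prob_space_clock_space)
  interpret SC: pair_prob_space "ticks p" "clock_space p" ..
  have d: "distr (ticks p \<Otimes>\<^sub>M clock_space p) (clock_space p) (\<lambda>(s, \<omega>). \<omega> (v := s)) = clock_space p"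
    using distr_pair_PiM_eq_PiM[of UNIV "\<lambda>_. ticks p" v] prob_space_ticks
    by (simp add: clock_space_eq)
  have m: "(\<lambda>x. F (case x of (s, \<omega>) \<Rightarrow> \<omega> (v := s))) \<in> borel_measurable (ticks p \<Otimes>\<^sub>M clock_space p)"
    by (rule measurable_compose[OF measurable_resample F])
  have *: "(\<integral>\<^sup>+ \<omega>. F \<omega> \<partial>clock_space p) = (\<integral>\<^sup>+ x. F (case x of (s, \<omega>) \<Rightarrow> \<omega> (v := s)) \<partial>(ticks p \<Otimes>\<^sub>M clock_space p))"
    using nn_integral_distr[OF measurable_resample[of v p], of F] F by (simp add: d)
  show "(\<integral>\<^sup>+ \<omega>. F \<omega> \<partial>clock_space p) = (\<integral>\<^sup>+ s. \<integral>\<^sup>+ \<omega>. F (\<omega> (v := s)) \<partial>clock_space p \<partial>ticks p)"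
    using C.nn_integral_fst[OF m] by (simp add: *)
  show "(\<integral>\<^sup>+ \<omega>. F \<omega> \<partial>clock_space p) = (\<integral>\<^sup>+ \<omega>. \<integral>\<^sup>+ s. F (\<omega> (v := s)) \<partial>ticks p \<partial>clock_space p)"
    using SC.nn_integral_snd[OF m] by (simp add: *)
qed

lemma clock_memoryless:
  assumes a: "a \<ge> 0" and G: "G \<in> borel_measurable (clock_space p)"
  shows "(\<integral>\<^sup>+ \<omega>. indicator (beyond b a) (fst (shd (\<omega> w))) * G (\<omega> (w := shift_ring a (\<omega> w))) \<partial>clock_space p) =
    ennreal (exp (- a)) * (\<integral>\<^sup>+ \<omega>. G \<omega> \<partial>clock_space p)"
proof -
  have upd: "(\<lambda>s. \<omega> (w := s)) \<in> ticks p \<rightarrow>\<^sub>M clock_space p" for \<omega>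
    by (rule measurable_clocksI) (auto simp: fun_upd_def)
  have shift: "(\<lambda>\<omega>. \<omega> (w := shift_ring a (\<omega> w))) \<in> clock_space p \<rightarrow>\<^sub>M clock_space p"
  proof (rule measurable_clocksI)
    show "(\<lambda>x. (x(w := shift_ring a (x w))) w') \<in> clock_space p \<rightarrow>\<^sub>M ticks p" for w'
      by (cases "w' = w") (auto intro: measurable_shift_ring)
  qed
  note [measurable] = measurable_compose[OF shift G]
  interpret S: prob_space "ticks p" by (rule prob_space_ticks)
  have [measurable]: "(\<lambda>\<omega>. \<integral>\<^sup>+ s. G (\<omega> (w := s)) \<partial>ticks p) \<in> borel_measurable (clock_space p)"
  proof (rule S.borel_measurable_nn_integral)
    have "(\<lambda>x. case (snd x, fst x) of (s, \<omega>) \<Rightarrow> \<omega> (w := s)) \<in> clock_space p \<Otimes>\<^sub>M ticks p \<rightarrow>\<^sub>M clock_space p"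
      by (rule measurable_compose[OF _ measurable_resample]) measurable
    from measurable_compose[OF this G]
    show "(\<lambda>(\<omega>, s). G (\<omega> (w := s))) \<in> borel_measurable (clock_space p \<Otimes>\<^sub>M ticks p)"
      by (simp add: case_prod_beta)
  qed
  have "(\<integral>\<^sup>+ \<omega>. indicator (beyond b a) (fst (shd (\<omega> w))) * G (\<omega> (w := shift_ring a (\<omega> w))) \<partial>clock_space p) =
    (\<integral>\<^sup>+ \<omega>. \<integral>\<^sup>+ s. indicator (beyond b a) (fst (shd s)) * G (\<omega> (w := shift_ring a s)) \<partial>ticks p \<partial>clock_space p)"
    by (subst nn_integral_resample(2)[where v = w]) simp_all
  also have "\<dots> = (\<integral>\<^sup>+ \<omega>. ennreal (exp (- a)) * (\<integral>\<^sup>+ s. G (\<omega> (w := s)) \<partial>ticks p) \<partial>clock_space p)"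
    by (intro nn_integral_cong ticks_memoryless[OF a] measurable_compose[OF upd G])
  also have "\<dots> = ennreal (exp (- a)) * (\<integral>\<^sup>+ \<omega>. G \<omega> \<partial>clock_space p)"
    by (simp add: nn_integral_cmult nn_integral_resample(2)[OF G, of w])
  finally show ?thesis .
qed

lemma measurable_shift_all:
  assumes "a \<in> N \<rightarrow>\<^sub>M borel" "c \<in> N \<rightarrow>\<^sub>M clock_space p"
  shows "(\<lambda>x w. if w \<in> B then shift_ring (a x) (c x w) else c x w) \<in> N \<rightarrow>\<^sub>M clock_space p"
proof (rule measurable_clocksI)
  note [measurable] = assms
  show "(\<lambda>x. if w \<in> B then shift_ring (a x) (c x w) else c x w) \<in> N \<rightarrow>\<^sub>M ticks p" for w
    by (cases "w \<in> B")
      (auto intro: measurable_shift_ring measurable_compose[OF assms(2) measurable_clock] assms(1))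
qed

text \<open>
  The clocks are shifted one after the other, each at the cost of a factor \<open>exp (- a)\<close>.
\<close>

lemma clocks_memoryless:
  assumes "finite B" and a: "a \<ge> 0"
  shows "G \<in> borel_measurable (clock_space p) \<Longrightarrow>
    (\<integral>\<^sup>+ \<omega>. (\<Prod>w\<in>B. indicator (beyond (b w) a) (fst (shd (\<omega> w))))
        * G (\<lambda>w. if w \<in> B then shift_ring a (\<omega> w) else \<omega> w) \<partial>clock_space p) =
    ennreal (exp (- a)) ^ card B * (\<integral>\<^sup>+ \<omega>. G \<omega> \<partial>clock_space p)"
  using assms(1)
proof (induction B)
  case (insert w B)
  let ?G = "\<lambda>\<omega>. (\<Prod>w\<in>B. indicator (beyond (b w) a) (fst (shd (\<omega> w))))
        * G (\<lambda>w. if w \<in> B then shift_ring a (\<omega> w) else \<omega> w)"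
  have "(\<lambda>\<omega> w. if w \<in> B then shift_ring a (\<omega> w) else \<omega> w) \<in> clock_space p \<rightarrow>\<^sub>M clock_space p"
    by (rule measurable_shift_all) auto
  note [measurable] = measurable_compose[OF this insert.prems]
  have "(\<integral>\<^sup>+ \<omega>. (\<Prod>w\<in>insert w B. indicator (beyond (b w) a) (fst (shd (\<omega> w))))
        * G (\<lambda>w'. if w' \<in> insert w B then shift_ring a (\<omega> w') else \<omega> w') \<partial>clock_space p) =
    (\<integral>\<^sup>+ \<omega>. indicator (beyond (b w) a) (fst (shd (\<omega> w))) * ?G (\<omega> (w := shift_ring a (\<omega> w))) \<partial>clock_space p)"
  proof (rule nn_integral_cong)
    fix \<omega> :: clocks
    let ?\<omega> = "\<omega> (w := shift_ring a (\<omega> w))"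
    have "(\<Prod>w\<in>B. indicator (beyond (b w) a) (fst (shd (?\<omega> w)))) =
        (\<Prod>w\<in>B. indicator (beyond (b w) a) (fst (shd (\<omega> w))) :: ennreal)"
      using insert.hyps by (intro prod.cong) auto
    moreover have "(\<lambda>w'. if w' \<in> B then shift_ring a (?\<omega> w') else ?\<omega> w') =
        (\<lambda>w'. if w' \<in> insert w B then shift_ring a (\<omega> w') else \<omega> w')"
      using insert.hyps by (auto simp: fun_eq_iff)
    ultimately show "(\<Prod>w\<in>insert w B. indicator (beyond (b w) a) (fst (shd (\<omega> w))))
        * G (\<lambda>w'. if w' \<in> insert w B then shift_ring a (\<omega> w') else \<omega> w') =
      indicator (beyond (b w) a) (fst (shd (\<omega> w))) * ?G ?\<omega>"
      using insert.hyps by (simp only: prod.insert mult.assoc not_False_eq_True)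
  qed
  also have "\<dots> = ennreal (exp (- a)) * (\<integral>\<^sup>+ \<omega>. ?G \<omega> \<partial>clock_space p)"
    by (rule clock_memoryless[OF a]) measurable
  also have "\<dots> = ennreal (exp (- a)) ^ card (insert w B) * (\<integral>\<^sup>+ \<omega>. G \<omega> \<partial>clock_space p)"
    using insert by (simp add: mult.assoc)
  finally show ?case .
qed simp

section \<open>One reproduction\<close>

lemma first_to_ring_spec:
  "first_to_ring ps \<omega> \<le> length ps"
  "w \<le> length ps \<Longrightarrow> next_ring \<omega> (first_to_ring ps \<omega>) \<le> next_ring \<omega> w"
proof -
  let ?Q = "\<lambda>v. v \<in> vertices ps \<and> (\<forall>w\<in>vertices ps. next_ring \<omega> v \<le> next_ring \<omega> w)"
  have "\<exists>v. ?Q v"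
    using ex_min_if_finite[of "next_ring \<omega> ` vertices ps"] by (auto simp: not_less)
  then have "?Q (first_to_ring ps \<omega>)" unfolding first_to_ring_def by (rule LeastI_ex)
  then show "first_to_ring ps \<omega> \<le> length ps"
    "w \<le> length ps \<Longrightarrow> next_ring \<omega> (first_to_ring ps \<omega>) \<le> next_ring \<omega> w"
    by auto
qed

lemma first_to_ring_eq_iff:
  assumes "v \<le> length ps"
  shows "first_to_ring ps \<omega> = v \<longleftrightarrow>
    (\<forall>w\<in>vertices ps - {v}. next_ring \<omega> w \<in> beyond (w < v) (next_ring \<omega> v))"
proof
  assume v: "first_to_ring ps \<omega> = v"
  show "\<forall>w\<in>vertices ps - {v}. next_ring \<omega> w \<in> beyond (w < v) (next_ring \<omega> v)"
  proof
    fix w assume w: "w \<in> vertices ps - {v}"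
    have le: "next_ring \<omega> v \<le> next_ring \<omega> w"
      using first_to_ring_spec(2)[of w ps \<omega>] v w by auto
    have "next_ring \<omega> v < next_ring \<omega> w" if "w < v"
    proof (rule ccontr)
      assume "\<not> ?thesis"
      then have "w \<in> vertices ps \<and> (\<forall>u\<in>vertices ps. next_ring \<omega> w \<le> next_ring \<omega> u)"
        using first_to_ring_spec(2)[of _ ps \<omega>] v w by force
      then have "v \<le> w" unfolding v[symmetric] first_to_ring_def by (rule Least_le)
      then show False using that by simp
    qed
    then show "next_ring \<omega> w \<in> beyond (w < v) (next_ring \<omega> v)" using le by (auto simp: beyond_def)
  qed
next
  assume *: "\<forall>w\<in>vertices ps - {v}. next_ring \<omega> w \<in> beyond (w < v) (next_ring \<omega> v)"
  show "first_to_ring ps \<omega> = v"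
    unfolding first_to_ring_def
  proof (rule Least_equality)
    show "v \<in> vertices ps \<and> (\<forall>w\<in>vertices ps. next_ring \<omega> v \<le> next_ring \<omega> w)"
    proof (intro conjI ballI)
      fix w assume "w \<in> vertices ps"
      then show "next_ring \<omega> v \<le> next_ring \<omega> w"
        using *[rule_format, of w] by (cases "w = v"; cases "w < v") (auto simp: beyond_def)
    qed (use assms in simp)
    fix w assume w: "w \<in> vertices ps \<and> (\<forall>u\<in>vertices ps. next_ring \<omega> w \<le> next_ring \<omega> u)"
    show "v \<le> w"
    proof (rule ccontr)
      assume "\<not> v \<le> w"
      then have "next_ring \<omega> v < next_ring \<omega> w" using *[rule_format, of w] w by (auto simp: beyond_def)
      then show False using w assms by (auto simp: not_le[symmetric])
    qed
  qed
qed

definition jump :: "nat \<Rightarrow> ptree \<Rightarrow> real \<Rightarrow> clocks \<Rightarrow> clocks" where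
  "jump v ps a \<omega> = (\<lambda>w. if w \<in> vertices ps - {v} then shift_ring a (\<omega> w) else \<omega> w)"

lemma advance_eq_jump:
  "first_to_ring ps \<omega> = v \<Longrightarrow>
    advance ps \<omega> = (jump v ps (next_ring \<omega> v) \<omega>)(v := stl (\<omega> v))"
  by (auto simp: advance_def jump_def fun_eq_iff shift_ring_def next_ring_def next_mark_def)

lemma prod_indicator_eq:
  "finite B \<Longrightarrow> (\<Prod>w\<in>B. indicator (C w) (x w)) = (of_bool (\<forall>w\<in>B. x w \<in> C w) :: ennreal)"
  by (induction B rule: finite_induct) (auto simp: indicator_def)

lemma measurable_next_ring [measurable]: "(\<lambda>\<omega>. next_ring \<omega> v) \<in> clock_space p \<rightarrow>\<^sub>M borel"
  unfolding next_ring_def by measurable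

lemma measurable_next_mark [measurable]: "(\<lambda>\<omega>. next_mark \<omega> v) \<in> clock_space p \<rightarrow>\<^sub>M count_space UNIV"
  unfolding next_mark_def by measurable

lemma measurable_clocks_upd:
  assumes "c \<in> N \<rightarrow>\<^sub>M clock_space p" "s \<in> N \<rightarrow>\<^sub>M ticks p"
  shows "(\<lambda>x. (c x)(v := s x)) \<in> N \<rightarrow>\<^sub>M clock_space p"
proof (rule measurable_clocksI)
  show "(\<lambda>x. ((c x)(v := s x)) w) \<in> N \<rightarrow>\<^sub>M ticks p" for w
    using assms measurable_compose[OF assms(1) measurable_clock] by (cases "w = v") auto
qed

lemma measurable_jump:
  assumes "a \<in> N \<rightarrow>\<^sub>M borel" "c \<in> N \<rightarrow>\<^sub>M clock_space p"
  shows "(\<lambda>x. jump v ps (a x) (c x)) \<in> N \<rightarrow>\<^sub>M clock_space p"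
  unfolding jump_def by (rule measurable_shift_all[OF assms])

lemma measurable_first_to_ring [measurable]:
  "first_to_ring ps \<in> clock_space p \<rightarrow>\<^sub>M count_space UNIV"
proof (rule measurable_count_space_eq2_countable[THEN iffD2])
  show "first_to_ring ps \<in> space (clock_space p) \<rightarrow> UNIV \<and>
    (\<forall>a\<in>UNIV. first_to_ring ps -` {a} \<inter> space (clock_space p) \<in> sets (clock_space p))"
  proof (intro conjI ballI)
    fix v :: nat
    show "first_to_ring ps -` {v} \<inter> space (clock_space p) \<in> sets (clock_space p)"
    proof (cases "v \<le> length ps")
      case True
      have "first_to_ring ps -` {v} \<inter> space (clock_space p) =
        {\<omega> \<in> space (clock_space p). \<forall>w\<in>vertices ps - {v}. next_ring \<omega> w \<in> beyond (w < v) (next_ring \<omega> v)}"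
        by (simp add: vimage_def first_to_ring_eq_iff[OF True])
      also have "\<dots> \<in> sets (clock_space p)"
      proof (rule sets.sets_Collect_finite_All)
        fix w
        show "{\<omega> \<in> space (clock_space p). next_ring \<omega> w \<in> beyond (w < v) (next_ring \<omega> v)} \<in> sets (clock_space p)"
          by (cases "w < v") (simp_all add: beyond_def del: space_clock_space)
      next
        show "finite (vertices ps - {v})" by simp
      qed
      finally show ?thesis .
    next
      case False
      then have "first_to_ring ps -` {v} = {}" using first_to_ring_spec(1)[of ps] by auto
      then show ?thesis by simp
    qed
  qed simp
qed

lemma measurable_advance [measurable]: "advance ps \<in> clock_space p \<rightarrow>\<^sub>M clock_space p"
proof -
  have "(\<lambda>\<omega>. (jump v ps (next_ring \<omega> v) \<omega>)(v := stl (\<omega> v))) \<in> clock_space p \<rightarrow>\<^sub>M clock_space p" for v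
    by (intro measurable_clocks_upd measurable_jump measurable_next_ring measurable_ident_sets refl
        measurable_compose[OF measurable_clock measurable_tick_stl])
  from measurable_compose_countable[where f = "\<lambda>v \<omega>. (jump v ps (next_ring \<omega> v) \<omega>)(v := stl (\<omega> v))",
      OF this measurable_first_to_ring[of ps p]]
  show ?thesis by (simp add: advance_eq_jump[OF refl, symmetric])
qed

lemma measurable_pair_exp_law:
  "f \<in> N \<rightarrow>\<^sub>M P \<Longrightarrow> g \<in> N \<rightarrow>\<^sub>M borel \<Longrightarrow> (\<lambda>x. (f x, g x)) \<in> N \<rightarrow>\<^sub>M P \<Otimes>\<^sub>M exp_law"
  by (intro measurable_Pair) (simp_all add: measurable_cong_sets[OF refl sets_exp_law])

lemma measurable_snd_exp_law [measurable]: "snd \<in> M \<Otimes>\<^sub>M exp_law \<rightarrow>\<^sub>M borel"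
  by (subst measurable_cong_sets[OF refl sets_exp_law[symmetric]]) measurable

lemma measurable_step_integrand:
  fixes f :: "clocks \<times> real \<Rightarrow> ennreal"
  assumes "f \<in> borel_measurable (clock_space p \<Otimes>\<^sub>M exp_law)"
  shows "(\<lambda>(\<omega>, \<tau>). of_bool (first_to_ring ps \<omega> = v \<and> next_mark \<omega> v = z \<and> next_ring \<omega> v \<le> \<tau>)
        * f (advance ps \<omega>, \<tau> - next_ring \<omega> v)) \<in> borel_measurable (clock_space p \<Otimes>\<^sub>M exp_law)"
proof -
  have [measurable]: "(\<lambda>x. f (advance ps (fst x), snd x - next_ring (fst x) v))
      \<in> borel_measurable (clock_space p \<Otimes>\<^sub>M exp_law)"
    by (rule measurable_compose[OF measurable_pair_exp_law assms]) measurable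
  have [measurable]: "(\<lambda>x. next_ring (fst x) v) \<in> clock_space p \<Otimes>\<^sub>M exp_law \<rightarrow>\<^sub>M borel"
    by (rule measurable_compose[OF measurable_fst measurable_next_ring])
  have [measurable]: "(\<lambda>x. of_bool (first_to_ring ps (fst x) = v) :: ennreal) \<in> borel_measurable (clock_space p \<Otimes>\<^sub>M exp_law)"
    by (rule measurable_compose[OF measurable_compose[OF measurable_fst measurable_first_to_ring]]) simp
  have [measurable]: "(\<lambda>x. of_bool (next_mark (fst x) v = z) :: ennreal) \<in> borel_measurable (clock_space p \<Otimes>\<^sub>M exp_law)"
    by (rule measurable_compose[OF measurable_compose[OF measurable_fst measurable_next_mark]]) simp
  have "Measurable.pred (clock_space p \<Otimes>\<^sub>M exp_law) (\<lambda>x. next_ring (fst x) v \<le> snd x)"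
    by measurable
  then have [measurable]: "(\<lambda>x. of_bool (next_ring (fst x) v \<le> snd x) :: ennreal) \<in> borel_measurable (clock_space p \<Otimes>\<^sub>M exp_law)"
    by measurable
  have eq: "(\<lambda>(\<omega>, \<tau>). of_bool (first_to_ring ps \<omega> = v \<and> next_mark \<omega> v = z \<and> next_ring \<omega> v \<le> \<tau>)
        * f (advance ps \<omega>, \<tau> - next_ring \<omega> v)) =
      (\<lambda>x. of_bool (first_to_ring ps (fst x) = v) * of_bool (next_mark (fst x) v = z)
        * of_bool (next_ring (fst x) v \<le> snd x) * f (advance ps (fst x), snd x - next_ring (fst x) v))"
    by (auto simp: fun_eq_iff)
  show ?thesis unfolding eq by (intro borel_measurable_times_ennreal; fact)
qed

text \<open>
  Fix the clock of \<open>v\<close>, with its first ring at \<open>a\<close>.  The other \<open>length ps\<close> clocks and \<open>\<tau>\<close> all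
  exceed \<open>a\<close> with probability \<open>exp (- a) ^ (length ps + 1)\<close>, and then their residual values have the
  original law.  The later ticks of \<open>v\<close> are independent of its first tick, so after integration over
  \<open>a\<close> and the mark the state in which the process continues is distributed as the initial one.
\<close>

lemma nn_integral_step:
  assumes v: "v \<le> length ps" and f: "f \<in> borel_measurable (clock_space p \<Otimes>\<^sub>M exp_law)"
  shows "(\<integral>\<^sup>+ (\<omega>, \<tau>). of_bool (first_to_ring ps \<omega> = v \<and> next_mark \<omega> v = z \<and> next_ring \<omega> v \<le> \<tau>)
        * f (advance ps \<omega>, \<tau> - next_ring \<omega> v) \<partial>(clock_space p \<Otimes>\<^sub>M exp_law)) =
    ennreal (pmf p z / (real (length ps) + 2)) * (\<integral>\<^sup>+ x. f x \<partial>(clock_space p \<Otimes>\<^sub>M exp_law))"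
proof -
  interpret E: prob_space exp_law by (rule prob_space_exp_law)
  interpret C: prob_space "clock_space p" by (rule prob_space_clock_space)
  interpret S: prob_space "ticks p" by (rule prob_space_ticks)
  define B where "B = vertices ps - {v}"
  have B: "finite B" "card B = length ps" using v by (simp_all add: B_def)
  let ?e = "\<lambda>x. ennreal (exp (- x))"
  \<comment> \<open>The integrand as a function of the clocks, \<open>\<tau>\<close> being integrated out.\<close>
  define H where "H \<omega> = (\<integral>\<^sup>+ \<tau>. of_bool (first_to_ring ps \<omega> = v \<and> next_mark \<omega> v = z \<and> next_ring \<omega> v \<le> \<tau>)
        * f (advance ps \<omega>, \<tau> - next_ring \<omega> v) \<partial>exp_law)" for \<omega>
  have H: "H \<in> borel_measurable (clock_space p)"
    unfolding H_def by (rule E.borel_measurable_nn_integral) (rule measurable_step_integrand[OF f])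
  have fpair: "(\<lambda>(\<omega>, \<tau>). f (\<omega>, \<tau>)) \<in> borel_measurable (clock_space p \<Otimes>\<^sub>M exp_law)" using f by simp
  define K where "K \<omega> = (\<integral>\<^sup>+ \<tau>. f (\<omega>, \<tau>) \<partial>exp_law)" for \<omega>
  have K: "K \<in> borel_measurable (clock_space p)"
    unfolding K_def by (rule E.borel_measurable_nn_integral[OF fpair])
  have upd: "(\<lambda>\<omega>. \<omega> (v := s)) \<in> clock_space p \<rightarrow>\<^sub>M clock_space p" for s
    by (rule measurable_clocks_upd) auto
  have inner: "(\<integral>\<^sup>+ \<omega>. H (\<omega> (v := (a, z') ## s)) \<partial>clock_space p) =
      ?e a ^ (length ps + 1) * of_bool (z' = z) * (\<integral>\<^sup>+ \<omega>. K (\<omega> (v := s)) \<partial>clock_space p)"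
    if a: "a \<ge> 0" for a z' s
  proof -
    have Hupd: "H (\<omega> (v := (a, z') ## s)) =
        (\<Prod>w\<in>B. indicator (beyond (w < v) a) (fst (shd (\<omega> w)))) *
        (of_bool (z' = z) * ?e a * K ((\<lambda>w. if w \<in> B then shift_ring a (\<omega> w) else \<omega> w)(v := s)))" for \<omega>
    proof -
      let ?\<omega> = "\<omega> (v := (a, z') ## s)" and ?\<omega>' = "(\<lambda>w. if w \<in> B then shift_ring a (\<omega> w) else \<omega> w)(v := s)"
      have ring: "next_ring ?\<omega> v = a" "next_mark ?\<omega> v = z'"
        by (simp_all add: next_ring_def next_mark_def)
      have "(of_bool (first_to_ring ps ?\<omega> = v) :: ennreal) =
          (\<Prod>w\<in>B. indicator (beyond (w < v) a) (next_ring ?\<omega> w))"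
        unfolding prod_indicator_eq[OF B(1)] first_to_ring_eq_iff[OF v] by (simp add: ring B_def)
      also have "\<dots> = (\<Prod>w\<in>B. indicator (beyond (w < v) a) (fst (shd (\<omega> w))))"
        by (intro prod.cong) (auto simp: B_def next_ring_def)
      finally have first: "(of_bool (first_to_ring ps ?\<omega> = v) :: ennreal) = \<dots>" .
      have adv: "advance ps ?\<omega> = ?\<omega>'" if "first_to_ring ps ?\<omega> = v"
        unfolding advance_eq_jump[OF that] ring jump_def B_def[symmetric] by (auto simp: fun_eq_iff B_def)
      have "H ?\<omega> = (\<integral>\<^sup>+ \<tau>. of_bool (first_to_ring ps ?\<omega> = v) * (of_bool (z' = z) *
          (indicator (beyond False a) \<tau> * f (?\<omega>', \<tau> - a))) \<partial>exp_law)"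
        unfolding H_def ring
        by (intro nn_integral_cong) (auto simp: adv beyond_def)
      also have "\<dots> = of_bool (first_to_ring ps ?\<omega> = v) * (of_bool (z' = z) *
          (\<integral>\<^sup>+ \<tau>. indicator (beyond False a) \<tau> * f (?\<omega>', \<tau> - a) \<partial>exp_law))"
        by auto
      also have "(\<integral>\<^sup>+ \<tau>. indicator (beyond False a) \<tau> * f (?\<omega>', \<tau> - a) \<partial>exp_law) = ?e a * K ?\<omega>'"
        unfolding K_def
        by (rule exp_law_memoryless[OF a, of "\<lambda>\<tau>. f (?\<omega>', \<tau>)"])
          (rule measurable_compose[OF measurable_pair_exp_law f]; simp)
      finally show ?thesis unfolding first by (simp only: mult.assoc)
    qed
    have "(\<integral>\<^sup>+ \<omega>. H (\<omega> (v := (a, z') ## s)) \<partial>clock_space p) =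
        ?e a ^ card B * (\<integral>\<^sup>+ \<omega>. of_bool (z' = z) * ?e a * K (\<omega> (v := s)) \<partial>clock_space p)"
      unfolding Hupd
      by (rule clocks_memoryless[OF B(1) a, where G = "\<lambda>\<omega>. of_bool (z' = z) * ?e a * K (\<omega> (v := s))"])
        (intro borel_measurable_times_ennreal borel_measurable_const measurable_compose[OF upd K])
    also have "\<dots> = ?e a ^ (length ps + 1) * of_bool (z' = z) * (\<integral>\<^sup>+ \<omega>. K (\<omega> (v := s)) \<partial>clock_space p)"
      by (subst nn_integral_cmult) (simp_all add: B(2) measurable_compose[OF upd K] mult_ac)
    finally show ?thesis .
  qed
  have Kint: "(\<lambda>s. \<integral>\<^sup>+ \<omega>. K (\<omega> (v := s)) \<partial>clock_space p) \<in> borel_measurable (ticks p)"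
    by (rule C.borel_measurable_nn_integral)
      (use measurable_compose[OF measurable_resample K] in \<open>simp add: case_prod_beta\<close>)
  have Hint: "(\<lambda>s. \<integral>\<^sup>+ \<omega>. H (\<omega> (v := s)) \<partial>clock_space p) \<in> borel_measurable (ticks p)"
    by (rule C.borel_measurable_nn_integral)
      (use measurable_compose[OF measurable_resample H] in \<open>simp add: case_prod_beta\<close>)
  have "(\<integral>\<^sup>+ (\<omega>, \<tau>). of_bool (first_to_ring ps \<omega> = v \<and> next_mark \<omega> v = z \<and> next_ring \<omega> v \<le> \<tau>)
        * f (advance ps \<omega>, \<tau> - next_ring \<omega> v) \<partial>(clock_space p \<Otimes>\<^sub>M exp_law)) = (\<integral>\<^sup>+ \<omega>. H \<omega> \<partial>clock_space p)"
    unfolding H_def by (subst E.nn_integral_fst[symmetric, OF measurable_step_integrand[OF f]]) simp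
  also have "\<dots> = (\<integral>\<^sup>+ z'. \<integral>\<^sup>+ x. \<integral>\<^sup>+ s. \<integral>\<^sup>+ \<omega>. H (\<omega> (v := (x, z') ## s)) \<partial>clock_space p \<partial>ticks p \<partial>exp_law \<partial>measure_pmf p)"
    unfolding nn_integral_resample(1)[OF H, of v] nn_integral_ticks[OF Hint] ..
  also have "\<dots> = (\<integral>\<^sup>+ z'. \<integral>\<^sup>+ x. ?e x ^ (length ps + 1) * (of_bool (z' = z) *
      (\<integral>\<^sup>+ s. \<integral>\<^sup>+ \<omega>. K (\<omega> (v := s)) \<partial>clock_space p \<partial>ticks p)) \<partial>exp_law \<partial>measure_pmf p)"
  proof (rule nn_integral_cong, rule nn_integral_cong_AE)
    fix z'
    show "AE x in exp_law. (\<integral>\<^sup>+ s. \<integral>\<^sup>+ \<omega>. H (\<omega> (v := (x, z') ## s)) \<partial>clock_space p \<partial>ticks p) =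
      ?e x ^ (length ps + 1) * (of_bool (z' = z) * (\<integral>\<^sup>+ s. \<integral>\<^sup>+ \<omega>. K (\<omega> (v := s)) \<partial>clock_space p \<partial>ticks p))"
      using AE_exp_law_nonneg
    proof eventually_elim
      case (elim x)
      have "(\<integral>\<^sup>+ s. ?e x ^ (length ps + 1) * of_bool (z' = z) * (\<integral>\<^sup>+ \<omega>. K (\<omega> (v := s)) \<partial>clock_space p) \<partial>ticks p) =
        ?e x ^ (length ps + 1) * of_bool (z' = z) * (\<integral>\<^sup>+ s. \<integral>\<^sup>+ \<omega>. K (\<omega> (v := s)) \<partial>clock_space p \<partial>ticks p)"
        by (rule nn_integral_cmult[OF Kint])
      then show ?case unfolding inner[OF elim] by (simp only: mult.assoc)
    qed
  qed
  also have "\<dots> = (\<integral>\<^sup>+ z'. ennreal (1 / (real (length ps + 1) + 1)) * (of_bool (z' = z) *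
      (\<integral>\<^sup>+ \<omega>. K \<omega> \<partial>clock_space p)) \<partial>measure_pmf p)"
    unfolding nn_integral_resample(1)[OF K, of v, symmetric]
    by (subst nn_integral_multc, measurable) (simp only: exp_law_laplace)
  also have "\<dots> = (\<integral>\<^sup>+ z'. indicator {z} z' * (ennreal (1 / (real (length ps) + 2)) * (\<integral>\<^sup>+ \<omega>. K \<omega> \<partial>clock_space p)) \<partial>measure_pmf p)"
    by (intro nn_integral_cong) (auto simp: indicator_def add.commute)
  also have "\<dots> = ennreal (pmf p z) * (ennreal (1 / (real (length ps) + 2)) * (\<integral>\<^sup>+ \<omega>. K \<omega> \<partial>clock_space p))"
    by (subst nn_integral_multc) (simp_all add: emeasure_pmf_single)
  also have "(\<integral>\<^sup>+ \<omega>. K \<omega> \<partial>clock_space p) = (\<integral>\<^sup>+ x. f x \<partial>(clock_space p \<Otimes>\<^sub>M exp_law))"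
    unfolding K_def by (rule E.nn_integral_fst[OF f])
  finally show ?thesis
    by (simp add: mult.assoc[symmetric] ennreal_mult[symmetric])
qed

section \<open>The chain of trees up to the time \<open>\<tau>\<close>\<close>

definition trees_upto :: "nat \<Rightarrow> ptree set" where
  "trees_upto k = {q. increasing_tree q \<and> length q \<le> k}"

lemma finite_trees_upto [simp]: "finite (trees_upto k)"
  unfolding trees_upto_def by (rule finite_increasing_trees)

lemma grow_trees_upto: "q \<in> trees_upto k \<Longrightarrow> v \<le> length q \<Longrightarrow> grow q v z \<in> trees_upto (Suc k)"
  using length_grow[of q v z] by (auto simp: trees_upto_def increasing_tree_grow)

lemma trees_upto_mono: "j \<le> k \<Longrightarrow> trees_upto j \<subseteq> trees_upto k"
  by (auto simp: trees_upto_def)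

text \<open>
  \<open>reach p k q\<close> is the probability that at least \<open>k\<close> reproductions take place before \<open>\<tau>\<close> and that
  the tree is \<open>q\<close> after \<open>k\<close> of them; \<open>halt p k q\<close> is the probability that moreover no further
  reproduction takes place before \<open>\<tau>\<close>.  With \<open>length q + 1\<close> vertices, \<open>length q + 2\<close> clocks compete.
\<close>

fun reach :: "nat pmf \<Rightarrow> nat \<Rightarrow> ptree \<Rightarrow> real" where
  "reach p 0 q = of_bool (q = [])"
| "reach p (Suc k) q' = (\<Sum>q\<in>trees_upto k. reach p k q / (real (length q) + 2) * rate p q q')"

definition halt :: "nat pmf \<Rightarrow> nat \<Rightarrow> ptree \<Rightarrow> real" where
  "halt p k q = reach p k q / (real (length q) + 2)"

lemma reach_Suc: "reach p (Suc k) q' = (\<Sum>q\<in>trees_upto k. halt p k q * rate p q q')"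
  by (simp add: halt_def)

lemma reach_nonneg: "reach p k q \<ge> 0"
  by (induction k arbitrary: q) (auto intro!: sum_nonneg simp: rate_nonneg)

lemma halt_nonneg: "halt p k q \<ge> 0"
  by (simp add: halt_def reach_nonneg)

lemma sum_rate:
  assumes "q \<in> trees_upto k"
  shows "(\<Sum>v\<in>vertices q. \<integral>\<^sup>+ z. \<phi> (grow q v z) \<partial>measure_pmf p) =
    (\<Sum>q'\<in>trees_upto (Suc k). ennreal (rate p q q') * \<phi> q')"
proof -
  have *: "(\<integral>\<^sup>+ z. \<phi> (grow q v z) \<partial>measure_pmf p) =
      (\<Sum>q'\<in>trees_upto (Suc k). ennreal (measure_pmf.prob p {z. grow q v z = q'}) * \<phi> q')"
    if "v \<in> vertices q" for v
  proof -
    have "(\<integral>\<^sup>+ z. \<phi> (grow q v z) \<partial>measure_pmf p) =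
        (\<integral>\<^sup>+ z. (\<Sum>q'\<in>trees_upto (Suc k). indicator {z. grow q v z = q'} z * \<phi> q') \<partial>measure_pmf p)"
      using grow_trees_upto[OF assms, of v] that
      by (intro nn_integral_cong) (simp add: indicator_def if_distrib[of "\<lambda>x. x * _"] sum.delta' cong: if_cong)
    also have "\<dots> = (\<Sum>q'\<in>trees_upto (Suc k). emeasure p {z. grow q v z = q'} * \<phi> q')"
      by (subst nn_integral_sum, simp, intro sum.cong refl, subst nn_integral_multc, simp_all)
    finally show ?thesis by (simp add: measure_pmf.emeasure_eq_measure)
  qed
  have "(\<Sum>v\<in>vertices q. \<integral>\<^sup>+ z. \<phi> (grow q v z) \<partial>measure_pmf p) =
    (\<Sum>q'\<in>trees_upto (Suc k). \<Sum>v\<in>vertices q. ennreal (measure_pmf.prob p {z. grow q v z = q'}) * \<phi> q')"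
    by (subst sum.swap) (simp add: *)
  then show ?thesis
    by (simp add: rate_def sum_distrib_right flip: sum_ennreal)
qed

abbreviation run_space :: "nat pmf \<Rightarrow> (clocks \<times> real) measure" where
  "run_space p \<equiv> clock_space p \<Otimes>\<^sub>M exp_law"

lemma prob_space_run_space: "prob_space (run_space p)"
  by (intro prob_space_pair prob_space_clock_space prob_space_exp_law)

definition alive :: "clocks \<Rightarrow> real \<Rightarrow> nat \<Rightarrow> bool" where
  "alive \<omega> \<tau> k \<longleftrightarrow> (\<forall>j\<in>{1..k}. reproduction_time \<omega> j \<le> \<tau>)"

definition residual :: "clocks \<Rightarrow> real \<Rightarrow> nat \<Rightarrow> clocks \<times> real" where
  "residual \<omega> \<tau> k = (snd (snd (state_after \<omega> k)), \<tau> - reproduction_time \<omega> k)"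

text \<open>
  The value of \<open>h\<close> after the next reproduction, or \<open>0\<close> if that comes after \<open>\<tau>\<close>.
\<close>

definition next_state :: "(ptree \<Rightarrow> clocks \<times> real \<Rightarrow> ennreal) \<Rightarrow> ptree \<Rightarrow> clocks \<times> real \<Rightarrow> ennreal" where
  "next_state h q = (\<lambda>(\<omega>, \<tau>). let v = first_to_ring q \<omega> in
     of_bool (next_ring \<omega> v \<le> \<tau>) * h (grow q v (next_mark \<omega> v)) (advance q \<omega>, \<tau> - next_ring \<omega> v))"

text \<open>
  Splitting by the vertex that rings first and by its mark leaves terms in which the next tree is
  fixed, so that their measurability and their integrals come from \<open>nn_integral_step\<close>.
\<close>

lemma next_state_eq_sum:
  "next_state h q x = (\<Sum>v\<in>vertices q. \<Sum>z. (case x of (\<omega>, \<tau>) \<Rightarrow>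
     of_bool (first_to_ring q \<omega> = v \<and> next_mark \<omega> v = z \<and> next_ring \<omega> v \<le> \<tau>)
        * h (grow q v z) (advance q \<omega>, \<tau> - next_ring \<omega> v)))"
proof -
  obtain \<omega> \<tau> where x: "x = (\<omega>, \<tau>)" by (cases x)
  let ?v = "first_to_ring q \<omega>"
  have "(\<Sum>z. of_bool (?v = v \<and> next_mark \<omega> v = z \<and> next_ring \<omega> v \<le> \<tau>)
        * h (grow q v z) (advance q \<omega>, \<tau> - next_ring \<omega> v)) =
     (if v = ?v then next_state h q (\<omega>, \<tau>) else 0)" for v
    by (subst suminf_finite[where N = "{next_mark \<omega> v}"]) (auto simp: next_state_def Let_def)
  then show ?thesis
    using first_to_ring_spec(1)[of q \<omega>] by (simp add: x sum.delta)
qed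

lemma measurable_next_state:
  assumes "\<And>q. h q \<in> borel_measurable (run_space p)"
  shows "next_state h q \<in> borel_measurable (run_space p)"
proof -
  have "(\<lambda>x. next_state h q x) \<in> borel_measurable (run_space p)"
    unfolding next_state_eq_sum
    by (intro borel_measurable_sum borel_measurable_suminf_order measurable_step_integrand assms)
  then show ?thesis by simp
qed

lemma nn_integral_next_state:
  assumes h: "\<And>q. h q \<in> borel_measurable (run_space p)" and q: "q \<in> trees_upto k"
  shows "(\<integral>\<^sup>+ x. next_state h q x \<partial>run_space p) =
    (\<Sum>q'\<in>trees_upto (Suc k). ennreal (rate p q q' / (real (length q) + 2)) * (\<integral>\<^sup>+ x. h q' x \<partial>run_space p))"
proof -
  let ?I = "\<lambda>q. \<integral>\<^sup>+ x. h q x \<partial>run_space p" and ?c = "ennreal (1 / (real (length q) + 2))"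
  have "(\<integral>\<^sup>+ x. next_state h q x \<partial>run_space p) =
      (\<Sum>v\<in>vertices q. \<Sum>z. ennreal (pmf p z / (real (length q) + 2)) * ?I (grow q v z))"
    unfolding next_state_eq_sum
    by (subst nn_integral_sum, intro borel_measurable_suminf_order measurable_step_integrand h,
        subst nn_integral_suminf, intro measurable_step_integrand h,
        intro sum.cong suminf_cong refl nn_integral_step h) simp
  also have "\<dots> = (\<Sum>v\<in>vertices q. ?c * (\<integral>\<^sup>+ z. ?I (grow q v z) \<partial>measure_pmf p))"
  proof (rule sum.cong[OF refl])
    fix v
    have "(\<Sum>z. ennreal (pmf p z / (real (length q) + 2)) * ?I (grow q v z)) =
        (\<Sum>z. ?c * (ennreal (pmf p z) * ?I (grow q v z)))"
      by (simp add: mult.assoc[symmetric] ennreal_mult[symmetric])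
    also have "\<dots> = ?c * (\<Sum>z. ennreal (pmf p z) * ?I (grow q v z))"
      by simp
    also have "(\<Sum>z. ennreal (pmf p z) * ?I (grow q v z)) = (\<integral>\<^sup>+ z. ?I (grow q v z) \<partial>measure_pmf p)"
      by (simp add: nn_integral_measure_pmf nn_integral_count_space_nat)
    finally show "(\<Sum>z. ennreal (pmf p z / (real (length q) + 2)) * ?I (grow q v z)) =
      ?c * (\<integral>\<^sup>+ z. ?I (grow q v z) \<partial>measure_pmf p)" .
  qed
  also have "\<dots> = ?c * (\<Sum>q'\<in>trees_upto (Suc k). ennreal (rate p q q') * ?I q')"
    by (simp only: sum_distrib_left[symmetric] sum_rate[OF q, where \<phi> = ?I])
  also have "\<dots> = (\<Sum>q'\<in>trees_upto (Suc k). ennreal (rate p q q' / (real (length q) + 2)) * ?I q')"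
    by (simp add: sum_distrib_left mult.assoc[symmetric] ennreal_mult[symmetric] rate_nonneg)
  finally show ?thesis .
qed

lemma state_after_Suc: "state_after \<omega> (Suc k) = reproduce (state_after \<omega> k)"
  by (simp add: state_after_def)

lemma state_after_0: "state_after \<omega> 0 = ([], 0, \<omega>)"
  by (simp add: state_after_def)

lemma one_reproduction:
  "of_bool (alive \<omega> \<tau> (Suc k)) * h (tree_after \<omega> (Suc k)) (residual \<omega> \<tau> (Suc k)) =
    of_bool (alive \<omega> \<tau> k) * next_state h (tree_after \<omega> k) (residual \<omega> \<tau> k)"
proof -
  obtain q s \<omega>' where st: "state_after \<omega> k = (q, s, \<omega>')" by (cases "state_after \<omega> k")
  let ?v = "first_to_ring q \<omega>'"
  have k: "tree_after \<omega> k = q" "reproduction_time \<omega> k = s" "residual \<omega> \<tau> k = (\<omega>', \<tau> - s)"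
    by (simp_all add: tree_after_def reproduction_time_def residual_def st)
  have Sk: "tree_after \<omega> (Suc k) = grow q ?v (next_mark \<omega>' ?v)"
    "reproduction_time \<omega> (Suc k) = s + next_ring \<omega>' ?v"
    "residual \<omega> \<tau> (Suc k) = (advance q \<omega>', \<tau> - s - next_ring \<omega>' ?v)"
    by (simp_all add: tree_after_def reproduction_time_def residual_def state_after_Suc st Let_def)
  have "alive \<omega> \<tau> (Suc k) \<longleftrightarrow> alive \<omega> \<tau> k \<and> next_ring \<omega>' ?v \<le> \<tau> - s"
    using Sk(2) by (auto simp: alive_def atLeastAtMostSuc_conv)
  then show ?thesis by (simp add: k Sk next_state_def Let_def)
qed

text \<open>
  Conditionally on survival and on the tree, the clocks after \<open>k\<close> reproductions and the residual
  value of \<open>\<tau>\<close> have the original law.  Test functions \<open>h\<close> that depend on the tree and on the clocks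
  make this an induction which peels off the last reproduction.
\<close>

lemma nn_integral_alive:
  assumes h: "\<And>q. h q \<in> borel_measurable (run_space p)"
  shows "(\<integral>\<^sup>+ (\<omega>, \<tau>). of_bool (alive \<omega> \<tau> k) * h (tree_after \<omega> k) (residual \<omega> \<tau> k) \<partial>run_space p) =
    (\<Sum>q\<in>trees_upto k. ennreal (reach p k q) * (\<integral>\<^sup>+ x. h q x \<partial>run_space p))"
  using h
proof (induction k arbitrary: h)
  case 0
  have "trees_upto 0 = {[]}" by (auto simp: trees_upto_def)
  then show ?case
    by (simp add: alive_def tree_after_def residual_def reproduction_time_def state_after_0)
next
  case (Suc k)
  let ?I = "\<lambda>q. \<integral>\<^sup>+ x. h q x \<partial>run_space p"
  have "(\<integral>\<^sup>+ (\<omega>, \<tau>). of_bool (alive \<omega> \<tau> (Suc k)) * h (tree_after \<omega> (Suc k)) (residual \<omega> \<tau> (Suc k)) \<partial>run_space p) =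
    (\<integral>\<^sup>+ (\<omega>, \<tau>). of_bool (alive \<omega> \<tau> k) * next_state h (tree_after \<omega> k) (residual \<omega> \<tau> k) \<partial>run_space p)"
    by (simp only: one_reproduction)
  also have "\<dots> = (\<Sum>q\<in>trees_upto k. ennreal (reach p k q) * (\<integral>\<^sup>+ x. next_state h q x \<partial>run_space p))"
    by (rule Suc.IH) (rule measurable_next_state[OF Suc.prems])
  also have "\<dots> = (\<Sum>q\<in>trees_upto k. \<Sum>q'\<in>trees_upto (Suc k).
      ennreal (halt p k q * rate p q q') * ?I q')"
    by (intro sum.cong refl, subst nn_integral_next_state[OF Suc.prems], assumption)
      (simp add: sum_distrib_left mult.assoc[symmetric] ennreal_mult[symmetric] reach_nonneg rate_nonneg halt_def)
  also have "\<dots> = (\<Sum>q'\<in>trees_upto (Suc k). ennreal (reach p (Suc k) q') * ?I q')"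
    unfolding reach_Suc
    by (subst sum.swap) (simp add: sum_distrib_right[symmetric] sum_ennreal halt_nonneg rate_nonneg del: reach.simps)
  finally show ?case .
qed

text \<open>
  The complement of the event that one of the vertices rings first.
\<close>

lemma nn_integral_no_ring:
  assumes "increasing_tree q"
  shows "(\<integral>\<^sup>+ (\<omega>, \<tau>). of_bool (\<tau> < next_ring \<omega> (first_to_ring q \<omega>)) \<partial>run_space p) =
    ennreal (1 / (real (length q) + 2))"
    and "(\<lambda>(\<omega>, \<tau>). of_bool (\<tau> < next_ring \<omega> (first_to_ring q \<omega>)) :: ennreal) \<in> borel_measurable (run_space p)"
proof -
  interpret R: prob_space "run_space p" by (rule prob_space_run_space)
  let ?h = "\<lambda>_ _. 1 :: ennreal" and ?n = "length q"
  have q: "q \<in> trees_upto ?n" using assms by (simp add: trees_upto_def)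
  have ns: "next_state ?h q = (\<lambda>(\<omega>, \<tau>). of_bool (next_ring \<omega> (first_to_ring q \<omega>) \<le> \<tau>))"
    by (simp add: next_state_def Let_def)
  have m: "next_state ?h q \<in> borel_measurable (run_space p)"
    by (rule measurable_next_state) simp
  have compl: "(\<lambda>(\<omega>, \<tau>). of_bool (\<tau> < next_ring \<omega> (first_to_ring q \<omega>)) :: ennreal) =
      (\<lambda>x. 1 - next_state ?h q x)"
    by (auto simp: ns fun_eq_iff)
  show "(\<lambda>(\<omega>, \<tau>). of_bool (\<tau> < next_ring \<omega> (first_to_ring q \<omega>)) :: ennreal) \<in> borel_measurable (run_space p)"
    unfolding compl using m by measurable
  have "(\<Sum>q'\<in>trees_upto (Suc ?n). ennreal (rate p q q') * 1) = of_nat (Suc ?n)"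
    by (subst sum_rate[OF q, where \<phi> = "\<lambda>_. 1", symmetric]) (simp add: measure_pmf.emeasure_space_1)
  then have sum_rate': "(\<Sum>q'\<in>trees_upto (Suc ?n). rate p q q') = real (Suc ?n)"
    by (subst (asm) mult_1_right, subst (asm) sum_ennreal)
      (auto simp: rate_nonneg sum_nonneg ennreal_of_nat_eq_real_of_nat simp del: of_nat_Suc)
  have "(\<integral>\<^sup>+ x. next_state ?h q x \<partial>run_space p) =
      (\<Sum>q'\<in>trees_upto (Suc ?n). ennreal (rate p q q' / (real ?n + 2)))"
    by (subst nn_integral_next_state[OF _ q]) (simp_all add: R.emeasure_space_1)
  also have "\<dots> = ennreal (real (Suc ?n) / (real ?n + 2))"
    by (subst sum_ennreal) (simp_all add: rate_nonneg sum_divide_distrib[symmetric] sum_rate')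
  finally have I: "(\<integral>\<^sup>+ x. next_state ?h q x \<partial>run_space p) = ennreal (real (Suc ?n) / (real ?n + 2))" .
  have "(\<integral>\<^sup>+ x. 1 - next_state ?h q x \<partial>run_space p) = 1 - ennreal (real (Suc ?n) / (real ?n + 2))"
  proof -
    have "(\<integral>\<^sup>+ x. 1 - next_state ?h q x \<partial>run_space p) =
        (\<integral>\<^sup>+ x. 1 \<partial>run_space p) - (\<integral>\<^sup>+ x. next_state ?h q x \<partial>run_space p)"
    proof (rule nn_integral_diff[OF _ m])
      show "(\<integral>\<^sup>+ x. next_state ?h q x \<partial>run_space p) \<noteq> \<infinity>" unfolding I by simp
      show "AE x in run_space p. next_state ?h q x \<le> 1" by (auto simp: ns)
    qed simp
    then show ?thesis unfolding I by (simp add: R.emeasure_space_1)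
  qed
  also have "\<dots> = ennreal (1 - real (Suc ?n) / (real ?n + 2))"
    by (simp add: ennreal_minus[symmetric])
  also have "1 - real (Suc ?n) / (real ?n + 2) = 1 / (real ?n + 2)"
    by (simp add: field_simps)
  finally show "(\<integral>\<^sup>+ (\<omega>, \<tau>). of_bool (\<tau> < next_ring \<omega> (first_to_ring q \<omega>)) \<partial>run_space p) =
    ennreal (1 / (real (length q) + 2))" unfolding compl .
qed

definition halts :: "clocks \<Rightarrow> real \<Rightarrow> nat \<Rightarrow> bool" where
  "halts \<omega> \<tau> k \<longleftrightarrow> alive \<omega> \<tau> k \<and> \<tau> < reproduction_time \<omega> (Suc k)"

text \<open>
  Halting after \<open>k\<close> reproductions is survival up to the \<open>k\<close>-th one followed by a first ring that
  exceeds the residual value of \<open>\<tau>\<close>.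
\<close>

lemma nn_integral_halts:
  "(\<integral>\<^sup>+ (\<omega>, \<tau>). of_bool (halts \<omega> \<tau> k) * \<phi> (tree_after \<omega> k) \<partial>run_space p) =
    (\<Sum>q\<in>trees_upto k. ennreal (halt p k q) * \<phi> q)"
proof -
  define h where "h q = (\<lambda>(\<omega>, \<tau>). of_bool (increasing_tree q \<and> \<tau> < next_ring \<omega> (first_to_ring q \<omega>)) * \<phi> q)" for q
  have h: "h q \<in> borel_measurable (run_space p)" for q
  proof (cases "increasing_tree q")
    case True
    then have "h q = (\<lambda>x. (case x of (\<omega>, \<tau>) \<Rightarrow> of_bool (\<tau> < next_ring \<omega> (first_to_ring q \<omega>))) * \<phi> q)"
      by (simp add: h_def fun_eq_iff)
    then show ?thesis
      by (simp only:) (intro borel_measurable_times_ennreal nn_integral_no_ring(2)[OF True] borel_measurable_const)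
  qed (simp add: h_def case_prod_beta)
  have inc: "increasing_tree (tree_after \<omega> k)" for \<omega>
  proof (induction k)
    case (Suc k)
    obtain q s \<omega>' where "state_after \<omega> k = (q, s, \<omega>')" by (cases "state_after \<omega> k")
    then show ?case
      using Suc first_to_ring_spec(1)[of q \<omega>']
      by (simp add: tree_after_def state_after_Suc Let_def increasing_tree_grow)
  qed (simp add: tree_after_def state_after_0)
  have "of_bool (halts \<omega> \<tau> k) * \<phi> (tree_after \<omega> k) = of_bool (alive \<omega> \<tau> k) * h (tree_after \<omega> k) (residual \<omega> \<tau> k)" for \<omega> \<tau>
  proof -
    obtain q s \<omega>' where st: "state_after \<omega> k = (q, s, \<omega>')" by (cases "state_after \<omega> k")
    have "halts \<omega> \<tau> k \<longleftrightarrow> alive \<omega> \<tau> k \<and> \<tau> - s < next_ring \<omega>' (first_to_ring q \<omega>')"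
      by (auto simp: halts_def reproduction_time_def state_after_Suc st Let_def)
    then show ?thesis
      using inc[of \<omega>] by (simp add: h_def residual_def tree_after_def reproduction_time_def st)
  qed
  then have "(\<integral>\<^sup>+ (\<omega>, \<tau>). of_bool (halts \<omega> \<tau> k) * \<phi> (tree_after \<omega> k) \<partial>run_space p) =
      (\<integral>\<^sup>+ (\<omega>, \<tau>). of_bool (alive \<omega> \<tau> k) * h (tree_after \<omega> k) (residual \<omega> \<tau> k) \<partial>run_space p)"
    by (simp only:)
  also have "\<dots> = (\<Sum>q\<in>trees_upto k. ennreal (reach p k q) * (\<integral>\<^sup>+ x. h q x \<partial>run_space p))"
    by (rule nn_integral_alive[OF h])
  also have "\<dots> = (\<Sum>q\<in>trees_upto k. ennreal (halt p k q) * \<phi> q)"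
  proof (rule sum.cong[OF refl])
    fix q assume "q \<in> trees_upto k"
    then have q: "increasing_tree q" by (simp add: trees_upto_def)
    then have hq: "h q = (\<lambda>x. (case x of (\<omega>, \<tau>) \<Rightarrow> of_bool (\<tau> < next_ring \<omega> (first_to_ring q \<omega>))) * \<phi> q)"
      by (simp add: h_def fun_eq_iff)
    have "(\<integral>\<^sup>+ x. h q x \<partial>run_space p) = ennreal (1 / (real (length q) + 2)) * \<phi> q"
      unfolding hq by (subst nn_integral_multc[OF nn_integral_no_ring(2)[OF q]]) (simp only: nn_integral_no_ring(1)[OF q])
    then show "ennreal (reach p k q) * (\<integral>\<^sup>+ x. h q x \<partial>run_space p) = ennreal (halt p k q) * \<phi> q"
      by (simp add: halt_def mult.assoc[symmetric] ennreal_mult[symmetric] reach_nonneg)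
  qed
  finally show ?thesis .
qed

section \<open>The mean number of vertices at a given depth\<close>

definition reach_sum :: "nat pmf \<Rightarrow> nat \<Rightarrow> (ptree \<Rightarrow> real) \<Rightarrow> real" where
  "reach_sum p k h = (\<Sum>q\<in>trees_upto k. reach p k q * h q)"

definition halt_sum :: "nat pmf \<Rightarrow> nat \<Rightarrow> (ptree \<Rightarrow> real) \<Rightarrow> real" where
  "halt_sum p k h = (\<Sum>q\<in>trees_upto k. halt p k q * h q)"

lemma halt_sum_nonneg: "(\<And>q. h q \<ge> 0) \<Longrightarrow> halt_sum p k h \<ge> 0"
  unfolding halt_sum_def by (intro sum_nonneg mult_nonneg_nonneg halt_nonneg)

lemma reach_sum_nonneg: "(\<And>q. h q \<ge> 0) \<Longrightarrow> reach_sum p k h \<ge> 0"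
  unfolding reach_sum_def by (intro sum_nonneg mult_nonneg_nonneg reach_nonneg)

lemma reach_sum_eq_halt_sum: "reach_sum p k h = halt_sum p k (\<lambda>q. (real (length q) + 2) * h q)"
  unfolding reach_sum_def halt_sum_def halt_def by (intro sum.cong refl) simp

lemma sum_rate_real:
  fixes f :: "ptree \<Rightarrow> real"
  assumes "q \<in> trees_upto k"
  shows "(\<Sum>q'\<in>trees_upto (Suc k). rate p q q' * f q') =
    (\<Sum>v\<in>vertices q. measure_pmf.expectation p (\<lambda>z. f (grow q v z)))"
proof -
  have *: "measure_pmf.expectation p (\<lambda>z. f (grow q v z)) =
      (\<Sum>q'\<in>trees_upto (Suc k). measure_pmf.prob p {z. grow q v z = q'} * f q')"
    if "v \<in> vertices q" for v
  proof -
    have int: "integrable (measure_pmf p) (indicat_real A)" for A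
      by (rule measure_pmf.integrable_const_bound[where B = 1]) auto
    have "f (grow q v z) = (\<Sum>q'\<in>trees_upto (Suc k). indicator {z. grow q v z = q'} z * f q')" for z
      using grow_trees_upto[OF assms, of v z] that
      by (simp add: indicator_def if_distrib[of "\<lambda>x. x * _"] sum.delta' cong: if_cong)
    then have "measure_pmf.expectation p (\<lambda>z. f (grow q v z)) =
        measure_pmf.expectation p (\<lambda>z. \<Sum>q'\<in>trees_upto (Suc k). indicator {z. grow q v z = q'} z * f q')"
      by (simp only:)
    also have "\<dots> = (\<Sum>q'\<in>trees_upto (Suc k). measure_pmf.expectation p (\<lambda>z. indicator {z. grow q v z = q'} z * f q'))"
      by (intro Bochner_Integration.integral_sum integrable_mult_left int)
    also have "\<dots> = (\<Sum>q'\<in>trees_upto (Suc k). measure_pmf.prob p {z. grow q v z = q'} * f q')"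
      by (intro sum.cong refl, subst integral_mult_left_zero) simp
    finally show ?thesis .
  qed
  show ?thesis
    by (simp add: * rate_def sum_distrib_right sum.swap[of _ "vertices q"])
qed

text \<open>
  The rate at which a vertex at depth \<open>e\<close> produces vertices at depth \<open>d\<close>.
\<close>

definition walk_step :: "nat pmf \<Rightarrow> nat \<Rightarrow> nat \<Rightarrow> real" where
  "walk_step p e d = measure_pmf.prob p {z. z \<le> e \<and> d + z = Suc e}"

lemma walk_step_eq: "walk_step p e d = (if 1 \<le> d \<and> d \<le> Suc e then pmf p (Suc e - d) else 0)"
proof -
  have "{z. z \<le> e \<and> d + z = Suc e} = (if 1 \<le> d \<and> d \<le> Suc e then {Suc e - d} else {})"
    by auto
  then show ?thesis by (simp add: walk_step_def measure_pmf_single)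
qed

lemma sum_rate_level_size:
  assumes q: "q \<in> trees_upto k"
  shows "(\<Sum>q'\<in>trees_upto (Suc k). rate p q q' * real (level_size q' d)) =
    (real (length q) + 1) * real (level_size q d) + (\<Sum>e\<le>k. real (level_size q e) * walk_step p e d)"
proof -
  have inc: "increasing_tree q" "length q \<le> k" using q by (auto simp: trees_upto_def)
  have "measure_pmf.expectation p (\<lambda>z. real (level_size (grow q v z) d)) =
      real (level_size q d) + walk_step p (depth q v) d" if "v \<in> vertices q" for v
  proof -
    let ?A = "{z. z \<le> depth q v \<and> d + z = Suc (depth q v)}"
    have "measure_pmf.expectation p (\<lambda>z. real (level_size (grow q v z) d)) =
        measure_pmf.expectation p (\<lambda>z. real (level_size q d) + indicator ?A z)"
      using that inc by (simp add: level_size_grow indicator_def)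
    also have "\<dots> = real (level_size q d) + measure_pmf.prob p ?A"
      by (subst Bochner_Integration.integral_add)
        (auto intro!: measure_pmf.integrable_const_bound[where B = 1])
    finally show ?thesis by (simp add: walk_step_def)
  qed
  then have "(\<Sum>q'\<in>trees_upto (Suc k). rate p q q' * real (level_size q' d)) =
      (\<Sum>v\<in>vertices q. real (level_size q d) + walk_step p (depth q v) d)"
    by (simp add: sum_rate_real[OF q])
  also have "\<dots> = (real (length q) + 1) * real (level_size q d) + (\<Sum>v\<in>vertices q. walk_step p (depth q v) d)"
    by (simp add: sum.distrib add.commute)
  also have "(\<Sum>v\<in>vertices q. walk_step p (depth q v) d) = (\<Sum>e\<le>k. real (level_size q e) * walk_step p e d)"
    by (rule sum_over_levels) (use inc in auto)
  finally show ?thesis .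
qed

abbreviation reach_level :: "nat pmf \<Rightarrow> nat \<Rightarrow> nat \<Rightarrow> real" where
  "reach_level p k d \<equiv> reach_sum p k (\<lambda>q. real (level_size q d))"

abbreviation halt_level :: "nat pmf \<Rightarrow> nat \<Rightarrow> nat \<Rightarrow> real" where
  "halt_level p k d \<equiv> halt_sum p k (\<lambda>q. real (level_size q d))"

lemma reach_sum_Suc:
  "reach_sum p (Suc k) h = (\<Sum>q\<in>trees_upto k. halt p k q * (\<Sum>q'\<in>trees_upto (Suc k). rate p q q' * h q'))"
  unfolding reach_sum_def reach_Suc
  by (simp add: sum_distrib_left sum_distrib_right mult.assoc sum.swap[of _ "trees_upto (Suc k)"])

text \<open>
  Between two reproductions, the expected number of vertices at depth \<open>d\<close>, on the event of
  survival, changes in two ways: the chain halts, or a vertex is added.  The identity concerns a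
  single step, where all sums are finite, so that terms may be moved from one side to the other.
\<close>

lemma reach_level_Suc:
  "reach_level p (Suc k) d + halt_level p k d = reach_level p k d + (\<Sum>e\<le>k. halt_level p k e * walk_step p e d)"
proof -
  have "reach_level p (Suc k) d =
    (\<Sum>q\<in>trees_upto k. halt p k q * ((real (length q) + 1) * real (level_size q d) + (\<Sum>e\<le>k. real (level_size q e) * walk_step p e d)))"
    unfolding reach_sum_Suc by (intro sum.cong refl) (simp only: sum_rate_level_size)
  also have "\<dots> = (\<Sum>q\<in>trees_upto k. halt p k q * ((real (length q) + 1) * real (level_size q d)))
     + (\<Sum>q\<in>trees_upto k. \<Sum>e\<le>k. halt p k q * real (level_size q e) * walk_step p e d)"
    by (simp add: distrib_left sum.distrib sum_distrib_left mult.assoc)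
  also have "(\<Sum>q\<in>trees_upto k. \<Sum>e\<le>k. halt p k q * real (level_size q e) * walk_step p e d)
      = (\<Sum>e\<le>k. halt_level p k e * walk_step p e d)"
    by (subst sum.swap) (simp add: halt_sum_def sum_distrib_right)
  finally show ?thesis
    unfolding reach_sum_eq_halt_sum[of p k] halt_sum_def
    by (simp add: sum.distrib[symmetric] algebra_simps)
qed

lemma halt_level_eq_0: "k < d \<Longrightarrow> halt_level p k d = 0"
  unfolding halt_sum_def by (intro sum.neutral) (auto simp: trees_upto_def level_size_eq_0)

definition partial_level :: "nat pmf \<Rightarrow> nat \<Rightarrow> nat \<Rightarrow> real" where
  "partial_level p K d = (\<Sum>k<K. halt_level p k d)"

lemma partial_level_nonneg: "partial_level p K d \<ge> 0"
  unfolding partial_level_def by (intro sum_nonneg halt_sum_nonneg) simp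

lemma partial_level_eq_0: "K \<le> d \<Longrightarrow> partial_level p K d = 0"
  unfolding partial_level_def by (intro sum.neutral ballI halt_level_eq_0) simp

lemma partial_level_mono: "K \<le> L \<Longrightarrow> partial_level p K d \<le> partial_level p L d"
  unfolding partial_level_def by (intro sum_mono2) (auto intro: halt_sum_nonneg)

text \<open>
  Summing the one-step balance telescopes.  The contribution of depth \<open>d\<close> is not in equilibrium
  before the limit \<open>K \<rightarrow> \<infinity>\<close>; \<open>reach_level p K d\<close> is the defect.
\<close>

lemma partial_level_balance:
  "partial_level p K d + reach_level p K d = of_bool (d = 0) + (\<Sum>e\<le>K. partial_level p K e * walk_step p e d)"
proof -
  have "partial_level p K d + reach_level p K d =
      of_bool (d = 0) + (\<Sum>e\<le>L. partial_level p K e * walk_step p e d)" if "K \<le> L" for L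
    using that
  proof (induction K)
    case 0
    have "trees_upto 0 = {[]}" by (auto simp: trees_upto_def)
    then show ?case by (simp add: partial_level_def reach_sum_def level_size_Nil)
  next
    case (Suc K)
    have "(\<Sum>e\<le>K. halt_level p K e * walk_step p e d) = (\<Sum>e\<le>L. halt_level p K e * walk_step p e d)"
      using Suc.prems by (intro sum.mono_neutral_left) (auto simp: halt_level_eq_0)
    then show ?case
      using Suc.IH Suc.prems reach_level_Suc[of p K d]
      by (simp add: partial_level_def distrib_right sum.distrib)
  qed
  then show ?thesis by simp
qed

lemma partial_level_balance':
  assumes "d \<ge> 1"
  shows "(\<lambda>j. pmf p j * partial_level p K (d - 1 + j)) sums (partial_level p K d + reach_level p K d)"
proof -
  let ?g = "\<lambda>e. partial_level p K e * walk_step p e d"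
  have "(\<lambda>j. pmf p j * partial_level p K (d - 1 + j)) sums (\<Sum>j\<le>K. pmf p j * partial_level p K (d - 1 + j))"
    by (rule sums_finite) (auto simp: partial_level_eq_0)
  also have "(\<Sum>j\<le>K. pmf p j * partial_level p K (d - 1 + j)) = (\<Sum>j\<le>K. ?g (j + (d - 1)))"
    using assms by (intro sum.cong refl) (auto simp: walk_step_eq add.commute mult.commute)
  also have "\<dots> = (\<Sum>e\<in>{0 + (d - 1)..K + (d - 1)}. ?g e)"
    by (subst sum.shift_bounds_cl_nat_ivl) (simp add: atMost_atLeast0)
  also have "\<dots> = (\<Sum>e\<le>K + (d - 1). ?g e)"
    by (intro sum.mono_neutral_left) (auto simp: walk_step_eq)
  also have "\<dots> = (\<Sum>e\<le>K. ?g e)"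
    by (intro sum.mono_neutral_right) (auto simp: partial_level_eq_0)
  also have "\<dots> = partial_level p K d + reach_level p K d"
    using partial_level_balance[of p K d] assms by simp
  finally show ?thesis .
qed

lemma halt_level_0: "halt_level p k 0 = halt_sum p k (\<lambda>_. 1)"
  unfolding halt_sum_def by (intro sum.cong) (auto simp: trees_upto_def level_size_0)

lemma partial_level_0: "partial_level p K 0 = 1 - reach_level p K 0"
  using partial_level_balance[of p K 0] by (simp add: walk_step_eq)

lemma halt_level_ge: "reach_level p k d \<le> (real k + 2) * halt_level p k d"
  unfolding reach_sum_eq_halt_sum halt_sum_def sum_distrib_left
proof (rule sum_mono)
  fix q assume "q \<in> trees_upto k"
  then have "halt p k q * real (level_size q d) * (real (length q) + 2) \<le> halt p k q * real (level_size q d) * (real k + 2)"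
    by (intro mult_left_mono mult_nonneg_nonneg halt_nonneg) (auto simp: trees_upto_def)
  then show "halt p k q * ((real (length q) + 2) * real (level_size q d)) \<le> (real k + 2) * (halt p k q * real (level_size q d))"
    by (simp add: mult_ac)
qed

text \<open>
  After \<open>k\<close> reproductions there are at most \<open>k + 1\<close> vertices, so the chain survives the next step
  with probability at most \<open>(k + 1) / (k + 2)\<close>, and the product of these ratios telescopes.
\<close>

lemma survival_bound: "reach_level p k 0 \<le> 1 / (real k + 1)"
proof (induction k)
  case 0
  show ?case using partial_level_balance[of p 0 0] by (simp add: partial_level_def walk_step_eq)
next
  case (Suc k)
  have "reach_level p (Suc k) 0 = reach_level p k 0 - halt_level p k 0"
    using reach_level_Suc[of p k 0] by (simp add: walk_step_eq)
  also have "\<dots> \<le> reach_level p k 0 - reach_level p k 0 / (real k + 2)"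
    using halt_level_ge[of p k 0] by (simp add: field_simps)
  also have "\<dots> = reach_level p k 0 * ((real k + 1) / (real k + 2))"
    by (simp add: field_simps)
  also have "\<dots> \<le> 1 / (real k + 1) * ((real k + 1) / (real k + 2))"
    by (rule mult_right_mono[OF Suc.IH]) simp
  also have "\<dots> = 1 / (real (Suc k) + 1)" by (simp add: field_simps)
  finally show ?case .
qed

text \<open>
  The chain halts almost surely; in particular the reproduction times do not accumulate before \<open>\<tau>\<close>.
\<close>

lemma halt_sums_1: "(\<lambda>k. halt_sum p k (\<lambda>_. 1)) sums 1"
proof -
  have "(\<lambda>k. reach_level p k 0) \<longlonglongrightarrow> 0"
  proof (rule tendsto_sandwich[where f = "\<lambda>_. 0" and h = "\<lambda>k. 1 / (real k + 1)"])
    show "(\<lambda>k. 1 / (real k + 1)) \<longlonglongrightarrow> 0" by real_asymp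
    show "\<forall>\<^sub>F k in sequentially. 0 \<le> reach_level p k 0" by (simp add: reach_sum_nonneg)
  qed (use survival_bound in auto)
  then have "(\<lambda>K. 1 - reach_level p K 0) \<longlonglongrightarrow> 1 - 0" by (intro tendsto_diff tendsto_const)
  then show ?thesis
    unfolding sums_def by (simp add: partial_level_0[symmetric] partial_level_def halt_level_0)
qed

text \<open>
  A subsolution of \<open>b d = (\<Sum>j. w j * b (d - 1 + j))\<close> cannot have a positive maximum, since at a
  point where the maximum is attained the average of \<open>b\<close> would have to be maximal too.  If the
  weights sum up to less than \<open>1\<close> this is absurd at once.  Otherwise \<open>w 0 > 0\<close> shows that the
  preceding point also carries the maximum, which contradicts the choice of the least such point.
\<close>

lemma maximum_principle:
  fixes w b :: "nat \<Rightarrow> real"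
  assumes w: "\<And>j. w j \<ge> 0" "summable w" "suminf w \<le> 1" "w 0 > 0 \<or> suminf w < 1"
    and b0: "b 0 \<le> 0" and bN: "\<And>d. d > N \<Longrightarrow> b d \<le> 0"
    and sub: "\<And>d. d \<ge> 1 \<Longrightarrow> summable (\<lambda>j. w j * b (d - 1 + j))"
      "\<And>d. d \<ge> 1 \<Longrightarrow> b d \<le> (\<Sum>j. w j * b (d - 1 + j))"
  shows "b d \<le> 0"
proof (rule ccontr)
  assume d: "\<not> b d \<le> 0"
  define M where "M = Max (b ` {..N})"
  have "d \<le> N" using d bN[of d] by force
  then have "b d \<le> M" unfolding M_def by (intro Max_ge) auto
  then have M: "M > 0" using d by simp
  have le: "b e \<le> M" for e
    using bN[of e] M Max_ge[of "b ` {..N}" "b e"] by (cases "e \<le> N") (auto simp: M_def)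
  have "M \<in> b ` {..N}" unfolding M_def by (rule Max_in) auto
  then have ex: "\<exists>e. b e = M" by auto
  define m where "m = (LEAST e. b e = M)"
  have m: "b m = M" unfolding m_def using ex by (rule LeastI_ex)
  then have m1: "m \<ge> 1" using b0 M by (cases m) auto
  have "b (m - 1) \<noteq> M" using not_less_Least[of "m - 1" "\<lambda>e. b e = M"] m1 by (auto simp: m_def)
  then have less: "b (m - 1) < M" using le[of "m - 1"] by simp
  let ?u = "\<lambda>j. w j * M - w j * b (m - 1 + j)"
  have u0: "?u j \<ge> 0" for j
    using mult_left_mono[OF le[of "m - 1 + j"] w(1)[of j]] by simp
  have us: "summable ?u" by (intro summable_diff summable_mult2 w sub m1)
  have "suminf ?u = suminf w * M - (\<Sum>j. w j * b (m - 1 + j))"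
    using suminf_diff[OF summable_mult2[OF w(2), of M] sub(1)[OF m1]] suminf_mult2[OF w(2), of M]
    by simp
  also have "\<dots> \<le> suminf w * M - M" using sub(2)[OF m1] m by simp
  finally have total: "suminf ?u \<le> (suminf w - 1) * M" by (simp add: algebra_simps)
  show False
  proof (cases "suminf w < 1")
    case True
    then have "(suminf w - 1) * M < 0" using M by (simp add: mult_less_0_iff)
    then show False using total suminf_nonneg[OF us] u0 by fastforce
  next
    case False
    then have "w 0 > 0" using w(4) by simp
    then have "?u 0 > 0" using less by simp
    then have "suminf ?u > 0" using suminf_pos2[OF us u0] by blast
    then show False using total w(3) False by simp
  qed
qed

lemma sums_pmf_nat: "(\<lambda>j. pmf p (j::nat)) sums 1"
proof -
  have "(\<integral>\<^sup>+ z. 1 \<partial>measure_pmf p) = (\<integral>\<^sup>+ z. ennreal (pmf p z) * 1 \<partial>count_space UNIV)"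
    by (rule nn_integral_measure_pmf)
  then have "(\<Sum>j. ennreal (pmf p j)) = (\<integral>\<^sup>+ z. 1 \<partial>measure_pmf p)"
    by (simp only: mult_1_right nn_integral_count_space_nat)
  then have eq: "(\<Sum>j. ennreal (pmf p j)) = ennreal 1" by (simp add: measure_pmf.emeasure_space_1)
  have "(\<lambda>j. ennreal (pmf p j)) sums ennreal 1"
    unfolding eq[symmetric] by (rule summable_sums) simp
  then show ?thesis by (subst (asm) sums_ennreal) auto
qed

text \<open>
  The function \<open>x ^ d\<close> is a supersolution of the balance equation, and the partial sums are a
  subsolution vanishing for \<open>d \<ge> K\<close>.  The maximum principle applies to their quotient, with the
  weights \<open>p j * x ^ j / x\<close>.
\<close>

lemma partial_level_le_power:
  assumes x: "0 < x" "x \<le> 1" and gf: "(\<Sum>j. pmf p j * x ^ j) \<le> x"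
    and strict: "pmf p 0 > 0 \<or> (\<Sum>j. pmf p j * x ^ j) < x"
  shows "partial_level p K d \<le> x ^ d"
proof -
  have sm: "summable (\<lambda>j. pmf p j * x ^ j)"
    by (rule summable_comparison_test'[OF sums_summable[OF sums_pmf_nat[of p]], of 0])
      (use x in \<open>auto intro!: mult_left_le power_le_one\<close>)
  define w where "w j = pmf p j * x ^ j / x" for j
  have ws: "summable w" "suminf w = (\<Sum>j. pmf p j * x ^ j) / x"
    unfolding w_def by (auto intro: summable_divide sm suminf_divide)
  \<comment> \<open>Division by \<open>x ^ d\<close> turns the balance equation into an average with weights \<open>w\<close>.\<close>
  define b where "b d = partial_level p K d / x ^ d - 1" for d
  have "b d \<le> 0"
  proof (rule maximum_principle[where w = w and N = K])
    show "w j \<ge> 0" for j using x by (simp add: w_def)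
    show "suminf w \<le> 1" using gf x by (simp add: ws)
    show "w 0 > 0 \<or> suminf w < 1" using strict x by (auto simp: ws) (simp add: w_def)
    show "b 0 \<le> 0" using reach_sum_nonneg[of _ p K] by (simp add: b_def partial_level_0)
    show "b d \<le> 0" if "d > K" for d using that by (simp add: b_def partial_level_eq_0)
    fix d :: nat assume d: "d \<ge> 1"
    have eq: "w j * b (d - 1 + j) = pmf p j * partial_level p K (d - 1 + j) / x ^ d - w j" for j
    proof -
      have "x ^ d * x ^ j = x * x ^ (d - 1 + j)" using d by (simp add: power_add[symmetric] power_Suc[symmetric] del: power_Suc)
      then show ?thesis using x by (simp add: w_def b_def field_simps)
    qed
    have S: "(\<lambda>j. w j * b (d - 1 + j)) sums ((partial_level p K d + reach_level p K d) / x ^ d - suminf w)"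
      unfolding eq by (intro sums_diff sums_divide partial_level_balance' d summable_sums ws)
    then show "summable (\<lambda>j. w j * b (d - 1 + j))" by (rule sums_summable)
    have "partial_level p K d / x ^ d \<le> (partial_level p K d + reach_level p K d) / x ^ d"
      using x by (intro divide_right_mono) (auto intro: reach_sum_nonneg)
    then show "b d \<le> (\<Sum>j. w j * b (d - 1 + j))"
      using \<open>suminf w \<le> 1\<close> unfolding sums_unique[OF S, symmetric] by (simp add: b_def)
  qed (rule ws)
  then show ?thesis using x by (simp add: b_def divide_le_eq)
qed

lemma mean_eq_suminf: "mean (measure_pmf p) (\<lambda>z. z) = (\<Sum>j. ennreal (pmf p j * real j))"
  unfolding mean_def
  by (simp add: nn_integral_measure_pmf nn_integral_count_space_nat ennreal_mult ennreal_of_nat_eq_real_of_nat)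

text \<open>
  The generating function of \<open>p\<close> has the value \<open>1\<close> at \<open>1\<close>, and slope above \<open>1\<close> there, so it is below
  the diagonal just left of \<open>1\<close>.  As the mean may be infinite, the slope is bounded below by a finite
  partial sum \<open>\<psi> x\<close> of \<open>(1 - (\<Sum>j. p j * x ^ j)) / (1 - x)\<close>.
\<close>

lemma supercritical_point:
  assumes "mean (measure_pmf p) (\<lambda>z. z) > 1"
  obtains x :: real where "0 < x" "x < 1" "(\<Sum>j. pmf p j * x ^ j) < x"
proof -
  have "(SUP n. \<Sum>j<n. ennreal (pmf p j * real j)) > 1"
    using assms by (simp add: mean_eq_suminf suminf_eq_SUP)
  then obtain n where "(\<Sum>j<n. ennreal (pmf p j * real j)) > 1"
    by (auto simp: less_SUP_iff)
  then have n: "(\<Sum>j<n. pmf p j * real j) > 1"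
    by (subst (asm) sum_ennreal) auto
  define \<psi> where "\<psi> x = (\<Sum>j<n. pmf p j * (\<Sum>i<j. x ^ i))" for x :: real
  have "isCont \<psi> 1" unfolding \<psi>_def by (intro continuous_intros)
  then have "(\<psi> \<longlongrightarrow> \<psi> 1) (at_left 1)"
    by (auto simp: isCont_def intro: tendsto_within_subset)
  moreover have "\<psi> 1 > 1" using n by (simp add: \<psi>_def)
  ultimately have "\<forall>\<^sub>F x in at_left 1. \<psi> x > 1" by (rule order_tendstoD(1))
  moreover have "\<forall>\<^sub>F x in at_left (1::real). x \<in> {0<..<1}" by (rule eventually_at_leftI[of 0]) auto
  ultimately have "\<forall>\<^sub>F x in at_left 1. \<psi> x > 1 \<and> x \<in> {0<..<1}" by (rule eventually_conj)
  then obtain x where x: "\<psi> x > 1" "0 < x" "x < 1"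
    using eventually_happens'[of "at_left (1::real)"] by (auto simp: trivial_limit_at_left_real)
  have sm: "summable (\<lambda>j. pmf p j * x ^ j)"
    by (rule summable_comparison_test'[OF sums_summable[OF sums_pmf_nat[of p]], of 0])
      (use x in \<open>auto intro!: mult_left_le power_le_one\<close>)
  have "(\<Sum>j<n. pmf p j * (1 - x ^ j)) = (1 - x) * \<psi> x"
    unfolding \<psi>_def sum_distrib_left one_diff_power_eq by (intro sum.cong) auto
  moreover have "(\<Sum>j<n. pmf p j * (1 - x ^ j)) \<le> (\<Sum>j. pmf p j - pmf p j * x ^ j)"
  proof -
    have "(\<Sum>j<n. pmf p j - pmf p j * x ^ j) \<le> (\<Sum>j. pmf p j - pmf p j * x ^ j)"
      by (rule sum_le_suminf)
        (use x in \<open>auto intro!: summable_diff sm sums_summable[OF sums_pmf_nat] mult_left_le power_le_one\<close>)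
    then show ?thesis by (simp add: right_diff_distrib)
  qed
  moreover have "(\<Sum>j. pmf p j - pmf p j * x ^ j) = 1 - (\<Sum>j. pmf p j * x ^ j)"
    using suminf_diff[OF sums_summable[OF sums_pmf_nat[of p]] sm] sums_unique[OF sums_pmf_nat[of p]] by simp
  moreover have "(1 - x) * \<psi> x > (1 - x) * 1"
    using x by (intro mult_strict_left_mono) auto
  ultimately have "(\<Sum>j. pmf p j * x ^ j) < x" by simp
  then show ?thesis using that x by blast
qed

text \<open>
  If \<open>p 0 = 0\<close>, then \<open>Z \<ge> 1\<close>, and a mean of at most \<open>1\<close> forces \<open>Z = 1\<close>.
\<close>

lemma subcritical_pmf:
  assumes mean: "mean (measure_pmf p) (\<lambda>z. z) \<le> 1" and p1: "pmf p 1 \<noteq> 1"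
  shows "summable (\<lambda>j. pmf p j * real j)" "(\<Sum>j. pmf p j * real j) \<le> 1" "pmf p 0 > 0"
proof -
  have part: "(\<Sum>j<n. pmf p j * real j) \<le> 1" for n
  proof -
    have "(\<Sum>j<n. ennreal (pmf p j * real j)) \<le> (\<Sum>j. ennreal (pmf p j * real j))"
      by (rule sum_le_suminf) auto
    also have "\<dots> \<le> 1" using mean by (simp add: mean_eq_suminf)
    finally show ?thesis by (subst (asm) sum_ennreal) auto
  qed
  show sm: "summable (\<lambda>j. pmf p j * real j)"
    by (rule bounded_imp_summable[where B = 1])
      (auto intro: order_trans[OF _ part[of "Suc _"]] simp: lessThan_Suc_atMost[symmetric])
  then show le: "(\<Sum>j. pmf p j * real j) \<le> 1" by (rule suminf_le_const) (rule part)
  show "pmf p 0 > 0"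
  proof (rule ccontr)
    assume "\<not> pmf p 0 > 0"
    then have p0: "pmf p 0 = 0" using pmf_nonneg[of p 0] by linarith
    let ?u = "\<lambda>j. pmf p j * real j - pmf p j"
    have us: "summable ?u" by (intro summable_diff sm sums_summable[OF sums_pmf_nat])
    have u0: "?u j \<ge> 0" for j using p0 by (cases j) (auto simp: distrib_left)
    have "suminf ?u = (\<Sum>j. pmf p j * real j) - 1"
      using suminf_diff[OF sm sums_summable[OF sums_pmf_nat[of p]]] sums_unique[OF sums_pmf_nat[of p]] by simp
    then have "suminf ?u \<le> 0" using le by simp
    then have "suminf ?u = 0" using suminf_nonneg[OF us u0] by simp
    then have z: "?u j = 0" for j using suminf_eq_zero_iff[OF us u0] by simp
    have "pmf p j = 0" if "j \<noteq> 1" for j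
      using z[of j] p0 that by (cases j) (auto simp: algebra_simps)
    then have "(\<lambda>j. pmf p j) sums pmf p 1"
      using sums_single[of 1 "pmf p"] by (auto elim!: sums_cong[THEN iffD1, rotated])
    then show False using p1 sums_unique2[OF sums_pmf_nat[of p]] by auto
  qed
qed

text \<open>
  Let \<open>a d \<le> 1\<close> be the sum of the series.  Then \<open>a\<close> is a supersolution of the balance equation: the
  defect \<open>reach_level p K d\<close> becomes arbitrarily small along a subsequence, since otherwise
  \<open>reach_level p k d \<le> (k + 2) * halt_level p k d\<close> would make the convergent series dominate a
  harmonic one.  So \<open>1 - a\<close> is a bounded subsolution that vanishes at \<open>0\<close>.  As the mean of \<open>p\<close> is at most
  \<open>1\<close>, \<open>1 - a d - \<epsilon> * d\<close> is a subsolution as well, and it is nonpositive for large \<open>d\<close>.  Hence it is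
  never positive, and \<open>\<epsilon>\<close> is arbitrary.
\<close>

lemma halt_level_sums_1:
  assumes mean: "mean (measure_pmf p) (\<lambda>z. z) \<le> 1" and p1: "pmf p 1 \<noteq> 1"
  shows "(\<lambda>k. halt_level p k d) sums 1"
proof -
  note sub = subcritical_pmf[OF assms]
  have le1: "partial_level p K d \<le> 1" for K d
    using partial_level_le_power[of 1 p K d] sub(3) sums_unique[OF sums_pmf_nat[of p]] by simp
  have sm: "summable (\<lambda>k. halt_level p k d)" for d
    by (rule bounded_imp_summable[where B = 1])
      (use le1[of "Suc _" d] in \<open>auto intro: halt_sum_nonneg simp: partial_level_def lessThan_Suc_atMost\<close>)
  define a where "a d = (\<Sum>k. halt_level p k d)" for d
  have lim: "(\<lambda>K. partial_level p K d) \<longlonglongrightarrow> a d" for d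
    unfolding partial_level_def a_def by (rule summable_LIMSEQ[OF sm])
  have le_a: "partial_level p K d \<le> a d" for K d
    by (rule incseq_le[OF _ lim]) (auto simp: incseq_def intro: partial_level_mono)
  have a1: "a d \<le> 1" for d by (rule LIMSEQ_le_const2[OF lim]) (use le1 in auto)
  have a_nonneg: "a d \<ge> 0" for d using le_a[of 0 d] partial_level_nonneg[of p 0 d] by linarith
  have small: "\<exists>K\<ge>K0. reach_level p K d < \<delta>" if "\<delta> > 0" for K0 d \<delta>
  proof (rule ccontr)
    assume "\<not> ?thesis"
    then have ge: "reach_level p K d \<ge> \<delta>" if "K \<ge> K0" for K using that by force
    have "summable (\<lambda>k. \<delta> / (real k + 2))"
    proof (rule summable_comparison_test'[OF sm[of d], of K0])
      fix k assume "k \<ge> K0"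
      then have "\<delta> \<le> (real k + 2) * halt_level p k d" using ge halt_level_ge[of p k d] by force
      then show "norm (\<delta> / (real k + 2)) \<le> halt_level p k d"
        using \<open>\<delta> > 0\<close> by (simp add: divide_le_eq mult.commute)
    qed
    then have "summable (\<lambda>k. \<delta> * (1 / real (k + 2)))" by (simp add: add.commute)
    then have "summable (\<lambda>k. 1 / real (k + 2))" by (rule summable_mult_D) (use \<open>\<delta> > 0\<close> in simp)
    then have "summable (\<lambda>k. 1 / real k)" by (subst (asm) summable_iff_shift)
    then show False using not_summable_harmonic[where 'a = real] by (simp add: inverse_eq_divide)
  qed
  have super: "(\<Sum>j<J. pmf p j * a (d - 1 + j)) \<le> a d" if d: "d \<ge> 1" for d J
  proof (rule field_le_epsilon)
    fix \<delta> :: real assume "\<delta> > 0"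
    have "(\<lambda>K. \<Sum>j<J. pmf p j * partial_level p K (d - 1 + j)) \<longlonglongrightarrow> (\<Sum>j<J. pmf p j * a (d - 1 + j))"
      by (intro tendsto_sum tendsto_mult tendsto_const lim)
    moreover have "(\<Sum>j<J. pmf p j * partial_level p K0 (d - 1 + j)) \<le> a d + \<delta>" for K0
    proof -
      obtain K where K: "K \<ge> K0" "reach_level p K d < \<delta>" using small \<open>\<delta> > 0\<close> by blast
      have "(\<Sum>j<J. pmf p j * partial_level p K0 (d - 1 + j)) \<le> (\<Sum>j<J. pmf p j * partial_level p K (d - 1 + j))"
        by (intro sum_mono mult_left_mono partial_level_mono K) simp
      also have "\<dots> \<le> (\<Sum>j. pmf p j * partial_level p K (d - 1 + j))"
        by (rule sum_le_suminf[OF sums_summable[OF partial_level_balance'[OF d]]])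
          (auto intro!: mult_nonneg_nonneg partial_level_nonneg)
      also have "\<dots> = partial_level p K d + reach_level p K d"
        by (rule sums_unique[OF partial_level_balance'[OF d], symmetric])
      also have "\<dots> \<le> a d + \<delta>" using K(2) le_a[of K d] by simp
      finally show ?thesis .
    qed
    ultimately show "(\<Sum>j<J. pmf p j * a (d - 1 + j)) \<le> a d + \<delta>"
      by (intro LIMSEQ_le_const2) auto
  qed
  have a0: "a 0 = 1"
    unfolding a_def halt_level_0 by (rule sums_unique[OF halt_sums_1, symmetric])
  have close: "1 - a d \<le> \<epsilon> * real d" if \<epsilon>: "\<epsilon> > 0" for \<epsilon> d
  proof -
    define b where "b d = 1 - a d - \<epsilon> * real d" for d
    have "b d \<le> 0"
    proof (rule maximum_principle[where w = "pmf p" and N = "nat \<lceil>1 / \<epsilon>\<rceil>"])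
      show "summable (pmf p)" by (rule sums_summable[OF sums_pmf_nat])
      show "suminf (pmf p) \<le> 1" using sums_unique[OF sums_pmf_nat[of p]] by simp
      show "pmf p 0 > 0 \<or> suminf (pmf p) < 1" using sub(3) by simp
      show "b 0 \<le> 0" by (simp add: b_def a0)
      show "b d \<le> 0" if "d > nat \<lceil>1 / \<epsilon>\<rceil>" for d
      proof -
        have "1 / \<epsilon> \<le> real d" using that by linarith
        then show ?thesis using \<epsilon> a_nonneg[of d] by (simp add: b_def divide_le_eq mult.commute)
      qed
      fix d :: nat assume d: "d \<ge> 1"
      have sa: "summable (\<lambda>j. pmf p j * a (d - 1 + j))"
        by (rule summable_comparison_test'[OF sums_summable[OF sums_pmf_nat[of p]], of 0])
          (use a1 a_nonneg in \<open>auto intro!: mult_left_le\<close>)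
      have la: "(\<Sum>j. pmf p j * a (d - 1 + j)) \<le> a d"
        by (rule suminf_le_const[OF sa super[OF d]])
      have eq: "pmf p j * b (d - 1 + j) = pmf p j * (1 - \<epsilon> * real (d - 1)) - pmf p j * a (d - 1 + j) - \<epsilon> * (pmf p j * real j)" for j
        by (simp add: b_def algebra_simps)
      have S: "(\<lambda>j. pmf p j * b (d - 1 + j)) sums
         (1 * (1 - \<epsilon> * real (d - 1)) - (\<Sum>j. pmf p j * a (d - 1 + j)) - \<epsilon> * (\<Sum>j. pmf p j * real j))"
        unfolding eq by (intro sums_diff sums_mult sums_mult2 sums_pmf_nat summable_sums sa sub)
      then show "summable (\<lambda>j. pmf p j * b (d - 1 + j))" by (rule sums_summable)
      have "\<epsilon> * (\<Sum>j. pmf p j * real j) \<le> \<epsilon> * 1" using sub(2) \<epsilon> by (intro mult_left_mono) auto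
      then show "b d \<le> (\<Sum>j. pmf p j * b (d - 1 + j))"
        using la d unfolding sums_unique[OF S, symmetric]
        by (simp add: b_def of_nat_diff algebra_simps)
    qed simp
    then show ?thesis by (simp add: b_def)
  qed
  have "1 - a d \<le> 0 + e" if "e > 0" for e
  proof -
    have "1 - a d \<le> e / (real d + 1) * real d" by (rule close) (use that in simp)
    also have "\<dots> \<le> e" using that by (simp add: field_simps)
    finally show ?thesis by simp
  qed
  then have "1 - a d \<le> 0" by (rule field_le_epsilon)
  then have "a d = 1" using a1[of d] by simp
  then show ?thesis using summable_sums[OF sm[of d]] by (simp add: a_def)
qed

section \<open>The law of the limit tree\<close>

lemma measurable_reproduce:
  "reproduce \<in> count_space UNIV \<Otimes>\<^sub>M (borel \<Otimes>\<^sub>M clock_space p) \<rightarrow>\<^sub>M count_space UNIV \<Otimes>\<^sub>M (borel \<Otimes>\<^sub>M clock_space p)"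
    (is "_ \<in> ?M \<rightarrow>\<^sub>M ?M")
proof -
  define g where "g ps x = (let v = first_to_ring ps (snd x)
      in (grow ps v (next_mark (snd x) v), fst x + next_ring (snd x) v, advance ps (snd x)))" for ps x
  have g: "g ps \<in> borel \<Otimes>\<^sub>M clock_space p \<rightarrow>\<^sub>M ?M" for ps
  proof -
    have first: "(\<lambda>x. first_to_ring ps (snd x)) \<in> borel \<Otimes>\<^sub>M clock_space p \<rightarrow>\<^sub>M count_space UNIV"
      by (rule measurable_compose[OF measurable_snd measurable_first_to_ring])
    have "(\<lambda>x. (grow ps v (next_mark (snd x) v), fst x + next_ring (snd x) v, advance ps (snd x)))
        \<in> borel \<Otimes>\<^sub>M clock_space p \<rightarrow>\<^sub>M ?M" for v
    proof (intro measurable_Pair)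
      show "(\<lambda>x. grow ps v (next_mark (snd x) v)) \<in> borel \<Otimes>\<^sub>M clock_space p \<rightarrow>\<^sub>M count_space UNIV"
        by (rule measurable_compose[OF measurable_compose[OF measurable_snd measurable_next_mark]]) simp
      show "(\<lambda>x. fst x + next_ring (snd x) v) \<in> borel_measurable (borel \<Otimes>\<^sub>M clock_space p)"
        by (intro borel_measurable_add measurable_fst measurable_compose[OF measurable_snd measurable_next_ring])
      show "(\<lambda>x. advance ps (snd x)) \<in> borel \<Otimes>\<^sub>M clock_space p \<rightarrow>\<^sub>M clock_space p"
        by (rule measurable_compose[OF measurable_snd measurable_advance])
    qed
    from measurable_compose_countable[where f = "\<lambda>v x. (grow ps v (next_mark (snd x) v), fst x + next_ring (snd x) v, advance ps (snd x))",
        OF this first]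
    show ?thesis unfolding g_def[abs_def] Let_def .
  qed
  have "(\<lambda>x. g (fst x) (snd x)) \<in> ?M \<rightarrow>\<^sub>M ?M"
    by (rule measurable_compose_countable[where f = "\<lambda>ps x. g ps (snd x)", OF measurable_compose[OF measurable_snd g] measurable_fst])
  moreover have "reproduce = (\<lambda>x. g (fst x) (snd x))"
    by (auto simp: fun_eq_iff g_def Let_def)
  ultimately show ?thesis by simp
qed

lemma measurable_state_after:
  "(\<lambda>\<omega>. state_after \<omega> k) \<in> clock_space p \<rightarrow>\<^sub>M count_space UNIV \<Otimes>\<^sub>M (borel \<Otimes>\<^sub>M clock_space p)"
proof (induction k)
  case 0
  show ?case unfolding state_after_0 by (intro measurable_Pair measurable_const measurable_ident_sets refl) simp_all
next
  case (Suc k)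
  show ?case unfolding state_after_Suc by (rule measurable_compose[OF Suc measurable_reproduce])
qed

lemma measurable_tree_after: "(\<lambda>\<omega>. tree_after \<omega> k) \<in> clock_space p \<rightarrow>\<^sub>M count_space UNIV"
  unfolding tree_after_def by (rule measurable_compose[OF measurable_state_after measurable_fst])

lemma measurable_reproduction_time [measurable]:
  "(\<lambda>\<omega>. reproduction_time \<omega> k) \<in> clock_space p \<rightarrow>\<^sub>M borel"
  unfolding reproduction_time_def
  by (rule measurable_compose[OF measurable_compose[OF measurable_state_after measurable_snd] measurable_fst])

lemma pred_reproduction_time_le:
  "Measurable.pred (run_space p) (\<lambda>x. reproduction_time (fst x) k \<le> snd x)"
  "Measurable.pred (run_space p) (\<lambda>x. snd x < reproduction_time (fst x) k)"
proof -
  have [measurable]: "(\<lambda>x. reproduction_time (fst x) k) \<in> borel_measurable (run_space p)"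
    by (rule measurable_compose[OF measurable_fst measurable_reproduction_time])
  show "Measurable.pred (run_space p) (\<lambda>x. reproduction_time (fst x) k \<le> snd x)"
    "Measurable.pred (run_space p) (\<lambda>x. snd x < reproduction_time (fst x) k)"
    by measurable
qed

lemma pred_halts: "Measurable.pred (run_space p) (\<lambda>x. halts (fst x) (snd x) k)"
  unfolding halts_def alive_def
  by (intro pred_intros_logic pred_intros_finite pred_reproduction_time_le) simp

lemma measurable_limit_tree:
  "(\<lambda>x. limit_tree (fst x) (snd x)) \<in> run_space p \<rightarrow>\<^sub>M count_space UNIV"
  unfolding limit_tree_def
  by (rule measurable_compose_countable[where f = "\<lambda>k x. tree_after (fst x) k",
      OF measurable_compose[OF measurable_fst measurable_tree_after]
         measurable_Least[OF pred_reproduction_time_le(2)]])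

lemma measurable_limit_fringe:
  "(\<lambda>(\<omega>, \<tau>). fringe (limit_tree \<omega> \<tau>) 0) \<in> run_space p \<rightarrow>\<^sub>M count_space UNIV"
  unfolding case_prod_beta by (rule measurable_compose[OF measurable_limit_tree]) simp

lemma tree_prob_limit_law: "tree_prob (limit_law p)"
  unfolding tree_prob_def limit_law_def
  by (auto intro!: prob_space.prob_space_distr prob_space_run_space measurable_limit_fringe)

lemma halts_unique:
  assumes "halts \<omega> \<tau> k"
  shows "(LEAST k. \<tau> < reproduction_time \<omega> (Suc k)) = k"
proof (rule Least_equality)
  show "\<tau> < reproduction_time \<omega> (Suc k)" using assms by (simp add: halts_def)
  fix j assume "\<tau> < reproduction_time \<omega> (Suc j)"
  then show "k \<le> j" using assms by (force simp: halts_def alive_def not_le[symmetric])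
qed

text \<open>
  At most one summand differs from \<open>0\<close>, since halting after \<open>k\<close> reproductions determines \<open>k\<close>.
\<close>

lemma suminf_halts:
  "(\<Sum>k. of_bool (halts \<omega> \<tau> k) * f k) =
    (if \<exists>k. halts \<omega> \<tau> k then f (LEAST k. \<tau> < reproduction_time \<omega> (Suc k)) else (0::ennreal))"
proof (cases "\<exists>k. halts \<omega> \<tau> k")
  case True
  then obtain k where k: "halts \<omega> \<tau> k" by blast
  then have "halts \<omega> \<tau> j \<longleftrightarrow> j = k" for j using halts_unique by blast
  then have "(\<Sum>k. of_bool (halts \<omega> \<tau> k) * f k) = (\<Sum>j\<in>{k}. of_bool (halts \<omega> \<tau> j) * f j)"
    by (intro suminf_finite) auto
  then show ?thesis using k by (auto simp: halts_unique)
qed simp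

lemma ennreal_halt_sum:
  "(\<And>q. h q \<ge> 0) \<Longrightarrow> (\<Sum>q\<in>trees_upto k. ennreal (halt p k q) * ennreal (h q)) = ennreal (halt_sum p k h)"
  by (simp add: halt_sum_def ennreal_mult[symmetric] halt_nonneg)

lemma measurable_halts_integrand:
  "(\<lambda>(\<omega>, \<tau>). of_bool (halts \<omega> \<tau> k) * (\<phi> (tree_after \<omega> k) :: ennreal)) \<in> borel_measurable (run_space p)"
  unfolding case_prod_beta
proof (rule borel_measurable_times_ennreal)
  show "(\<lambda>x. of_bool (halts (fst x) (snd x) k) :: ennreal) \<in> borel_measurable (run_space p)"
    using pred_halts[where p = p and k = k] by measurable
  show "(\<lambda>x. \<phi> (tree_after (fst x) k)) \<in> borel_measurable (run_space p)"
    by (rule measurable_compose[OF measurable_compose[OF measurable_fst measurable_tree_after]]) simp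
qed

text \<open>
  The probabilities of halting after \<open>k\<close> reproductions add up to \<open>1\<close>.
\<close>

lemma AE_halts: "AE x in run_space p. \<exists>k. halts (fst x) (snd x) k"
proof -
  interpret R: prob_space "run_space p" by (rule prob_space_run_space)
  have ev: "{x \<in> space (run_space p). \<exists>k. halts (fst x) (snd x) k} \<in> sets (run_space p)"
    using pred_halts[where p = p] by measurable
  have "emeasure (run_space p) {x \<in> space (run_space p). \<exists>k. halts (fst x) (snd x) k} =
      (\<integral>\<^sup>+ x. indicator {x \<in> space (run_space p). \<exists>k. halts (fst x) (snd x) k} x \<partial>run_space p)"
    using ev by simp
  also have "\<dots> = (\<integral>\<^sup>+ x. (\<Sum>k. case x of (\<omega>, \<tau>) \<Rightarrow> of_bool (halts \<omega> \<tau> k) * 1) \<partial>run_space p)"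
    by (intro nn_integral_cong) (simp only: case_prod_beta suminf_halts, simp add: indicator_def)
  also have "\<dots> = (\<Sum>k. \<integral>\<^sup>+ (\<omega>, \<tau>). of_bool (halts \<omega> \<tau> k) * 1 \<partial>run_space p)"
    by (rule nn_integral_suminf) (rule measurable_halts_integrand)
  also have "\<dots> = (\<Sum>k. ennreal (halt_sum p k (\<lambda>_. 1)))"
    using nn_integral_halts[where \<phi> = "\<lambda>_. 1"] ennreal_halt_sum[where h = "\<lambda>_. 1"] by simp
  also have "\<dots> = ennreal 1"
    by (rule suminf_ennreal_eq[OF _ halt_sums_1]) (simp add: halt_sum_nonneg)
  finally have "emeasure (run_space p) {x \<in> space (run_space p). \<exists>k. halts (fst x) (snd x) k} = 1" by simp
  then have "AE x in run_space p. x \<in> {x \<in> space (run_space p). \<exists>k. halts (fst x) (snd x) k}"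
    by (intro R.AE_prob_1) (simp add: R.emeasure_eq_measure)
  then show ?thesis by eventually_elim simp
qed

lemma nn_integral_limit_law:
  "(\<integral>\<^sup>+ t. \<phi> t \<partial>limit_law p) = (\<Sum>k. \<Sum>q\<in>trees_upto k. ennreal (halt p k q) * \<phi> (fringe q 0))"
proof -
  have "(\<integral>\<^sup>+ t. \<phi> t \<partial>limit_law p) = (\<integral>\<^sup>+ (\<omega>, \<tau>). \<phi> (fringe (limit_tree \<omega> \<tau>) 0) \<partial>run_space p)"
    unfolding limit_law_def by (subst nn_integral_distr[OF measurable_limit_fringe]) (auto simp: case_prod_unfold)
  also have "\<dots> = (\<integral>\<^sup>+ x. (\<Sum>k. case x of (\<omega>, \<tau>) \<Rightarrow> of_bool (halts \<omega> \<tau> k) * \<phi> (fringe (tree_after \<omega> k) 0)) \<partial>run_space p)"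
  proof (rule nn_integral_cong_AE)
    show "AE x in run_space p. (case x of (\<omega>, \<tau>) \<Rightarrow> \<phi> (fringe (limit_tree \<omega> \<tau>) 0)) =
        (\<Sum>k. case x of (\<omega>, \<tau>) \<Rightarrow> of_bool (halts \<omega> \<tau> k) * \<phi> (fringe (tree_after \<omega> k) 0))"
      using AE_halts
      by eventually_elim (simp only: case_prod_beta suminf_halts limit_tree_def, simp)
  qed
  also have "\<dots> = (\<Sum>k. \<integral>\<^sup>+ (\<omega>, \<tau>). of_bool (halts \<omega> \<tau> k) * \<phi> (fringe (tree_after \<omega> k) 0) \<partial>run_space p)"
    by (rule nn_integral_suminf) (rule measurable_halts_integrand[where \<phi> = "\<lambda>q. \<phi> (fringe q 0)"])
  also have "\<dots> = (\<Sum>k. \<Sum>q\<in>trees_upto k. ennreal (halt p k q) * \<phi> (fringe q 0))"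
    by (intro suminf_cong) (rule nn_integral_halts[where \<phi> = "\<lambda>q. \<phi> (fringe q 0)"])
  finally show ?thesis .
qed

section \<open>The equilibrium equation\<close>

lemma reach_eq_0: "q \<notin> trees_upto k \<Longrightarrow> reach p k q = 0"
proof (induction k arbitrary: q)
  case 0
  then show ?case by (auto simp: trees_upto_def)
next
  case (Suc k)
  have "rate p s q = 0" if "s \<in> trees_upto k" for s
  proof -
    have "{z. grow s v z = q} = {}" if "v \<in> vertices s" for v
      using grow_trees_upto[OF \<open>s \<in> trees_upto k\<close>, of v] that Suc.prems by auto
    then show ?thesis by (simp add: rate_def)
  qed
  then show ?case by simp
qed

lemma halt_eq_0: "q \<notin> trees_upto k \<Longrightarrow> halt p k q = 0"
  by (simp add: halt_def reach_eq_0)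

definition tree_law :: "nat pmf \<Rightarrow> ptree \<Rightarrow> real" where
  "tree_law p q = (\<Sum>k. halt p k q)"

lemma summable_halt: "summable (\<lambda>k. halt p k q)"
proof (rule summable_comparison_test'[OF sums_summable[OF halt_sums_1[of p]], of 0])
  fix k
  have "halt p k q \<le> halt_sum p k (\<lambda>_. 1)"
  proof (cases "q \<in> trees_upto k")
    case True
    then show ?thesis unfolding halt_sum_def
      by (auto intro!: member_le_sum[of q _ "halt p k"] simp: halt_nonneg)
  qed (simp add: halt_eq_0 halt_sum_nonneg)
  then show "norm (halt p k q) \<le> halt_sum p k (\<lambda>_. 1)" by (simp add: halt_nonneg)
qed

lemma tree_law_nonneg: "tree_law p q \<ge> 0"
  unfolding tree_law_def by (rule suminf_nonneg[OF summable_halt halt_nonneg])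

text \<open>
  Both sides are the expected number of visits of the killed chain to \<open>q\<close>: each visit is the last
  one with probability \<open>1 / (length q + 2)\<close>, and each visit but an initial one is entered from \<open>q\<close> or
  from \<open>butlast q\<close>.
\<close>

lemma tree_law_balance:
  "(real (length q) + 2) * tree_law p q = of_bool (q = []) + tree_law p q * rate p q q
    + of_bool (q \<noteq> []) * tree_law p (butlast q) * rate p (butlast q) q"
proof -
  have butlast: "butlast q \<noteq> q" if "q \<noteq> []"
    using that by (metis append_butlast_last_id not_Cons_self2 self_append_conv)
  have Suc: "reach p (Suc k) q = halt p k q * rate p q q
      + of_bool (q \<noteq> []) * (halt p k (butlast q) * rate p (butlast q) q)" for k
  proof -
    let ?S = "insert q (if q = [] then {} else {butlast q})"
    have "reach p (Suc k) q = (\<Sum>s\<in>trees_upto k \<union> ?S. halt p k s * rate p s q)"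
      unfolding reach_Suc by (rule sum.mono_neutral_left) (auto simp: halt_eq_0)
    also have "\<dots> = (\<Sum>s\<in>?S. halt p k s * rate p s q)"
      by (rule sum.mono_neutral_right) (auto simp: rate_eq_0)
    also have "\<dots> = halt p k q * rate p q q
      + of_bool (q \<noteq> []) * (halt p k (butlast q) * rate p (butlast q) q)"
      using butlast by (cases "q = []") auto
    finally show ?thesis .
  qed
  have "(\<lambda>k. halt p k q * rate p q q + of_bool (q \<noteq> []) * (halt p k (butlast q) * rate p (butlast q) q))
      sums (tree_law p q * rate p q q + of_bool (q \<noteq> []) * (tree_law p (butlast q) * rate p (butlast q) q))"
    unfolding tree_law_def by (intro sums_add sums_mult sums_mult2 summable_sums summable_halt)
  then have "(\<lambda>k. reach p (Suc k) q) sums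
      (tree_law p q * rate p q q + of_bool (q \<noteq> []) * (tree_law p (butlast q) * rate p (butlast q) q))"
    by (simp only: Suc)
  then have "(\<lambda>k. reach p k q) sums
      (tree_law p q * rate p q q + of_bool (q \<noteq> []) * (tree_law p (butlast q) * rate p (butlast q) q) + reach p 0 q)"
    by (rule sums_Suc)
  moreover have "(\<lambda>k. (real (length q) + 2) * halt p k q) sums ((real (length q) + 2) * tree_law p q)"
    unfolding tree_law_def by (intro sums_mult summable_sums summable_halt)
  then have "(\<lambda>k. reach p k q) sums ((real (length q) + 2) * tree_law p q)"
    by (simp add: halt_def)
  ultimately have "(real (length q) + 2) * tree_law p q =
      tree_law p q * rate p q q + of_bool (q \<noteq> []) * (tree_law p (butlast q) * rate p (butlast q) q) + reach p 0 q"
    by (rule sums_unique2[rotated])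
  then show ?thesis by (simp add: mult.assoc)
qed

lemma prob_space_limit_law: "prob_space (limit_law p)"
  using tree_prob_limit_law by (simp add: tree_prob_def)

lemma sets_limit_law [simp]: "sets (limit_law p) = UNIV"
  using tree_prob_limit_law by (simp add: tree_prob_def)

lemma space_limit_law [simp]: "space (limit_law p) = UNIV"
  by (simp add: limit_law_def)

lemma measurable_limit_law [simp]: "f \<in> limit_law p \<rightarrow>\<^sub>M count_space UNIV" "(g :: rtree \<Rightarrow> ennreal) \<in> borel_measurable (limit_law p)"
  by (auto simp: measurable_def)

lemma measure_limit_law_singleton: "measure (limit_law p) {t} = (\<Sum>q\<in>orderings t. tree_law p q)"
proof -
  have "emeasure (limit_law p) {t} = (\<integral>\<^sup>+ s. indicator {t} s \<partial>limit_law p)" by simp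
  also have "\<dots> = (\<Sum>k. \<Sum>q\<in>trees_upto k. ennreal (halt p k q) * indicator {t} (fringe q 0))"
    by (rule nn_integral_limit_law)
  also have "\<dots> = (\<Sum>k. \<Sum>q\<in>orderings t. ennreal (halt p k q))"
  proof (rule suminf_cong)
    fix k
    have "(\<Sum>q\<in>trees_upto k. ennreal (halt p k q) * indicator {t} (fringe q 0)) =
        (\<Sum>q\<in>trees_upto k \<inter> orderings t. ennreal (halt p k q))"
      by (rule sum.mono_neutral_cong_right[OF finite_trees_upto]) (auto simp: orderings_def trees_upto_def)
    also have "\<dots> = (\<Sum>q\<in>orderings t. ennreal (halt p k q))"
    proof (rule sum.mono_neutral_left)
      show "\<forall>q\<in>orderings t - trees_upto k \<inter> orderings t. ennreal (halt p k q) = 0"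
      proof
        fix q assume "q \<in> orderings t - trees_upto k \<inter> orderings t"
        then have "q \<notin> trees_upto k" by blast
        then show "ennreal (halt p k q) = 0" by (simp add: halt_eq_0)
      qed
    qed (simp_all add: finite_orderings)
    finally show "(\<Sum>q\<in>trees_upto k. ennreal (halt p k q) * indicator {t} (fringe q 0)) = \<dots>" .
  qed
  also have "\<dots> = (\<Sum>q\<in>orderings t. \<Sum>k. ennreal (halt p k q))"
    by (rule suminf_sum) simp
  also have "\<dots> = (\<Sum>q\<in>orderings t. ennreal (tree_law p q))"
    unfolding tree_law_def by (intro sum.cong refl suminf_ennreal2 halt_nonneg summable_halt)
  also have "\<dots> = ennreal (\<Sum>q\<in>orderings t. tree_law p q)"
    by (intro sum_ennreal tree_law_nonneg)
  finally show ?thesis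
    by (simp add: measure_def sum_nonneg tree_law_nonneg)
qed

definition typical_trees :: "nat \<Rightarrow> rtree set" where
  "typical_trees k = (\<lambda>q. fringe q 0) ` trees_upto k"

lemma finite_typical_trees [simp]: "finite (typical_trees k)"
  by (simp add: typical_trees_def)

text \<open>
  Finitely many reproductions only lead to finitely many trees.
\<close>

lemma limit_law_tight:
  assumes "\<epsilon> > 0"
  obtains F where "finite F" "measure (limit_law p) F > 1 - \<epsilon>"
proof -
  interpret L: prob_space "limit_law p" by (rule prob_space_limit_law)
  have "(\<lambda>K. \<Sum>k<K. halt_sum p k (\<lambda>_. 1)) \<longlonglongrightarrow> 1"
    using halt_sums_1[of p] by (simp add: sums_def)
  then have "\<forall>\<^sub>F K in sequentially. (\<Sum>k<K. halt_sum p k (\<lambda>_. 1)) > 1 - \<epsilon>"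
    using assms by (intro order_tendstoD(1)) auto
  then obtain K where K: "(\<Sum>k<K. halt_sum p k (\<lambda>_. 1)) > 1 - \<epsilon>"
    by (auto simp: eventually_sequentially)
  have typical: "fringe q 0 \<in> typical_trees K" if "q \<in> trees_upto k" "k < K" for k q
    using that trees_upto_mono[of k K] by (auto simp: typical_trees_def)
  have "ennreal (\<Sum>k<K. halt_sum p k (\<lambda>_. 1)) = (\<Sum>k<K. \<Sum>q\<in>trees_upto k. ennreal (halt p k q) * ennreal 1)"
    by (subst sum_ennreal[symmetric]) (simp_all only: ennreal_halt_sum zero_le_one halt_sum_nonneg)
  also have "\<dots> \<le> (\<Sum>k<K. \<Sum>q\<in>trees_upto k. ennreal (halt p k q) * indicator (typical_trees K) (fringe q 0))"
    by (intro sum_mono mult_left_mono) (auto simp: indicator_def typical)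
  also have "\<dots> \<le> (\<Sum>k. \<Sum>q\<in>trees_upto k. ennreal (halt p k q) * indicator (typical_trees K) (fringe q 0))"
    by (rule sum_le_suminf) auto
  also have "\<dots> = emeasure (limit_law p) (typical_trees K)"
    by (subst nn_integral_limit_law[symmetric]) simp
  finally have "measure (limit_law p) (typical_trees K) \<ge> (\<Sum>k<K. halt_sum p k (\<lambda>_. 1))"
    by (simp add: L.emeasure_eq_measure)
  then have "measure (limit_law p) (typical_trees K) > 1 - \<epsilon>" using K by simp
  then show ?thesis using that finite_typical_trees by blast
qed

section \<open>Convergence of the fringe frequencies\<close>

lemma fringe_freq_finite_L1_limit:
  assumes "finite F"
  shows "L1_limit (discrete_tree p) (\<lambda>_. fringe_freq F) (measure (limit_law p) F)"
proof -
  interpret L: prob_space "limit_law p" by (rule prob_space_limit_law)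
  have "L1_limit (discrete_tree p) (\<lambda>n ps. \<Sum>t\<in>F. fringe_freq {t} ps) (\<Sum>t\<in>F. measure (limit_law p) {t})"
    unfolding measure_limit_law_singleton
    by (intro L1_limit_sum finite_set_discrete_tree assms fringe_freq_singleton_L1_limit tree_law_balance)
  moreover have "(\<Sum>t\<in>F. fringe_freq {t} ps) = fringe_freq F ps" for ps
  proof -
    have "card {v \<in> vertices ps. fringe ps v \<in> F} = card (\<Union>t\<in>F. {v \<in> vertices ps. fringe ps v \<in> {t}})"
      by (rule arg_cong[of _ _ card]) auto
    also have "\<dots> = (\<Sum>t\<in>F. card {v \<in> vertices ps. fringe ps v \<in> {t}})"
      using assms by (intro card_UN_disjoint) auto
    finally show ?thesis by (simp only: fringe_freq_def of_nat_sum sum_divide_distrib)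
  qed
  moreover have "(\<Sum>t\<in>F. measure (limit_law p) {t}) = measure (limit_law p) F"
    using assms by (subst L.finite_measure_eq_sum_singleton) auto
  ultimately show ?thesis by simp
qed

lemma fringe_freq_mono: "A \<subseteq> B \<Longrightarrow> fringe_freq A ps \<le> fringe_freq B ps"
  unfolding fringe_freq_def by (intro divide_right_mono of_nat_mono card_mono) auto

lemma fringe_freq_nonneg: "fringe_freq A ps \<ge> 0"
  by (simp add: fringe_freq_def)

lemma fringe_freq_Un: "A \<inter> B = {} \<Longrightarrow> fringe_freq (A \<union> B) ps = fringe_freq A ps + fringe_freq B ps"
proof -
  assume "A \<inter> B = {}"
  then have "card ({v \<in> vertices ps. fringe ps v \<in> A} \<union> {v \<in> vertices ps. fringe ps v \<in> B}) =
    card {v \<in> vertices ps. fringe ps v \<in> A} + card {v \<in> vertices ps. fringe ps v \<in> B}"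
    by (intro card_Un_disjoint) auto
  moreover have "{v \<in> vertices ps. fringe ps v \<in> A \<union> B} =
      {v \<in> vertices ps. fringe ps v \<in> A} \<union> {v \<in> vertices ps. fringe ps v \<in> B}" by auto
  ultimately show ?thesis by (simp only: fringe_freq_def of_nat_add add_divide_distrib)
qed

lemma fringe_freq_UNIV: "fringe_freq UNIV ps = 1"
  by (simp add: fringe_freq_def vertices_def)

text \<open>
  No mass escapes: if a finite set \<open>F\<close> has almost full mass in the limit, then almost all fringes
  belong to \<open>F\<close>, and what happens outside \<open>F\<close> is negligible on both sides.
\<close>

lemma fringe_freq_L1_limit:
  "L1_limit (discrete_tree p) (\<lambda>_. fringe_freq A) (measure (limit_law p) A)"
  unfolding L1_limit_def
proof (rule LIMSEQ_I)
  interpret L: prob_space "limit_law p" by (rule prob_space_limit_law)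
  let ?\<pi> = "measure (limit_law p)"
  fix r :: real assume "r > 0"
  then obtain F where F: "finite F" "?\<pi> F > 1 - r / 4" using limit_law_tight[of "r / 4" p] by auto
  let ?E = "\<lambda>B n. measure_pmf.expectation (discrete_tree p n) (\<lambda>ps. \<bar>fringe_freq B ps - ?\<pi> B\<bar>)"
  have [simp]: "integrable (measure_pmf (discrete_tree p n)) f" for n and f :: "ptree \<Rightarrow> real"
    by (rule integrable_measure_pmf_finite[OF finite_set_discrete_tree])
  have "?E (A \<inter> F) \<longlonglongrightarrow> 0" "?E F \<longlonglongrightarrow> 0"
    using fringe_freq_finite_L1_limit[of "A \<inter> F" p] fringe_freq_finite_L1_limit[of F p] F(1)
    by (auto simp: L1_limit_def)
  then have "\<forall>\<^sub>F n in sequentially. ?E (A \<inter> F) n < r / 4 \<and> ?E F n < r / 4"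
    using \<open>r > 0\<close> by (intro eventually_conj order_tendstoD(2)) auto
  then obtain N where N: "\<And>n. n \<ge> N \<Longrightarrow> ?E (A \<inter> F) n < r / 4 \<and> ?E F n < r / 4"
    by (auto simp: eventually_sequentially)
  have le: "\<bar>fringe_freq A ps - ?\<pi> A\<bar> \<le> \<bar>fringe_freq (A \<inter> F) ps - ?\<pi> (A \<inter> F)\<bar> + \<bar>fringe_freq F ps - ?\<pi> F\<bar> + 2 * (1 - ?\<pi> F)" for ps
  proof -
    have "fringe_freq A ps = fringe_freq (A \<inter> F) ps + fringe_freq (A - F) ps"
      by (subst fringe_freq_Un[symmetric]) (auto intro: arg_cong[where f = "\<lambda>X. fringe_freq X ps"])
    moreover have "1 = fringe_freq F ps + fringe_freq (- F) ps"
      by (subst fringe_freq_Un[symmetric]) (auto simp: fringe_freq_UNIV)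
    moreover have "fringe_freq (A - F) ps \<le> fringe_freq (- F) ps" by (rule fringe_freq_mono) auto
    moreover have "?\<pi> A = ?\<pi> (A \<inter> F) + ?\<pi> (A - F)"
      by (subst L.finite_measure_Union[symmetric]) (auto intro: arg_cong[where f = ?\<pi>])
    moreover have "?\<pi> (- F) = 1 - ?\<pi> F" using L.prob_compl[of F] by (simp add: Compl_eq_Diff_UNIV)
    moreover have "?\<pi> (A - F) \<le> ?\<pi> (- F)" by (rule L.finite_measure_mono) auto
    moreover have "fringe_freq (A - F) ps \<ge> 0" "?\<pi> (A - F) \<ge> 0" by (simp_all add: fringe_freq_nonneg)
    moreover have "\<bar>a - b\<bar> \<le> \<bar>a' - b'\<bar> + \<bar>f - \<phi>\<bar> + 2 * (1 - \<phi>)"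
      if "a = a' + u" "1 = f + f'" "u \<le> f'" "b = b' + v" "\<phi>' = 1 - \<phi>" "v \<le> \<phi>'" "0 \<le> u" "0 \<le> v"
      for a a' b b' u v f f' \<phi> \<phi>' :: real
      using that by (smt (verit))
    ultimately show ?thesis by blast
  qed
  show "\<exists>no. \<forall>n\<ge>no. norm (?E A n - 0) < r"
  proof (intro exI[of _ N] allI impI)
    fix n assume n: "n \<ge> N"
    have "?E A n \<le> measure_pmf.expectation (discrete_tree p n)
       (\<lambda>ps. \<bar>fringe_freq (A \<inter> F) ps - ?\<pi> (A \<inter> F)\<bar> + \<bar>fringe_freq F ps - ?\<pi> F\<bar> + 2 * (1 - ?\<pi> F))"
      by (intro expectation_mono_on_support finite_set_discrete_tree le)
    also have "\<dots> = ?E (A \<inter> F) n + ?E F n + 2 * (1 - ?\<pi> F)" by simp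
    also have "\<dots> < r" using N[OF n] F(2) by simp
    finally show "norm (?E A n - 0) < r" by simp
  qed
qed

lemma fringe_converges_discrete_tree: "fringe_converges (discrete_tree p) (limit_law p)"
  unfolding fringe_converges_def
proof (intro conjI allI tree_prob_limit_law)
  show "size_to_infinity (discrete_tree p)"
    unfolding size_to_infinity_def
  proof
    fix K
    have "measure_pmf.prob (discrete_tree p n) {ps. card (vertices ps) \<le> K} = 0" if "n \<ge> K" for n
      unfolding measure_pmf_zero_iff using that discrete_tree_support[of _ p n] by fastforce
    then show "(\<lambda>n. measure_pmf.prob (discrete_tree p n) {ps. card (vertices ps) \<le> K}) \<longlonglongrightarrow> 0"
      by (intro tendsto_eventually) (auto simp: eventually_sequentially)
  qed
  fix t
  have "conv_in_prob (discrete_tree p) (\<lambda>_. fringe_freq {t}) (measure (limit_law p) {t})"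
    by (intro L1_limit_conv_in_prob finite_set_discrete_tree fringe_freq_L1_limit)
  then show "conv_in_prob (discrete_tree p)
      (\<lambda>_ ps. real (card {v \<in> vertices ps. fringe ps v = t}) / real (card (vertices ps))) (measure (limit_law p) {t})"
    by (simp add: fringe_freq_def[abs_def] del: card_vertices mem_vertices)
qed

text \<open>
  Apart from the root, a vertex has one edge to its parent and one edge to each child.
\<close>

lemma degree_freq_conv_in_prob:
  "conv_in_prob (discrete_tree p)
     (\<lambda>n ps. 1 / real (n + 1) * (\<Sum>v\<in>vertices ps. of_bool (vertex_degree ps v = k + 1)))
     (measure (limit_law p) {t. root_degree t = k})"
proof (rule L1_limit_conv_in_prob[OF finite_set_discrete_tree])
  let ?A = "{t. root_degree t = k}" and ?c = "measure (limit_law p) {t. root_degree t = k}"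
  have [simp]: "integrable (measure_pmf (discrete_tree p n)) f" for n and f :: "ptree \<Rightarrow> real"
    by (rule integrable_measure_pmf_finite[OF finite_set_discrete_tree])
  show "L1_limit (discrete_tree p)
     (\<lambda>n ps. 1 / real (n + 1) * (\<Sum>v\<in>vertices ps. of_bool (vertex_degree ps v = k + 1))) ?c"
  proof (rule L1_limitI[where m = 1 and Y = "\<lambda>n ps. \<bar>fringe_freq ?A ps - ?c\<bar> + 1 / (real n + 1)"])
    show "finite (set_pmf (discrete_tree p n))" for n by (rule finite_set_discrete_tree)
    have "(\<lambda>n. 1 / (real n + 1)) \<longlonglongrightarrow> 0" by real_asymp
    then have "(\<lambda>n. measure_pmf.expectation (discrete_tree p n) (\<lambda>ps. \<bar>fringe_freq ?A ps - ?c\<bar>) + 1 / (real n + 1)) \<longlonglongrightarrow> 0 + 0"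
      by (intro tendsto_add) (use fringe_freq_L1_limit[of p ?A] in \<open>simp_all add: L1_limit_def\<close>)
    then show "(\<lambda>n. measure_pmf.expectation (discrete_tree p n) (\<lambda>ps. \<bar>fringe_freq ?A ps - ?c\<bar> + 1 / (real n + 1))) \<longlonglongrightarrow> 0"
      by simp
    fix n ps assume "1 \<le> n" "ps \<in> set_pmf (discrete_tree p n)"
    then have ps: "increasing_tree ps" "length ps = n" using discrete_tree_support[of ps p n] by auto
    let ?S = "\<lambda>P. \<Sum>v\<in>{1..n}. of_bool (P v) :: real"
    have split: "(\<Sum>v\<in>vertices ps. of_bool (P v)) = of_bool (P 0) + ?S P" for P
    proof -
      have "vertices ps = insert 0 {1..n}" using ps by auto
      then show ?thesis by (simp only:) (subst sum.insert, auto)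
    qed
    have "fringe_freq ?A ps = (\<Sum>v\<in>vertices ps. of_bool (fringe ps v \<in> ?A)) / (real n + 1)"
      using ps by (simp add: fringe_freq_def Int_def add.commute)
    then have 1: "fringe_freq ?A ps = of_bool (fringe ps 0 \<in> ?A) / (real n + 1) + ?S (\<lambda>v. fringe ps v \<in> ?A) / (real n + 1)"
      unfolding split by (simp only: add_divide_distrib)
    have "?S (\<lambda>v. vertex_degree ps v = k + 1) = ?S (\<lambda>v. fringe ps v \<in> ?A)"
      using ps by (intro sum.cong) (auto simp: vertex_degree_eq root_degree_fringe)
    then have 2: "1 / real (n + 1) * (\<Sum>v\<in>vertices ps. of_bool (vertex_degree ps v = k + 1)) =
        of_bool (vertex_degree ps 0 = k + 1) / (real n + 1) + ?S (\<lambda>v. fringe ps v \<in> ?A) / (real n + 1)"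
      unfolding split by (simp add: add_divide_distrib add.commute)
    have b: "0 \<le> of_bool b / (real n + 1)" "of_bool b / (real n + 1) \<le> 1 / (real n + 1)" for b
      by (auto simp: divide_right_mono)
    show "\<bar>1 / real (n + 1) * (\<Sum>v\<in>vertices ps. of_bool (vertex_degree ps v = k + 1)) - ?c\<bar>
        \<le> \<bar>fringe_freq ?A ps - ?c\<bar> + 1 / (real n + 1)"
      unfolding 1 2 using b[of "fringe ps 0 \<in> ?A"] b[of "vertex_degree ps 0 = k + 1"] by linarith
  qed
qed

section \<open>Means of the limit tree\<close>

lemma mean_root_degree: "mean (limit_law p) root_degree = (\<Sum>k. ennreal (halt_level p k 1))"
proof -
  have "mean (limit_law p) root_degree =
      (\<Sum>k. \<Sum>q\<in>trees_upto k. ennreal (halt p k q) * of_nat (root_degree (fringe q 0)))"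
    unfolding mean_def by (rule nn_integral_limit_law)
  also have "\<dots> = (\<Sum>k. \<Sum>q\<in>trees_upto k. ennreal (halt p k q) * ennreal (real (level_size q 1)))"
    by (intro suminf_cong sum.cong refl)
      (auto simp: trees_upto_def root_degree_fringe_0 ennreal_of_nat_eq_real_of_nat)
  also have "\<dots> = (\<Sum>k. ennreal (halt_level p k 1))"
    by (simp only: ennreal_halt_sum of_nat_0_le_iff)
  finally show ?thesis .
qed

lemma mean_num_vertices: "mean (limit_law p) num_vertices = (\<Sum>k. ennreal (\<Sum>d\<le>k. halt_level p k d))"
proof -
  have len: "real (length q) + 1 = (\<Sum>d\<le>k. real (level_size q d))" if "q \<in> trees_upto k" for q k
    using sum_over_levels[of q k "\<lambda>_. 1"] that by (simp add: trees_upto_def add.commute)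
  have level: "halt_sum p k (\<lambda>q. real (length q) + 1) = (\<Sum>d\<le>k. halt_level p k d)" for k
    unfolding halt_sum_def by (subst sum.swap) (simp add: len sum_distrib_left)
  have "mean (limit_law p) num_vertices =
      (\<Sum>k. \<Sum>q\<in>trees_upto k. ennreal (halt p k q) * of_nat (num_vertices (fringe q 0)))"
    unfolding mean_def by (rule nn_integral_limit_law)
  also have "\<dots> = (\<Sum>k. \<Sum>q\<in>trees_upto k. ennreal (halt p k q) * ennreal (real (length q) + 1))"
    by (intro suminf_cong sum.cong refl)
      (auto simp: trees_upto_def num_vertices_fringe_0 ennreal_of_nat_eq_real_of_nat add.commute)
  also have "\<dots> = (\<Sum>k. ennreal (halt_sum p k (\<lambda>q. real (length q) + 1)))"
    by (simp only: ennreal_halt_sum add_nonneg_nonneg of_nat_0_le_iff zero_le_one)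
  finally show ?thesis by (simp only: level)
qed

lemma halt_level_nonneg: "halt_level p k d \<ge> 0"
  by (rule halt_sum_nonneg) simp

lemma critical_means:
  assumes "mean (measure_pmf p) (\<lambda>z. z) \<le> 1" "pmf p 1 \<noteq> 1"
  shows "mean (limit_law p) root_degree = 1" "mean (limit_law p) num_vertices = \<infinity>"
proof -
  have level: "(\<Sum>k. ennreal (halt_level p k d)) = 1" for d
    using suminf_ennreal_eq[OF halt_level_nonneg halt_level_sums_1[OF assms, of d]] by simp
  show "mean (limit_law p) root_degree = 1" unfolding mean_root_degree by (rule level)
  have "of_nat L \<le> mean (limit_law p) num_vertices" for L
  proof -
    have "of_nat L = (\<Sum>d<L. \<Sum>k. ennreal (halt_level p k d))" by (simp add: level)
    also have "\<dots> = (\<Sum>k. \<Sum>d<L. ennreal (halt_level p k d))"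
      by (rule suminf_sum[symmetric]) simp
    also have "\<dots> \<le> (\<Sum>k. ennreal (\<Sum>d\<le>k. halt_level p k d))"
    proof (rule suminf_le)
      fix k
      have "(\<Sum>d<L. halt_level p k d) \<le> (\<Sum>d\<in>{..<L} \<union> {..k}. halt_level p k d)"
        by (rule sum_mono2) (auto simp: halt_level_nonneg)
      also have "\<dots> = (\<Sum>d\<le>k. halt_level p k d)"
        by (rule sum.mono_neutral_right) (auto simp: halt_level_eq_0)
      finally show "(\<Sum>d<L. ennreal (halt_level p k d)) \<le> ennreal (\<Sum>d\<le>k. halt_level p k d)"
        by (subst sum_ennreal) (auto simp: halt_level_nonneg intro: ennreal_leI)
    qed auto
    finally show ?thesis unfolding mean_num_vertices .
  qed
  then show "mean (limit_law p) num_vertices = \<infinity>"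
    using ennreal_Ex_less_of_nat[of "mean (limit_law p) num_vertices"] by (metis infinity_ennreal_def less_top not_less)
qed

lemma supercritical_means:
  assumes "mean (measure_pmf p) (\<lambda>z. z) > 1"
  shows "mean (limit_law p) root_degree < 1" "mean (limit_law p) num_vertices < \<infinity>"
proof -
  obtain x where x: "0 < x" "x < 1" "(\<Sum>j. pmf p j * x ^ j) < x"
    using supercritical_point[OF assms] by blast
  have le: "partial_level p K d \<le> x ^ d" for K d
    by (rule partial_level_le_power) (use x in auto)
  have "(\<Sum>k. ennreal (halt_level p k 1)) \<le> ennreal x"
  proof (rule suminf_le_const)
    fix K
    show "(\<Sum>k<K. ennreal (halt_level p k 1)) \<le> ennreal x"
      using le[of K 1] by (subst sum_ennreal) (auto simp: halt_level_nonneg partial_level_def intro: ennreal_leI)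
  qed simp
  also have "\<dots> < 1" using x by (simp add: ennreal_less_one_iff)
  finally show "mean (limit_law p) root_degree < 1" unfolding mean_root_degree .
  have "(\<Sum>k. ennreal (\<Sum>d\<le>k. halt_level p k d)) \<le> ennreal (1 / (1 - x))"
  proof (rule suminf_le_const)
    fix K
    have "(\<Sum>k<K. \<Sum>d\<le>k. halt_level p k d) = (\<Sum>k<K. \<Sum>d<K. halt_level p k d)"
      by (intro sum.cong sum.mono_neutral_left) (auto simp: halt_level_eq_0)
    also have "\<dots> = (\<Sum>d<K. partial_level p K d)"
      unfolding partial_level_def by (rule sum.swap)
    also have "\<dots> \<le> (\<Sum>d<K. x ^ d)" by (intro sum_mono le)
    also have "\<dots> \<le> (\<Sum>d. x ^ d)" using x by (intro sum_le_suminf) auto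
    also have "\<dots> = 1 / (1 - x)" using x by (intro suminf_geometric) simp
    finally show "(\<Sum>k<K. ennreal (\<Sum>d\<le>k. halt_level p k d)) \<le> ennreal (1 / (1 - x))"
      by (subst sum_ennreal) (auto intro!: sum_nonneg halt_level_nonneg ennreal_leI)
  qed simp
  then show "mean (limit_law p) num_vertices < \<infinity>"
    unfolding mean_num_vertices by (rule le_less_trans) simp
qed

section \<open>Fringe distributions\<close>

lemma nn_integral_on_finite_set:
  assumes "finite G"
  shows "(\<integral>\<^sup>+ t. (\<Sum>s\<in>G. of_nat (f s) * indicator {s} t) \<partial>limit_law p) =
    ennreal (\<Sum>s\<in>G. measure (limit_law p) {s} * real (f s))"
proof -
  interpret L: prob_space "limit_law p" by (rule prob_space_limit_law)
  show ?thesis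
    by (subst nn_integral_sum, simp, subst sum_ennreal[symmetric])
      (auto simp: nn_integral_cmult_indicator ennreal_mult L.emeasure_eq_measure
        ennreal_of_nat_eq_real_of_nat mult.commute)
qed

lemma sum_root_degree_le_mean:
  assumes "finite G"
  shows "ennreal (\<Sum>s\<in>G. measure (limit_law p) {s} * real (root_degree s)) \<le> mean (limit_law p) root_degree"
proof -
  have "ennreal (\<Sum>s\<in>G. measure (limit_law p) {s} * real (root_degree s)) =
      (\<integral>\<^sup>+ t. (\<Sum>s\<in>G. of_nat (root_degree s) * indicator {s} t) \<partial>limit_law p)"
    by (rule nn_integral_on_finite_set[OF assms, symmetric])
  also have "\<dots> \<le> mean (limit_law p) root_degree"
    unfolding mean_def
  proof (rule nn_integral_mono)
    fix t
    have "(\<Sum>s\<in>G. of_nat (root_degree s) * indicator {s} t) = (\<Sum>s\<in>G. if s = t then of_nat (root_degree s) else (0::ennreal))"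
      by (intro sum.cong) (auto simp: indicator_def)
    then show "(\<Sum>s\<in>G. of_nat (root_degree s) * indicator {s} t) \<le> (of_nat (root_degree t) :: ennreal)"
      using assms by simp
  qed
  finally show ?thesis .
qed

lemma mean_root_degree_le:
  assumes "\<And>G. finite G \<Longrightarrow> (\<Sum>s\<in>G. measure (limit_law p) {s} * real (root_degree s)) \<le> c"
  shows "mean (limit_law p) root_degree \<le> ennreal c"
  unfolding mean_root_degree
proof (rule suminf_le_const)
  fix K
  let ?G = "typical_trees K"
  have "(\<Sum>k<K. ennreal (halt_level p k 1)) =
      (\<Sum>k<K. \<Sum>q\<in>trees_upto k. ennreal (halt p k q) * ennreal (real (level_size q 1)))"
    by (simp only: ennreal_halt_sum of_nat_0_le_iff)
  also have "\<dots> \<le> (\<Sum>k<K. \<Sum>q\<in>trees_upto k. ennreal (halt p k q) * (\<Sum>s\<in>?G. of_nat (root_degree s) * indicator {s} (fringe q 0)))"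
  proof (intro sum_mono mult_left_mono)
    fix k q assume "k \<in> {..<K}" "q \<in> trees_upto k"
    then have "fringe q 0 \<in> ?G" "increasing_tree q"
      using trees_upto_mono[of k K] by (auto simp: typical_trees_def trees_upto_def)
    have "ennreal (real (level_size q 1)) = of_nat (root_degree (fringe q 0)) * indicator {fringe q 0} (fringe q 0)"
      using root_degree_fringe_0[OF \<open>increasing_tree q\<close>] by (simp add: ennreal_of_nat_eq_real_of_nat)
    also have "\<dots> \<le> (\<Sum>s\<in>?G. of_nat (root_degree s) * indicator {s} (fringe q 0))"
      by (rule member_le_sum[of "fringe q 0" ?G "\<lambda>s. of_nat (root_degree s) * indicator {s} (fringe q 0)"])
        (use \<open>fringe q 0 \<in> ?G\<close> in auto)
    finally show "ennreal (real (level_size q 1)) \<le> (\<Sum>s\<in>?G. of_nat (root_degree s) * indicator {s} (fringe q 0))" .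
  qed auto
  also have "\<dots> \<le> (\<Sum>k. \<Sum>q\<in>trees_upto k. ennreal (halt p k q) * (\<Sum>s\<in>?G. of_nat (root_degree s) * indicator {s} (fringe q 0)))"
    by (rule sum_le_suminf) auto
  also have "\<dots> = (\<integral>\<^sup>+ t. (\<Sum>s\<in>?G. of_nat (root_degree s) * indicator {s} t) \<partial>limit_law p)"
    by (rule nn_integral_limit_law[symmetric])
  also have "\<dots> = ennreal (\<Sum>s\<in>?G. measure (limit_law p) {s} * real (root_degree s))"
    by (rule nn_integral_on_finite_set) simp
  also have "\<dots> \<le> ennreal c" by (intro ennreal_leI assms) simp
  finally show "(\<Sum>k<K. ennreal (halt_level p k 1)) \<le> ennreal c" .
qed simp

lemma sum_child_count_le:
  assumes "finite F"
  shows "(\<Sum>t\<in>F. child_count s t) \<le> root_degree s"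
proof -
  let ?M = "subtrees s"
  have "(\<Sum>t\<in>F. count ?M t) \<le> (\<Sum>t\<in>F \<union> set_mset ?M. count ?M t)"
    by (rule sum_mono2) (use assms in auto)
  also have "\<dots> = (\<Sum>t\<in>set_mset ?M. count ?M t)"
    by (rule sum.mono_neutral_right) (use assms in \<open>auto simp: not_in_iff\<close>)
  finally show ?thesis
    by (simp add: child_count_def root_degree_def size_multiset_overloaded_eq)
qed

lemma L1_limit_le:
  assumes fin: "\<And>n. finite (set_pmf (\<mu> n))" and X: "L1_limit \<mu> X c" and Y: "L1_limit \<mu> Y d"
    and le: "\<And>n x. x \<in> set_pmf (\<mu> n) \<Longrightarrow> X n x \<le> Y n x"
  shows "c \<le> d"
proof -
  have [simp]: "integrable (measure_pmf (\<mu> n)) f" for n and f :: "'a \<Rightarrow> real"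
    by (rule integrable_measure_pmf_finite[OF fin])
  have "c - d \<le> measure_pmf.expectation (\<mu> n) (\<lambda>x. \<bar>X n x - c\<bar>) + measure_pmf.expectation (\<mu> n) (\<lambda>x. \<bar>Y n x - d\<bar>)" for n
  proof -
    have "measure_pmf.expectation (\<mu> n) (\<lambda>_. c - d) \<le> measure_pmf.expectation (\<mu> n) (\<lambda>x. \<bar>X n x - c\<bar> + \<bar>Y n x - d\<bar>)"
      by (rule expectation_mono_on_support[OF fin]) (use le in force)
    then show ?thesis by simp
  qed
  moreover have "(\<lambda>n. measure_pmf.expectation (\<mu> n) (\<lambda>x. \<bar>X n x - c\<bar>) + measure_pmf.expectation (\<mu> n) (\<lambda>x. \<bar>Y n x - d\<bar>)) \<longlonglongrightarrow> 0 + 0"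
    by (intro tendsto_add X[unfolded L1_limit_def] Y[unfolded L1_limit_def])
  ultimately have "c - d \<le> 0 + 0" by (intro LIMSEQ_le_const) auto
  then show ?thesis by simp
qed

text \<open>
  The left-hand side counts the vertices with fringe \<open>t\<close> that have a parent with fringe in \<open>G\<close>.
\<close>

lemma sum_fringe_freq_children_le:
  assumes "finite G" "increasing_tree ps"
  shows "(\<Sum>s\<in>G. real (child_count s t) * fringe_freq {s} ps) \<le> fringe_freq {t} ps"
proof -
  let ?V = "\<lambda>s. {v \<in> vertices ps. fringe ps v \<in> {s}}" and ?C = "\<lambda>v. {w \<in> children ps v. fringe ps w = t}"
  have "(\<Sum>s\<in>G. child_count s t * card (?V s)) = (\<Sum>s\<in>G. \<Sum>v\<in>?V s. card (?C v))"
  proof (rule sum.cong[OF refl])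
    fix s
    have "(\<Sum>v\<in>?V s. card (?C v)) = (\<Sum>v\<in>?V s. child_count s t)"
      by (rule sum.cong) (auto simp flip: child_count_fringe)
    then show "child_count s t * card (?V s) = (\<Sum>v\<in>?V s. card (?C v))" by simp
  qed
  also have "\<dots> = (\<Sum>v\<in>(\<Union>s\<in>G. ?V s). card (?C v))"
    using assms(1) by (intro sum.UNION_disjoint[symmetric]) auto
  also have "\<dots> = card (\<Union>v\<in>(\<Union>s\<in>G. ?V s). ?C v)"
    using assms(1) by (intro card_UN_disjoint[symmetric]) (auto simp: mem_children_iff finite_children)
  also have "\<dots> \<le> card (?V t)"
    by (intro card_mono) (auto simp: mem_children_iff)
  finally have "real (\<Sum>s\<in>G. child_count s t * card (?V s)) \<le> real (card (?V t))" by (rule of_nat_mono)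
  then have "(\<Sum>s\<in>G. real (child_count s t) * real (card (?V s))) / real (card (vertices ps)) \<le> real (card (?V t)) / real (card (vertices ps))"
    by (intro divide_right_mono) simp_all
  then show ?thesis by (simp only: fringe_freq_def sum_divide_distrib times_divide_eq_right)
qed

lemma sum_child_count_le_measure:
  assumes "finite G"
  shows "(\<Sum>s\<in>G. measure (limit_law p) {s} * real (child_count s t)) \<le> measure (limit_law p) {t}"
proof (rule L1_limit_le)
  show "L1_limit (discrete_tree p) (\<lambda>_ ps. \<Sum>s\<in>G. real (child_count s t) * fringe_freq {s} ps)
      (\<Sum>s\<in>G. measure (limit_law p) {s} * real (child_count s t))"
    by (subst mult.commute, intro L1_limit_sum L1_limit_cmult finite_set_discrete_tree assms fringe_freq_L1_limit)
  show "L1_limit (discrete_tree p) (\<lambda>_. fringe_freq {t}) (measure (limit_law p) {t})"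
    by (rule fringe_freq_L1_limit)
qed (use finite_set_discrete_tree sum_fringe_freq_children_le[OF assms] discrete_tree_support in auto)

text \<open>
  Summing the equations for \<open>t \<in> F\<close> bounds the mass of \<open>F\<close> by the mean root degree, which would be
  below \<open>1\<close> in the supercritical case.
\<close>

lemma fringe_distribution_imp_mean_le:
  assumes "fringe_distribution (limit_law p)"
  shows "mean (measure_pmf p) (\<lambda>z. z) \<le> 1"
proof (rule ccontr)
  interpret L: prob_space "limit_law p" by (rule prob_space_limit_law)
  assume "\<not> ?thesis"
  then have less: "mean (limit_law p) root_degree < 1" by (intro supercritical_means(1)) simp
  then obtain c where c: "mean (limit_law p) root_degree = ennreal c" "c \<ge> 0" "c < 1"
    by (cases "mean (limit_law p) root_degree") auto
  have hs: "((\<lambda>s. measure (limit_law p) {s} * real (child_count s t)) has_sum measure (limit_law p) {t}) UNIV" for t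
    using assms by (simp add: fringe_distribution_def)
  have "measure (limit_law p) F \<le> c" if F: "finite F" for F
  proof -
    have "((\<lambda>s. \<Sum>t\<in>F. measure (limit_law p) {s} * real (child_count s t)) has_sum (\<Sum>t\<in>F. measure (limit_law p) {t})) UNIV"
      using F by (induction F) (auto intro!: has_sum_add hs)
    then have "(\<Sum>t\<in>F. measure (limit_law p) {t}) \<le> c"
    proof (rule has_sum_le_finite_sums)
      fix G :: "rtree set" assume G: "finite G"
      have "(\<Sum>s\<in>G. \<Sum>t\<in>F. measure (limit_law p) {s} * real (child_count s t)) \<le>
          (\<Sum>s\<in>G. measure (limit_law p) {s} * real (root_degree s))"
        unfolding sum_distrib_left[symmetric] of_nat_sum[symmetric]
        by (intro sum_mono mult_left_mono of_nat_mono sum_child_count_le F) simp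
      also have "\<dots> \<le> c" using sum_root_degree_le_mean[OF G, of p] c by simp
      finally show "(\<Sum>s\<in>G. \<Sum>t\<in>F. measure (limit_law p) {s} * real (child_count s t)) \<le> c" .
    qed
    then show ?thesis using F by (subst L.finite_measure_eq_sum_singleton) auto
  qed
  moreover obtain F where "finite F" "measure (limit_law p) F > 1 - (1 - c)"
    using limit_law_tight[of "1 - c" p] c by auto
  ultimately show False by fastforce
qed

text \<open>
  The inequality \<open>\<pi> Q \<le> \<pi>\<close> holds at every tree.  If it were strict at \<open>t\<close>, then the total mass of
  the left-hand side, the mean root degree, would be below \<open>1\<close>.
\<close>

lemma mean_le_imp_fringe_distribution:
  assumes "mean (measure_pmf p) (\<lambda>z. z) \<le> 1" "pmf p 1 \<noteq> 1"
  shows "fringe_distribution (limit_law p)"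
  unfolding fringe_distribution_def
proof (intro conjI tree_prob_limit_law allI)
  interpret L: prob_space "limit_law p" by (rule prob_space_limit_law)
  let ?\<pi> = "\<lambda>t. measure (limit_law p) {t}"
  let ?f = "\<lambda>t s. ?\<pi> s * real (child_count s t)"
  have sm: "?f t summable_on UNIV" for t
    by (rule nonneg_bdd_above_summable_on)
      (auto intro!: bdd_aboveI2[where M = "?\<pi> t"] sum_child_count_le_measure)
  have le: "infsum (?f t) UNIV \<le> ?\<pi> t" for t
    by (rule infsum_le_finite_sums[OF sm]) (rule sum_child_count_le_measure)
  fix t
  have "infsum (?f t) UNIV = ?\<pi> t"
  proof (rule ccontr)
    assume "infsum (?f t) UNIV \<noteq> ?\<pi> t"
    then have less: "infsum (?f t) UNIV < ?\<pi> t" using le[of t] by simp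
    define c where "c = 1 - (?\<pi> t - infsum (?f t) UNIV)"
    have "(\<Sum>s\<in>G. ?\<pi> s * real (root_degree s)) \<le> c" if G: "finite G" for G
    proof -
      \<comment> \<open>No child of the root of a tree in \<open>G\<close> is missed by \<open>F\<close>, so child counts over \<open>F\<close> add up to degrees.\<close>
      define F where "F = insert t (\<Union>s\<in>G. set_mset (subtrees s))"
      have F: "finite F" "t \<in> F" using G by (auto simp: F_def)
      have deg: "root_degree s = (\<Sum>u\<in>F. child_count s u)" if "s \<in> G" for s
        unfolding root_degree_def child_count_def size_multiset_overloaded_eq
        by (rule sum.mono_neutral_left) (use that F in \<open>auto simp: F_def count_eq_zero_iff\<close>)
      have "(\<Sum>s\<in>G. ?\<pi> s * real (root_degree s)) = (\<Sum>u\<in>F. \<Sum>s\<in>G. ?f u s)"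
        by (subst sum.swap) (simp add: deg sum_distrib_left)
      also have "\<dots> \<le> (\<Sum>u\<in>F. infsum (?f u) UNIV)"
        by (intro sum_mono finite_sum_le_infsum sm G) auto
      also have "\<dots> = infsum (?f t) UNIV + (\<Sum>u\<in>F - {t}. infsum (?f u) UNIV)"
        using F by (rule sum.remove)
      also have "\<dots> \<le> infsum (?f t) UNIV + (\<Sum>u\<in>F - {t}. ?\<pi> u)"
        by (intro add_left_mono sum_mono le)
      also have "\<dots> = infsum (?f t) UNIV - ?\<pi> t + (\<Sum>u\<in>F. ?\<pi> u)"
        using sum.remove[OF F, of ?\<pi>] by simp
      also have "(\<Sum>u\<in>F. ?\<pi> u) = measure (limit_law p) F"
        using F(1) by (subst L.finite_measure_eq_sum_singleton) auto
      also have "infsum (?f t) UNIV - ?\<pi> t + measure (limit_law p) F \<le> c"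
        by (simp add: c_def)
      finally show ?thesis .
    qed
    then have "mean (limit_law p) root_degree \<le> ennreal c" by (rule mean_root_degree_le)
    moreover have "c < 1" using less by (simp add: c_def)
    ultimately show False using critical_means(1)[OF assms] by (simp add: ennreal_ge_1)
  qed
  then show "(?f t has_sum ?\<pi> t) UNIV" using has_sum_infsum[OF sm[of t]] by simp
qed

theorem theorem3p3:
  fixes p :: "nat pmf"
  shows
    "(mean (measure_pmf p) (\<lambda>z. z) < \<infinity> \<longrightarrow>
        fringe_converges (discrete_tree p) (limit_law p) \<and>
        (\<forall>k. conv_in_prob (discrete_tree p)
               (\<lambda>n ps. 1 / real (n + 1) * (\<Sum>v\<in>vertices ps. of_bool (vertex_degree ps v = k + 1)))
               (measure (limit_law p) {t. root_degree t = k})))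
     \<and> (pmf p 1 \<noteq> 1 \<longrightarrow>
          (fringe_distribution (limit_law p) \<longleftrightarrow> mean (measure_pmf p) (\<lambda>z. z) \<le> 1))
     \<and> (pmf p 1 \<noteq> 1 \<and> mean (measure_pmf p) (\<lambda>z. z) \<le> 1 \<longrightarrow>
          mean (limit_law p) root_degree = 1 \<and> mean (limit_law p) num_vertices = \<infinity>)
     \<and> (mean (measure_pmf p) (\<lambda>z. z) > 1 \<longrightarrow>
          mean (limit_law p) root_degree < 1 \<and> mean (limit_law p) num_vertices < \<infinity>)"
  using fringe_converges_discrete_tree degree_freq_conv_in_prob fringe_distribution_imp_mean_le
    mean_le_imp_fringe_distribution critical_means supercritical_means
  by blast

end
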